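(* Let $\Omega\subset\mathbb{R}^N$, $N\in\{2,3\}$, together with $\Gamma_M\subset\partial\Omega$, $\bar x$, $\varepsilon_0$, satisfy the geometric assumption of the context. For $i=1,2$ let the data $(a_i,b_i,c_i,d_i,u_{0,i})$ satisfy the coefficient assumption of the context, and suppose that the solvability assumption of the context holds for these data. For $g\in G$ and $i=1,2$ let $u_i(g)$ be a weak solution of $$-\operatorname{div}\big(a_i(t,u)\nabla u+b_i(x,t,u)\big)+c_i(x,t,u,\nabla u)=\tfrac{d}{dt}d_i(t,u)\ \text{ in }\Omega\times(0,T),\quad u=g \text{ on }\partial\Omega\times(0,T),\quad u(0)=u_{0,i}\text{ in }\Omega,$$ and let $j_i(g)$ be the corresponding Neumann flux (all notions as in the context). Assume that $a_1(\tilde t,\tilde g)\neq a_2(\tilde t,\tilde g)$ for some $0<\tilde t<T$ and some $\underline g\le\tilde g\le\overline g$. Then there exists a Dirichlet datum $g\in G$ such that $j_1(g)\not\equiv j_2(g)$ on $\Gamma_M\times(0,T)$.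
   Context: Fixed are $T>0$, real numbers $\underline g<\overline g$, and positive constants $C_A,C_0,C_G,\underline a,\overline a$. $B_r(y)$ is the open ball of radius $r$ about $y$; $n$ is the outward unit normal on $\partial\Omega$; $(\cdot,\cdot)_\Omega$ is the $L^2(\Omega)$ inner product. The space dimension is denoted by $N$; $d_i$ denotes a coefficient function. Geometric assumption: $\Omega\subset\mathbb{R}^N$, $N\in\{2,3\}$, is a bounded Lipschitz domain and $\Gamma_M'\subset\partial\Omega$ is an open smooth part of the boundary with $|\Gamma_M'|\neq0$; $\bar x\in\Gamma_M'$ and $\varepsilon_0>0$ are such that $B_{\varepsilon_0}(\bar x+\varepsilon_0 n(\bar x))\cap\Omega=\emptyset$ and $\Gamma_M:=B_{\varepsilon_0}(\bar x)\cap\partial\Omega\subset\Gamma_M'$. Moreover $\Gamma_M$ is flat: $n(x)=n(\bar x)=e_N$ (the $N$-th unit vector) for $x\in\Gamma_M$. Coefficient assumption: the functions $a=a(t,u)$, $b=b(x,t,u)\in\mathbb{R}^N$, $c=c(x,t,u,p)$, $d=d(t,u)$ (with $x\in\Omega$, $t\in(0,T)$, $u\in\mathbb{R}$, $p\in\mathbb{R}^N$) lie in $W^{1,\infty}$ of their respective domains with norm bounded by $C_A$, $0<\underline a\le a(t,u)\le\overline a$, and $u_0\in L^2(\Omega)$ with $\|u_0\|_{L^2(\Omega)}\le C_0$. Dirichlet data: $G:=\{g\in H^1(0,T;H^1(\partial\Omega)):\ \underline g\le g\le\overline g,\ \|g\|_{H^1(0,T;H^1(\partial\Omega))}\le C_G\}$,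 where $C_G$ is chosen so large that for all $0\le t_1<t_2\le T$, all $\underline g\le g_1<g_2\le\overline g$ and all $0<\varepsilon\le\varepsilon_0$ the function $g_1+\gamma\varepsilon^{(3-N)/2}\chi^\varepsilon_{\bar x}(x)\chi(t)$ on $\partial\Omega\times(0,T)$ has $H^1(0,T;H^1(\partial\Omega))$-norm at most $C_G$; here $\gamma=4(g_2-g_1)\min(1,\varepsilon_0^{(N-3)/2})/T^2$, $\chi(t)=\max\{(t-t_1)(t_2-t),0\}$, and $\chi^\varepsilon_{\bar x}(x)=1$ for $|x-\bar x|\le\varepsilon/2$, $=2-2|x-\bar x|/\varepsilon$ for $\varepsilon/2<|x-\bar x|<\varepsilon$, $=0$ otherwise. Weak solution for data $(a,b,c,d,u_0)$ and $g\in G$: a function $u\in L^2(0,T;H^1(\Omega))\cap C([0,T];L^2(\Omega))$ with $u=g$ on $\partial\Omega\times(0,T)$ and $u(0)=u_0$ in the sense of traces, and $$\int_0^T(a(t,u)\nabla u+b(x,t,u),\nabla\varphi)_\Omega+(c(x,t,u,\nabla u),\varphi)_\Omega\,dt=-\int_0^T(d(t,u),\partial_t\varphi)_\Omega\,dt$$ for all $\varphi\in H^1_0(0,T;H^1_0(\Omega))$. Solvability assumption: for $i=1,2$ and every $g\in G$ a weak solution for the data $(a_i,b_i,c_i,d_i,u_{0,i})$ exists, and every such weak solution satisfies $\|u\|_{L^2(0,T;H^1(\Omega))}\le C_U$ with a constant $C_U$ independent of $i$ and of $g\in G$. Neumann flux: for a weak solution $u$, $j$ is the linear functional on $H^1_0(0,T;H^1(\Omega))$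 given by $$\int_0^T\langle j,\varphi\rangle_{\partial\Omega}\,dt:=\int_0^T(a(t,u)\nabla u+b(x,t,u),\nabla\varphi)_\Omega+(c(x,t,u,\nabla u),\varphi)_\Omega+(d(t,u),\partial_t\varphi)_\Omega\,dt .$$ One says $j\equiv0$ on $\Gamma_M\times(0,T)$ if $\int_0^T\langle j,\varphi\rangle_{\partial\Omega}\,dt=0$ for all $\varphi\in H^1_0(0,T;H^1(\Omega))$ with $\varphi=0$ on $(\partial\Omega\setminus\Gamma_M)\times(0,T)$ in the sense of traces; $j_1\equiv j_2$ on $\Gamma_M\times(0,T)$ means $j_1-j_2\equiv0$ there. *)

theory Defs
  imports "HOL-Analysis.Analysis"
begin

section \<open>Smooth functions and test functions\<close>

primrec C_k :: "nat \<Rightarrow> ('a::euclidean_space \<Rightarrow> real) \<Rightarrow> bool" where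
  "C_k 0 f \<longleftrightarrow> continuous_on UNIV f"
| "C_k (Suc k) f \<longleftrightarrow> f differentiable_on UNIV \<and>
     (\<forall>i\<in>Basis. C_k k (\<lambda>x. frechet_derivative f (at x) i))"

definition smooth :: "('a::euclidean_space \<Rightarrow> real) \<Rightarrow> bool" where
  "smooth f \<longleftrightarrow> (\<forall>k. C_k k f)"

definition test_function :: "'a::euclidean_space set \<Rightarrow> ('a \<Rightarrow> real) \<Rightarrow> bool" where
  "test_function D \<phi> \<longleftrightarrow> smooth \<phi> \<and>
     compact (closure {x. \<phi> x \<noteq> 0}) \<and> closure {x. \<phi> x \<noteq> 0} \<subseteq> D"

definition grad :: "('a::euclidean_space \<Rightarrow> real) \<Rightarrow> 'a \<Rightarrow> 'a" where
  "grad f x = (\<Sum>i\<in>Basis. frechet_derivative f (at x) i *\<^sub>R i)"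


section \<open>Lipschitz domains, outward normal, surface measure\<close>

text \<open>In the ball around \<open>x\<close>, the set \<open>\<Omega>\<close> is the part lying above the graph of \<open>\<psi>\<close>
  in direction \<open>\<nu>\<close>; the function \<open>\<psi>\<close> is only evaluated on the hyperplane orthogonal to \<open>\<nu>\<close>.\<close>

definition local_graph :: "'a::euclidean_space set \<Rightarrow> 'a \<Rightarrow> real \<Rightarrow> 'a \<Rightarrow> ('a \<Rightarrow> real) \<Rightarrow> bool" where
  "local_graph \<Omega> x r \<nu> \<psi> \<longleftrightarrow> r > 0 \<and> norm \<nu> = 1 \<and>
     (\<forall>y\<in>ball x r. y \<in> \<Omega> \<longleftrightarrow> y \<bullet> \<nu> > \<psi> (y - (y \<bullet> \<nu>) *\<^sub>R \<nu>))"

definition bounded_lipschitz_domain :: "'a::euclidean_space set \<Rightarrow> bool" where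
  "bounded_lipschitz_domain \<Omega> \<longleftrightarrow> open \<Omega> \<and> connected \<Omega> \<and> \<Omega> \<noteq> {} \<and> bounded \<Omega> \<and>
     (\<forall>x\<in>frontier \<Omega>. \<exists>r \<nu> \<psi> L. local_graph \<Omega> x r \<nu> \<psi> \<and> L-lipschitz_on UNIV \<psi>)"

definition smooth_boundary_part :: "'a::euclidean_space set \<Rightarrow> 'a set \<Rightarrow> bool" where
  "smooth_boundary_part \<Omega> \<Gamma> \<longleftrightarrow> openin (top_of_set (frontier \<Omega>)) \<Gamma> \<and>
     (\<forall>x\<in>\<Gamma>. \<exists>r \<nu> \<psi>. local_graph \<Omega> x r \<nu> \<psi> \<and> smooth \<psi>)"

text \<open>\<open>\<nu>\<close> is the outward unit normal at the boundary point \<open>x\<close> if, near \<open>x\<close>, the set \<open>\<Omega>\<close>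
  agrees with the half space \<open>(y - x) \<bullet> \<nu> < 0\<close> outside arbitrarily flat cones around the
  tangent plane.  Such a \<open>\<nu>\<close> is unique; for a Lipschitz graph it exists wherever the graph
  function is differentiable, hence almost everywhere on the boundary.\<close>

definition is_outer_normal :: "'a::euclidean_space set \<Rightarrow> 'a \<Rightarrow> 'a \<Rightarrow> bool" where
  "is_outer_normal \<Omega> x \<nu> \<longleftrightarrow> x \<in> frontier \<Omega> \<and> norm \<nu> = 1 \<and>
     (\<forall>\<delta>>0. \<exists>r>0. \<forall>y\<in>ball x r.
        ((y - x) \<bullet> \<nu> < - \<delta> * norm (y - x) \<longrightarrow> y \<in> \<Omega>) \<and>
        ((y - x) \<bullet> \<nu> > \<delta> * norm (y - x) \<longrightarrow> y \<notin> \<Omega>))"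

definition outer_normal :: "'a::euclidean_space set \<Rightarrow> 'a \<Rightarrow> 'a" where
  "outer_normal \<Omega> x = (SOME \<nu>. is_outer_normal \<Omega> x \<nu>)"

text \<open>Hausdorff measure of dimension \<open>s \<ge> 1\<close>, normalised so that it agrees with
  \<open>s\<close>-dimensional Lebesgue measure on \<open>s\<close>-dimensional planes.\<close>

definition hausdorff_pre :: "nat \<Rightarrow> real \<Rightarrow> 'a::euclidean_space set \<Rightarrow> ennreal" where
  "hausdorff_pre s \<delta> A =
     (INF U\<in>{U :: nat \<Rightarrow> 'a set. A \<subseteq> (\<Union>i. U i) \<and> (\<forall>i. bounded (U i) \<and> diameter (U i) \<le> \<delta>)}.
        \<Sum>i. ennreal (unit_ball_vol (real s) * (diameter (U i) / 2) ^ s))"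

definition hausdorff_measure :: "nat \<Rightarrow> 'a::euclidean_space measure" where
  "hausdorff_measure s = measure_of UNIV (sets borel) (\<lambda>A. SUP \<delta>\<in>{0<..}. hausdorff_pre s \<delta> A)"

definition surface :: "'a::euclidean_space set \<Rightarrow> 'a measure" where
  "surface \<Omega> = restrict_space (hausdorff_measure (DIM('a) - 1)) (frontier \<Omega>)"


section \<open>Function spaces in the space variable\<close>

text \<open>Elements of Lebesgue and Sobolev spaces are represented by functions.  A first-order
  space is given by the relation between its members and their (weak, respectively
  tangential) gradients, which are unique up to null sets.\<close>

definition L2_fun :: "'a measure \<Rightarrow> ('a \<Rightarrow> 'b::euclidean_space) \<Rightarrow> bool" where
  "L2_fun \<mu> f \<longleftrightarrow> f \<in> borel_measurable \<mu> \<and> integrable \<mu> (\<lambda>x. (norm (f x))\<^sup>2)"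

definition L2_inner :: "'a measure \<Rightarrow> ('a \<Rightarrow> 'b::euclidean_space) \<Rightarrow> ('a \<Rightarrow> 'b) \<Rightarrow> real" where
  "L2_inner \<mu> f g = (LINT x|\<mu>. f x \<bullet> g x)"

definition L2_norm :: "'a measure \<Rightarrow> ('a \<Rightarrow> 'b::euclidean_space) \<Rightarrow> real" where
  "L2_norm \<mu> f = sqrt (L2_inner \<mu> f f)"

definition L2_conv :: "'a measure \<Rightarrow> ('i \<Rightarrow> 'a \<Rightarrow> 'b::euclidean_space) \<Rightarrow> ('a \<Rightarrow> 'b) \<Rightarrow> 'i filter \<Rightarrow> bool" where
  "L2_conv \<mu> f h F \<longleftrightarrow> ((\<lambda>k. \<integral>\<^sup>+ x. ennreal ((norm (f k x - h x))\<^sup>2) \<partial>\<mu>) \<longlongrightarrow> 0) F"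

definition weak_grad :: "'a::euclidean_space set \<Rightarrow> ('a \<Rightarrow> real) \<Rightarrow> ('a \<Rightarrow> 'a) \<Rightarrow> bool" where
  "weak_grad D v V \<longleftrightarrow> (\<forall>\<phi>. test_function D \<phi> \<longrightarrow> (\<forall>i\<in>Basis.
     (LINT x|lebesgue_on D. v x * (grad \<phi> x \<bullet> i)) = - (LINT x|lebesgue_on D. (V x \<bullet> i) * \<phi> x)))"

text \<open>\<open>f\<close> is the continuous representative of an element of \<open>W\<^sup>1\<^sup>,\<^sup>\<infinity>(D)\<close> of norm at most \<open>C\<close>;
  point values matter because coefficients are composed with solutions.\<close>

definition W1inf_le :: "real \<Rightarrow> 'a::euclidean_space set \<Rightarrow> ('a \<Rightarrow> real) \<Rightarrow> bool" where
  "W1inf_le C D f \<longleftrightarrow> continuous_on D f \<and> (\<forall>z\<in>D. \<bar>f z\<bar> \<le> C) \<and>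
     (\<exists>F. F \<in> borel_measurable (lebesgue_on D) \<and> weak_grad D f F \<and>
          (AE z in lebesgue_on D. norm (F z) \<le> C))"

text \<open>\<open>H\<^sup>1(\<Omega>)\<close>\<close>
definition H1_grad :: "'a::euclidean_space set \<Rightarrow> ('a \<Rightarrow> real) \<Rightarrow> ('a \<Rightarrow> 'a) \<Rightarrow> bool" where
  "H1_grad \<Omega> v V \<longleftrightarrow> L2_fun (lebesgue_on \<Omega>) v \<and> L2_fun (lebesgue_on \<Omega>) V \<and> weak_grad \<Omega> v V"

text \<open>\<open>H\<^sup>1\<^sub>0(\<Omega>)\<close>, the closure of the test functions in \<open>H\<^sup>1(\<Omega>)\<close>\<close>
definition H10_grad :: "'a::euclidean_space set \<Rightarrow> ('a \<Rightarrow> real) \<Rightarrow> ('a \<Rightarrow> 'a) \<Rightarrow> bool" where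
  "H10_grad \<Omega> v V \<longleftrightarrow> H1_grad \<Omega> v V \<and>
     (\<exists>f :: nat \<Rightarrow> 'a \<Rightarrow> real. (\<forall>k. test_function \<Omega> (f k)) \<and>
        L2_conv (lebesgue_on \<Omega>) f v sequentially \<and>
        L2_conv (lebesgue_on \<Omega>) (\<lambda>k. grad (f k)) V sequentially)"

definition tangential_grad :: "'a::euclidean_space set \<Rightarrow> ('a \<Rightarrow> real) \<Rightarrow> 'a \<Rightarrow> 'a" where
  "tangential_grad \<Omega> f x = grad f x - (grad f x \<bullet> outer_normal \<Omega> x) *\<^sub>R outer_normal \<Omega> x"

text \<open>\<open>H\<^sup>1(\<partial>\<Omega>)\<close>, the completion of the restrictions of smooth functions with respect to the norm
  formed by the function and its tangential gradient (on a Lipschitz boundary these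
  restrictions are dense in the space defined by local graph coordinates)\<close>
definition bdry_H1_grad :: "'a::euclidean_space set \<Rightarrow> ('a \<Rightarrow> real) \<Rightarrow> ('a \<Rightarrow> 'a) \<Rightarrow> bool" where
  "bdry_H1_grad \<Omega> h H \<longleftrightarrow> L2_fun (surface \<Omega>) h \<and> L2_fun (surface \<Omega>) H \<and>
     (\<exists>f :: nat \<Rightarrow> 'a \<Rightarrow> real. (\<forall>k. smooth (f k)) \<and>
        L2_conv (surface \<Omega>) f h sequentially \<and>
        L2_conv (surface \<Omega>) (\<lambda>k. tangential_grad \<Omega> (f k)) H sequentially)"

text \<open>The graph of the trace operator from \<open>H\<^sup>1(\<Omega>)\<close> to \<open>L\<^sup>2(\<partial>\<Omega>)\<close>, which is the continuous extension
  of the restriction of smooth functions\<close>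
definition has_trace :: "'a::euclidean_space set \<Rightarrow> ('a \<Rightarrow> real) \<Rightarrow> ('a \<Rightarrow> real) \<Rightarrow> bool" where
  "has_trace \<Omega> v h \<longleftrightarrow> L2_fun (surface \<Omega>) h \<and>
     (\<exists>V. H1_grad \<Omega> v V \<and>
       (\<exists>f :: nat \<Rightarrow> 'a \<Rightarrow> real. (\<forall>k. smooth (f k)) \<and>
          L2_conv (lebesgue_on \<Omega>) f v sequentially \<and>
          L2_conv (lebesgue_on \<Omega>) (\<lambda>k. grad (f k)) V sequentially \<and>
          L2_conv (surface \<Omega>) f h sequentially))"


section \<open>Time-dependent functions\<close>

abbreviation time :: "real \<Rightarrow> real measure" where
  "time T \<equiv> lebesgue_on {0<..<T}"

text \<open>A function from the time interval into a space of functions on \<open>\<mu>\<close> is represented by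
  \<open>u :: real \<Rightarrow> 'a \<Rightarrow> real\<close>.  The spaces \<open>X\<close> below are separable, so strong measurability into \<open>X\<close>
  amounts to joint measurability of the function and its gradient.  The argument \<open>R\<close> is
  the gradient relation of \<open>X\<close>.\<close>

definition has_spatial_grad ::
  "real \<Rightarrow> 'a measure \<Rightarrow> (('a \<Rightarrow> real) \<Rightarrow> ('a \<Rightarrow> 'a) \<Rightarrow> bool) \<Rightarrow>
   (real \<Rightarrow> 'a \<Rightarrow> real) \<Rightarrow> (real \<Rightarrow> 'a::euclidean_space \<Rightarrow> 'a) \<Rightarrow> bool" where
  "has_spatial_grad T \<mu> R u Du \<longleftrightarrow>
     L2_fun (time T \<Otimes>\<^sub>M \<mu>) (\<lambda>(t, x). u t x) \<and> L2_fun (time T \<Otimes>\<^sub>M \<mu>) (\<lambda>(t, x). Du t x) \<and>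
     (AE t in time T. R (u t) (Du t))"

definition spatial_grad ::
  "real \<Rightarrow> 'a measure \<Rightarrow> (('a \<Rightarrow> real) \<Rightarrow> ('a \<Rightarrow> 'a) \<Rightarrow> bool) \<Rightarrow>
   (real \<Rightarrow> 'a \<Rightarrow> real) \<Rightarrow> real \<Rightarrow> 'a::euclidean_space \<Rightarrow> 'a" where
  "spatial_grad T \<mu> R u = (SOME Du. has_spatial_grad T \<mu> R u Du)"

text \<open>\<open>L\<^sup>2(0,T;X)\<close>\<close>
definition L2X where
  "L2X T \<mu> R = {u. \<exists>Du. has_spatial_grad T \<mu> R u Du}"

definition L2X_norm where
  "L2X_norm T \<mu> R u =
     sqrt (LINT t|time T. (L2_norm \<mu> (u t))\<^sup>2 + (L2_norm \<mu> (spatial_grad T \<mu> R u t))\<^sup>2)"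

text \<open>Weak time derivative; the identity between Bochner integrals in \<open>L\<^sup>2(\<mu>)\<close> is read pointwise
  almost everywhere.\<close>
definition has_time_deriv ::
  "real \<Rightarrow> 'a measure \<Rightarrow> (real \<Rightarrow> 'a \<Rightarrow> real) \<Rightarrow> (real \<Rightarrow> 'a \<Rightarrow> real) \<Rightarrow> bool" where
  "has_time_deriv T \<mu> u u' \<longleftrightarrow>
     L2_fun (time T \<Otimes>\<^sub>M \<mu>) (\<lambda>(t, x). u t x) \<and> L2_fun (time T \<Otimes>\<^sub>M \<mu>) (\<lambda>(t, x). u' t x) \<and>
     (\<forall>\<psi>. test_function {0<..<T} \<psi> \<longrightarrow>
        (AE x in \<mu>. (LINT t|time T. u t x * deriv \<psi> t) = - (LINT t|time T. u' t x * \<psi> t)))"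

definition time_deriv ::
  "real \<Rightarrow> 'a measure \<Rightarrow> (real \<Rightarrow> 'a \<Rightarrow> real) \<Rightarrow> real \<Rightarrow> 'a \<Rightarrow> real" where
  "time_deriv T \<mu> u = (SOME u'. has_time_deriv T \<mu> u u')"

text \<open>\<open>H\<^sup>1(0,T;X)\<close>\<close>
definition H1X where
  "H1X T \<mu> R = {u. u \<in> L2X T \<mu> R \<and> (\<exists>u'. has_time_deriv T \<mu> u u' \<and> u' \<in> L2X T \<mu> R)}"

definition H1X_norm where
  "H1X_norm T \<mu> R u = sqrt ((L2X_norm T \<mu> R u)\<^sup>2 + (L2X_norm T \<mu> R (time_deriv T \<mu> u))\<^sup>2)"

text \<open>\<open>C([0,T];L\<^sup>2(\<mu>))\<close>\<close>
definition CL2 :: "real \<Rightarrow> 'a measure \<Rightarrow> (real \<Rightarrow> 'a \<Rightarrow> real) set" where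
  "CL2 T \<mu> = {u. \<forall>t\<in>{0..T}. L2_fun \<mu> (u t) \<and> L2_conv \<mu> u (u t) (at t within {0..T})}"

text \<open>\<open>H\<^sup>1\<^sub>0(0,T;X)\<close>; each class is represented by its members that are continuous in time,
  so that the end point values make sense.\<close>
definition H10X where
  "H10X T \<mu> R = {u. u \<in> H1X T \<mu> R \<and> u \<in> CL2 T \<mu> \<and>
     (AE x in \<mu>. u 0 x = 0) \<and> (AE x in \<mu>. u T x = 0)}"


section \<open>The parabolic problem\<close>

record 'a pde_data =
  coef_a :: "real \<Rightarrow> real \<Rightarrow> real"
  coef_b :: "'a \<Rightarrow> real \<Rightarrow> real \<Rightarrow> 'a"
  coef_c :: "'a \<Rightarrow> real \<Rightarrow> real \<Rightarrow> 'a \<Rightarrow> real"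
  coef_d :: "real \<Rightarrow> real \<Rightarrow> real"
  init :: "'a \<Rightarrow> real"

definition geometric_assumption ::
  "'a::euclidean_space set \<Rightarrow> 'a set \<Rightarrow> 'a \<Rightarrow> real \<Rightarrow> 'a \<Rightarrow> bool" where
  "geometric_assumption \<Omega> \<Gamma>' xbar \<epsilon>0 e \<longleftrightarrow>
     bounded_lipschitz_domain \<Omega> \<and>
     \<Gamma>' \<subseteq> frontier \<Omega> \<and> smooth_boundary_part \<Omega> \<Gamma>' \<and> emeasure (surface \<Omega>) \<Gamma>' \<noteq> 0 \<and>
     xbar \<in> \<Gamma>' \<and> \<epsilon>0 > 0 \<and>
     ball (xbar + \<epsilon>0 *\<^sub>R outer_normal \<Omega> xbar) \<epsilon>0 \<inter> \<Omega> = {} \<and>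
     ball xbar \<epsilon>0 \<inter> frontier \<Omega> \<subseteq> \<Gamma>' \<and>
     (\<forall>x\<in>ball xbar \<epsilon>0 \<inter> frontier \<Omega>. is_outer_normal \<Omega> x e)"

definition coefficient_assumption ::
  "real \<Rightarrow> 'a::euclidean_space set \<Rightarrow> real \<Rightarrow> real \<Rightarrow> real \<Rightarrow> real \<Rightarrow> 'a pde_data \<Rightarrow> bool" where
  "coefficient_assumption T \<Omega> C\<^sub>A C\<^sub>0 a_lo a_up P \<longleftrightarrow>
     W1inf_le C\<^sub>A ({0<..<T} \<times> UNIV) (\<lambda>(t, s). coef_a P t s) \<and>
     (\<forall>i\<in>Basis. W1inf_le C\<^sub>A (\<Omega> \<times> {0<..<T} \<times> UNIV) (\<lambda>(x, t, s). coef_b P x t s \<bullet> i)) \<and>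
     W1inf_le C\<^sub>A (\<Omega> \<times> {0<..<T} \<times> UNIV \<times> UNIV) (\<lambda>(x, t, s, p). coef_c P x t s p) \<and>
     W1inf_le C\<^sub>A ({0<..<T} \<times> UNIV) (\<lambda>(t, s). coef_d P t s) \<and>
     (\<forall>t\<in>{0<..<T}. \<forall>s. a_lo \<le> coef_a P t s \<and> coef_a P t s \<le> a_up) \<and>
     L2_fun (lebesgue_on \<Omega>) (init P) \<and> L2_norm (lebesgue_on \<Omega>) (init P) \<le> C\<^sub>0"

definition dirichlet_data ::
  "real \<Rightarrow> 'a::euclidean_space set \<Rightarrow> real \<Rightarrow> real \<Rightarrow> real \<Rightarrow> (real \<Rightarrow> 'a \<Rightarrow> real) set" where
  "dirichlet_data T \<Omega> g_lo g_up C\<^sub>G =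
     {g \<in> H1X T (surface \<Omega>) (bdry_H1_grad \<Omega>).
        (AE (t, x) in time T \<Otimes>\<^sub>M surface \<Omega>. g_lo \<le> g t x \<and> g t x \<le> g_up) \<and>
        H1X_norm T (surface \<Omega>) (bdry_H1_grad \<Omega>) g \<le> C\<^sub>G}"

definition space_cutoff :: "'a::euclidean_space \<Rightarrow> real \<Rightarrow> 'a \<Rightarrow> real" where
  "space_cutoff xbar \<epsilon> x =
     (if norm (x - xbar) \<le> \<epsilon> / 2 then 1
      else if norm (x - xbar) < \<epsilon> then 2 - 2 * norm (x - xbar) / \<epsilon> else 0)"

definition time_cutoff :: "real \<Rightarrow> real \<Rightarrow> real \<Rightarrow> real" where
  "time_cutoff t1 t2 t = max ((t - t1) * (t2 - t)) 0"

definition peak_data ::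
  "real \<Rightarrow> 'a::euclidean_space \<Rightarrow> real \<Rightarrow> real \<Rightarrow> real \<Rightarrow> real \<Rightarrow> real \<Rightarrow> real \<Rightarrow> real \<Rightarrow> 'a \<Rightarrow> real" where
  "peak_data T xbar \<epsilon>0 t1 t2 g1 g2 \<epsilon> t x =
     (let \<gamma> = 4 * (g2 - g1) * min 1 (\<epsilon>0 powr ((real DIM('a) - 3) / 2)) / T\<^sup>2
      in g1 + \<gamma> * \<epsilon> powr ((3 - real DIM('a)) / 2) * space_cutoff xbar \<epsilon> x * time_cutoff t1 t2 t)"

definition data_bound_large_enough ::
  "real \<Rightarrow> 'a::euclidean_space set \<Rightarrow> 'a \<Rightarrow> real \<Rightarrow> real \<Rightarrow> real \<Rightarrow> real \<Rightarrow> bool" where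
  "data_bound_large_enough T \<Omega> xbar \<epsilon>0 g_lo g_up C\<^sub>G \<longleftrightarrow>
     (\<forall>t1 t2 g1 g2 \<epsilon>. 0 \<le> t1 \<and> t1 < t2 \<and> t2 \<le> T \<and> g_lo \<le> g1 \<and> g1 < g2 \<and> g2 \<le> g_up \<and>
          0 < \<epsilon> \<and> \<epsilon> \<le> \<epsilon>0 \<longrightarrow>
        peak_data T xbar \<epsilon>0 t1 t2 g1 g2 \<epsilon> \<in> H1X T (surface \<Omega>) (bdry_H1_grad \<Omega>) \<and>
        H1X_norm T (surface \<Omega>) (bdry_H1_grad \<Omega>) (peak_data T xbar \<epsilon>0 t1 t2 g1 g2 \<epsilon>) \<le> C\<^sub>G)"

definition weak_solution ::
  "real \<Rightarrow> 'a::euclidean_space set \<Rightarrow> 'a pde_data \<Rightarrow> (real \<Rightarrow> 'a \<Rightarrow> real) \<Rightarrow> (real \<Rightarrow> 'a \<Rightarrow> real) \<Rightarrow> bool" where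
  "weak_solution T \<Omega> P g u \<longleftrightarrow>
     (let \<mu> = lebesgue_on \<Omega>; Dx = spatial_grad T \<mu> (H1_grad \<Omega>) in
        u \<in> L2X T \<mu> (H1_grad \<Omega>) \<and> u \<in> CL2 T \<mu> \<and>
        (AE t in time T. has_trace \<Omega> (u t) (g t)) \<and>
        (AE x in \<mu>. u 0 x = init P x) \<and>
        (\<forall>\<phi>\<in>H10X T \<mu> (H10_grad \<Omega>).
          (LINT t|time T.
             L2_inner \<mu> (\<lambda>x. coef_a P t (u t x) *\<^sub>R Dx u t x + coef_b P x t (u t x)) (Dx \<phi> t)
           + L2_inner \<mu> (\<lambda>x. coef_c P x t (u t x) (Dx u t x)) (\<phi> t))
          = - (LINT t|time T. L2_inner \<mu> (\<lambda>x. coef_d P t (u t x)) (time_deriv T \<mu> \<phi> t))))"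

definition neumann_flux ::
  "real \<Rightarrow> 'a::euclidean_space set \<Rightarrow> 'a pde_data \<Rightarrow> (real \<Rightarrow> 'a \<Rightarrow> real) \<Rightarrow> (real \<Rightarrow> 'a \<Rightarrow> real) \<Rightarrow> real" where
  "neumann_flux T \<Omega> P u \<phi> =
     (let \<mu> = lebesgue_on \<Omega>; Dx = spatial_grad T \<mu> (H1_grad \<Omega>) in
        LINT t|time T.
           L2_inner \<mu> (\<lambda>x. coef_a P t (u t x) *\<^sub>R Dx u t x + coef_b P x t (u t x)) (Dx \<phi> t)
         + L2_inner \<mu> (\<lambda>x. coef_c P x t (u t x) (Dx u t x)) (\<phi> t)
         + L2_inner \<mu> (\<lambda>x. coef_d P t (u t x)) (time_deriv T \<mu> \<phi> t))"

definition vanishes_on ::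
  "real \<Rightarrow> 'a::euclidean_space set \<Rightarrow> 'a set \<Rightarrow> ((real \<Rightarrow> 'a \<Rightarrow> real) \<Rightarrow> real) \<Rightarrow> bool" where
  "vanishes_on T \<Omega> \<Gamma> J \<longleftrightarrow>
     (\<forall>\<phi>\<in>H10X T (lebesgue_on \<Omega>) (H1_grad \<Omega>).
        (AE t in time T. \<exists>h. has_trace \<Omega> (\<phi> t) h \<and> (AE x in surface \<Omega>. x \<notin> \<Gamma> \<longrightarrow> h x = 0)) \<longrightarrow>
        J \<phi> = 0)"

definition solvability_assumption ::
  "real \<Rightarrow> 'a::euclidean_space set \<Rightarrow> (real \<Rightarrow> 'a \<Rightarrow> real) set \<Rightarrow> real \<Rightarrow> 'a pde_data \<Rightarrow> bool" where
  "solvability_assumption T \<Omega> G C\<^sub>U P \<longleftrightarrow>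
     (\<forall>g\<in>G. (\<exists>u. weak_solution T \<Omega> P g u) \<and>
       (\<forall>u. weak_solution T \<Omega> P g u \<longrightarrow> L2X_norm T (lebesgue_on \<Omega>) (H1_grad \<Omega>) u \<le> C\<^sub>U))"

end

theory Submission
  imports Defs "HOL-Analysis.Analysis"
begin

text \<open>Write \<open>A\<^sub>i(t, s)\<close> for the primitive of \<open>a\<^sub>i(t, \<cdot>)\<close> vanishing at \<open>g\<^sub>1\<close>, so that \<open>a\<^sub>i(t, u) \<nabla>u\<close> is the
  gradient of \<open>A\<^sub>i(t, u)\<close>.  Testing the flux with \<open>\<eta>(t) \<Phi>(x)\<close> and integrating by parts on the half ball that \<open>\<Omega>\<close>
  is near \<open>xbar\<close>, the leading term becomes the integral of \<open>A\<^sub>i(t, g) \<partial>\<^sub>n\<Phi>\<close> over the flat boundary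
  part minus the integral of \<open>A\<^sub>i(t, u) \<Delta>\<Phi>\<close> over \<open>\<Omega>\<close>.  For \<open>\<Phi>\<close> take a dipole with pole \<open>xbar + \<epsilon> e\<close>
  outside \<open>\<Omega>\<close>, times a fixed cutoff.  It is harmonic near \<open>xbar\<close>, so \<open>\<Delta>\<Phi>\<close> is bounded uniformly in \<open>\<epsilon>\<close>;
  since \<open>b\<close>, \<open>c\<close>, \<open>d\<close> are bounded, the lower-order terms are controlled by the \<open>W\<^sup>1\<^sup>,\<^sup>1\<close> norm of \<open>\<Phi>\<close>,
  which is \<open>O(\<epsilon>\<^bsup>-1/4\<^esup>)\<close>.  If \<open>a\<^sub>1 > a\<^sub>2\<close> near \<open>(t_star, g_star)\<close> and \<open>g\<close> is a peak of width \<open>\<epsilon>\<close> with values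
  near \<open>g_star\<close>, then the difference of the boundary terms has a sign and is at least a multiple of
  \<open>\<epsilon>\<^bsup>(1-N)/2\<^esup>\<close>, which wins for small \<open>\<epsilon>\<close>.

  The surface measure enters only through two facts: it dominates a multiple of Lebesgue measure on the flat
  part, and it is finite.  That the Hausdorff set function is a measure at all is read off from the assumption
  that \<open>\<Gamma>'\<close> has positive measure, and finiteness from the assumption that constants belong to
  \<open>H\<^sup>1(\<partial>\<Omega>)\<close>.\<close>

section \<open>Calculus of smooth functions\<close>

text \<open>The powers of \<epsilon> balance as follows. A peak of width \<epsilon> may have height
  of order \<epsilon>^((3-N)/2): its surface gradient is then of order \<epsilon>^((1-N)/2) on a set
  of area \<epsilon>^(N-1), so the H^1 norm stays bounded and the peak remains an admissible datum.
  The normal derivative of the dipole is of order \<epsilon>^(-N) there, and height times derivative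
  times area is \<epsilon>^((1-N)/2), at least \<epsilon>^(-1/2). The gradient of the dipole has
  size |z|^(-N), z being the vector from the pole, which just fails to be integrable; giving up a
  factor \<epsilon>^(-1/4) makes it integrable uniformly in \<epsilon> and still loses against
  \<epsilon>^(-1/2). The normal derivative changes sign away from \<open>xbar\<close>. This is
  harmless because both primitives vanish at \<open>g1\<close>, the value of the datum off the peak,
  so only a region where the derivative is nonnegative is seen. The two solutions are never compared
  with each other. Each enters through its own L^1 norm, controlled by \<open>C\<^sub>U\<close>,
  because the Laplacian of the test function is bounded. The comparison is made at almost every
  time, with one pair of primitives per time slice.\<close>

abbreviation pd :: "'a::euclidean_space \<Rightarrow> ('a \<Rightarrow> real) \<Rightarrow> 'a \<Rightarrow> real" where
  "pd i f x \<equiv> frechet_derivative f (at x) i"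

lemma pd_eqI: "(f has_derivative f') (at x) \<Longrightarrow> pd i f x = f' i"
  by (metis frechet_derivative_at)

lemma C_k_differentiable: "C_k (Suc k) f \<Longrightarrow> f differentiable (at x)"
  by (simp add: differentiable_on_def)

lemma C_k_SucD: "C_k (Suc k) f \<Longrightarrow> C_k k f"
proof (induction k arbitrary: f)
  case 0
  then show ?case by (auto intro: differentiable_imp_continuous_on)
next
  case (Suc k)
  then show ?case by (metis C_k.simps(2))
qed

lemma C_k_const: "C_k k (\<lambda>x. c)"
proof (induction k arbitrary: c)
  case (Suc k)
  have "pd i (\<lambda>x::'a. c) x = 0" for i x
    by (rule pd_eqI) (rule has_derivative_const)
  then show ?case using Suc[of 0] by simp
qed simp

lemma C_k_inner_right: "C_k k (\<lambda>x. x \<bullet> v)"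
proof (cases k)
  case 0
  then show ?thesis by (simp add: continuous_intros)
next
  case (Suc m)
  have *: "((\<lambda>x::'a. x \<bullet> v) has_derivative (\<lambda>h. h \<bullet> v)) (at x)" for x
    by (auto intro!: derivative_eq_intros)
  have "pd i (\<lambda>x::'a. x \<bullet> v) x = i \<bullet> v" for i x
    by (rule pd_eqI) (rule *)
  moreover have "(\<lambda>x::'a. x \<bullet> v) differentiable_on UNIV"
    using * unfolding differentiable_on_def differentiable_def by blast
  ultimately show ?thesis using Suc by (simp add: C_k_const)
qed

lemma pd_add:
  assumes "f differentiable (at x)" "g differentiable (at x)"
  shows "pd i (\<lambda>x. f x + g x) x = pd i f x + pd i g x"
proof -
  have "((\<lambda>x. f x + g x) has_derivative (\<lambda>h. pd h f x + pd h g x)) (at x)"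
    using assms[THEN frechet_derivative_works[THEN iffD1]] by (intro has_derivative_add)
  then show ?thesis by (simp add: pd_eqI)
qed

lemma pd_mult:
  assumes "f differentiable (at x)" "g differentiable (at x)"
  shows "pd i (\<lambda>x. f x * g x) x = pd i f x * g x + f x * pd i g x"
proof -
  have "((\<lambda>x. f x * g x) has_derivative (\<lambda>h. f x * pd h g x + pd h f x * g x)) (at x)"
    using assms[THEN frechet_derivative_works[THEN iffD1]] by (intro has_derivative_mult)
  then show ?thesis by (simp add: pd_eqI)
qed

lemma pd_chain:
  assumes "f differentiable (at x)" "(u has_real_derivative d) (at (f x))"
  shows "pd i (\<lambda>x. u (f x)) x = d * pd i f x" "(\<lambda>x. u (f x)) differentiable (at x)"
proof -
  have "((\<lambda>x. u (f x)) has_derivative (\<lambda>h. d * pd h f x)) (at x)"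
    using has_derivative_compose[OF assms(1)[THEN frechet_derivative_works[THEN iffD1]], of u "\<lambda>h. d * h"] assms(2)
    by (simp add: has_field_derivative_def)
  then show "pd i (\<lambda>x. u (f x)) x = d * pd i f x" "(\<lambda>x. u (f x)) differentiable (at x)"
    by (auto simp add: pd_eqI differentiable_def)
qed

lemma C_k_add: "C_k k f \<Longrightarrow> C_k k g \<Longrightarrow> C_k k (\<lambda>x. f x + g x)"
proof (induction k arbitrary: f g)
  case 0
  then show ?case by (simp add: continuous_intros)
next
  case (Suc k)
  note d = Suc.prems[THEN C_k_differentiable]
  have "(\<lambda>x. pd i (\<lambda>x. f x + g x) x) = (\<lambda>x. pd i f x + pd i g x)" for i
    using pd_add[OF d] by blast
  then show ?case using Suc by (auto simp: differentiable_on_def)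
qed

lemma C_k_mult: "C_k k f \<Longrightarrow> C_k k g \<Longrightarrow> C_k k (\<lambda>x. f x * g x)"
proof (induction k arbitrary: f g)
  case 0
  then show ?case by (simp add: continuous_intros)
next
  case (Suc k)
  note d = Suc.prems[THEN C_k_differentiable]
  have "(\<lambda>x. pd i (\<lambda>x. f x * g x) x) = (\<lambda>x. pd i f x * g x + f x * pd i g x)" for i
    using pd_mult[OF d] by blast
  moreover have "C_k k f" "C_k k g" using Suc.prems C_k_SucD by blast+
  ultimately show ?case using Suc by (simp add: C_k_add)
qed

lemma C_k_diff: "C_k k f \<Longrightarrow> C_k k g \<Longrightarrow> C_k k (\<lambda>x. f x - g x)"
  using C_k_add[of k f "\<lambda>x. (-1) * g x"] C_k_mult[OF C_k_const] by fastforce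

lemma C_k_sum: "(\<And>j. j \<in> J \<Longrightarrow> C_k k (f j)) \<Longrightarrow> C_k k (\<lambda>x. \<Sum>j\<in>J. f j x)"
  by (induction J rule: infinite_finite_induct) (auto simp: C_k_const C_k_add)

lemma C_k_prod: "(\<And>j. j \<in> J \<Longrightarrow> C_k k (f j)) \<Longrightarrow> C_k k (\<lambda>x. \<Prod>j\<in>J. f j x)"
  by (induction J rule: infinite_finite_induct) (auto simp: C_k_const C_k_mult)

text \<open>The functions \<open>flat m\<close> span all derivatives of \<open>flat 0\<close>, the standard non-analytic
  smooth function.\<close>

definition flat :: "nat \<Rightarrow> real \<Rightarrow> real" where
  "flat m s = (if s > 0 then exp (- 1 / s) / s ^ m else 0)"

lemma flat_nonneg: "flat m s \<ge> 0"
  by (simp add: flat_def)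

lemma flat_pos: "s > 0 \<Longrightarrow> flat m s > 0"
  by (simp add: flat_def)

lemma flat_eq_0: "s \<le> 0 \<Longrightarrow> flat m s = 0"
  by (simp add: flat_def)

lemma flat_0_le_1: "flat 0 s \<le> 1"
  by (simp add: flat_def)

text \<open>The substitution s = 1/y turns the limit from the right at zero into that of y^m / exp y
  at infinity.\<close>

lemma flat_tendsto_0: "(flat m \<longlongrightarrow> 0) (at 0)"
proof -
  have "((\<lambda>x. x ^ m / exp x) \<longlongrightarrow> (0::real)) at_top"
    by (rule tendsto_power_div_exp_0)
  then have "((\<lambda>x::real. inverse x ^ m / exp (inverse x)) \<longlongrightarrow> 0) (at_right 0)"
    by (simp add: filterlim_at_right_to_top)
  then have "(flat m \<longlongrightarrow> 0) (at_right 0)"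
    by (rule Lim_transform_eventually)
      (auto simp: eventually_at_right_less flat_def eventually_at_filter field_simps exp_minus
        power_inverse intro!: always_eventually)
  moreover have "(flat m \<longlongrightarrow> 0) (at_left 0)"
    by (rule tendsto_eventually) (auto simp: eventually_at_filter flat_def)
  ultimately show ?thesis by (simp add: filterlim_split_at_real)
qed

lemma flat_has_derivative:
  "(flat m has_real_derivative (flat (m + 2) s - real m * flat (m + 1) s)) (at s)"
proof -
  consider "s > 0" | "s < 0" | "s = 0" by linarith
  then show ?thesis
  proof cases
    case 1
    have "((\<lambda>s. exp (- 1 / s) / s ^ m) has_real_derivative (flat (m + 2) s - real m * flat (m + 1) s)) (at s)"
    proof (cases m)
      case 0
      with 1 show ?thesis
        by (auto intro!: derivative_eq_intros simp: flat_def power2_eq_square)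
    next
      case (Suc j)
      with 1 show ?thesis
        by (auto intro!: derivative_eq_intros simp: flat_def field_simps power2_eq_square simp del: power_Suc)
           (simp add: algebra_simps power2_eq_square)
    qed
    then show ?thesis
      by (rule has_field_derivative_transform_within_open[where S = "{0<..}"]) (use 1 in \<open>auto simp: flat_def\<close>)
  next
    case 2
    have "((\<lambda>s. 0) has_real_derivative 0) (at s)" by simp
    then have "(flat m has_real_derivative 0) (at s)"
      by (rule has_field_derivative_transform_within_open[where S = "{..<0}"]) (use 2 in \<open>auto simp: flat_def\<close>)
    then show ?thesis using 2 by (simp add: flat_def)
  next
    case 3
    \<comment> \<open>At the origin the difference quotient of \<open>flat m\<close> is
      \<open>flat (Suc m)\<close>, so differentiability there is \<open>flat_tendsto_0\<close> one
      index higher.\<close>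
    have "((\<lambda>h. flat m h / h) \<longlongrightarrow> 0) (at 0)"
      by (rule Lim_transform_eventually[OF flat_tendsto_0[of "Suc m"]])
         (auto simp: flat_def eventually_at_filter field_simps)
    then show ?thesis using 3 by (simp add: DERIV_def flat_def)
  qed
qed

text \<open>The index \<open>m\<close> is arbitrary in the induction because each differentiation
  replaces \<open>flat m\<close> by a combination of \<open>flat (m + 1)\<close> and
  \<open>flat (m + 2)\<close>.\<close>

lemma C_k_flat: "C_k k f \<Longrightarrow> C_k k (\<lambda>x. flat m (f x))"
proof (induction k arbitrary: m)
  case 0
  have "continuous_on UNIV (flat m)"
    by (meson DERIV_isCont continuous_at_imp_continuous_on flat_has_derivative)
  then show ?case using 0 continuous_on_compose2 by fastforce
next
  case (Suc k)
  note d = C_k_differentiable[OF Suc.prems]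
  have f: "C_k k f" using Suc.prems by (rule C_k_SucD)
  have "(\<lambda>x. pd i (\<lambda>x. flat m (f x)) x) =
      (\<lambda>x. (flat (m + 2) (f x) + (- real m) * flat (m + 1) (f x)) * pd i f x)" for i
    using pd_chain(1)[OF d flat_has_derivative[of m], where i=i] by auto
  then show ?case using Suc.prems Suc.IH[OF f] pd_chain(2)[OF d flat_has_derivative[of m]]
    by (auto simp: differentiable_on_def intro!: C_k_mult C_k_add C_k_diff C_k_const)
qed

lemma C_k_powr:
  assumes "C_k k f" "\<And>x. f x > 0"
  shows "C_k k (\<lambda>x. f x powr a)"
  using assms(1)
proof (induction k arbitrary: a)
  case 0
  then show ?case using assms(2)
    by (auto intro!: continuous_on_powr dest: less_imp_neq[symmetric])
next
  case (Suc k)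
  note d = C_k_differentiable[OF Suc.prems]
  have f: "C_k k f" using Suc.prems by (rule C_k_SucD)
  have D: "((\<lambda>s. s powr a) has_real_derivative (a * f x powr (a - 1))) (at (f x))" for x
    by (rule has_real_derivative_powr) (rule assms(2))
  have "(\<lambda>x. pd i (\<lambda>x. f x powr a) x) = (\<lambda>x. (a * f x powr (a - 1)) * pd i f x)" for i
    by (intro ext pd_chain(1)[OF d D])
  then show ?case using Suc.prems Suc.IH[OF f] pd_chain(2)[OF d D]
    by (auto simp add: differentiable_on_def intro!: C_k_mult C_k_const)
qed

section \<open>Closure properties of smooth functions\<close>

lemma smooth_const: "smooth (\<lambda>x. c)"
  by (simp add: smooth_def C_k_const)

lemma smooth_inner_right: "smooth (\<lambda>x. x \<bullet> v)"
  by (simp add: smooth_def C_k_inner_right)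

lemma smooth_add: "smooth f \<Longrightarrow> smooth g \<Longrightarrow> smooth (\<lambda>x. f x + g x)"
  by (simp add: smooth_def C_k_add)

lemma smooth_mult: "smooth f \<Longrightarrow> smooth g \<Longrightarrow> smooth (\<lambda>x. f x * g x)"
  by (simp add: smooth_def C_k_mult)

lemma smooth_diff: "smooth f \<Longrightarrow> smooth g \<Longrightarrow> smooth (\<lambda>x. f x - g x)"
  by (simp add: smooth_def C_k_diff)

lemma smooth_sum: "(\<And>j. j \<in> J \<Longrightarrow> smooth (f j)) \<Longrightarrow> smooth (\<lambda>x. \<Sum>j\<in>J. f j x)"
  by (simp add: smooth_def C_k_sum)

lemma smooth_prod: "(\<And>j. j \<in> J \<Longrightarrow> smooth (f j)) \<Longrightarrow> smooth (\<lambda>x. \<Prod>j\<in>J. f j x)"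
  by (simp add: smooth_def C_k_prod)

lemma smooth_flat: "smooth f \<Longrightarrow> smooth (\<lambda>x. flat m (f x))"
  by (simp add: smooth_def C_k_flat)

lemma smooth_powr: "smooth f \<Longrightarrow> (\<And>x. f x > 0) \<Longrightarrow> smooth (\<lambda>x. f x powr a)"
  by (simp add: smooth_def C_k_powr)

lemma smooth_norm_diff_sq: "smooth (\<lambda>x::'a::euclidean_space. (norm (x - c))\<^sup>2)"
proof -
  have "(\<lambda>x. (norm (x - c))\<^sup>2) = (\<lambda>x. \<Sum>i\<in>Basis. (x \<bullet> i - c \<bullet> i) * (x \<bullet> i - c \<bullet> i))"
    by (subst power2_norm_eq_inner, subst euclidean_inner) (simp add: inner_diff_left)
  then show ?thesis
    by (auto intro!: smooth_sum smooth_mult smooth_diff smooth_const smooth_inner_right)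
qed

lemma smooth_differentiable: "smooth f \<Longrightarrow> f differentiable (at x)"
  unfolding smooth_def using C_k_differentiable by blast

lemma smooth_continuous: "smooth f \<Longrightarrow> continuous_on S f"
  unfolding smooth_def using C_k.simps(1) continuous_on_subset by blast

lemma smooth_pd: "smooth f \<Longrightarrow> i \<in> Basis \<Longrightarrow> smooth (\<lambda>x. pd i f x)"
  unfolding smooth_def using C_k.simps(2) by blast

lemma grad_inner_Basis: "i \<in> Basis \<Longrightarrow> grad f x \<bullet> i = pd i f x"
  unfolding grad_def by (simp add: inner_sum_left inner_Basis if_distrib sum.If_cases cong: if_cong)

lemma smooth_continuous_grad: "smooth f \<Longrightarrow> continuous_on S (grad f)"
  unfolding grad_def by (intro continuous_intros smooth_continuous[OF smooth_pd])

lemma grad_eq_sum: "grad f x \<bullet> v = (\<Sum>i\<in>Basis. pd i f x * (v \<bullet> i))"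
  unfolding grad_def by (simp add: inner_sum_left inner_commute[of v])

lemma grad_inner_grad: "grad f x \<bullet> grad h x = (\<Sum>i\<in>Basis. pd i f x * pd i h x)"
  by (subst grad_eq_sum) (simp add: grad_inner_Basis)

lemma pd_eq_0_outside_support:
  assumes "x \<notin> closure {x. f x \<noteq> 0}"
  shows "pd i f x = 0"
proof -
  have "((\<lambda>x. 0) has_derivative (\<lambda>h. 0)) (at x)" by simp
  then have "(f has_derivative (\<lambda>h. 0)) (at x)"
  proof (rule has_derivative_transform_within_open[of _ _ _ _ "- closure {x. f x \<noteq> 0}"])
    show "0 = f z" if "z \<in> - closure {x. f x \<noteq> 0}" for z
      using that closure_subset[of "{x. f x \<noteq> 0}"] by auto
  qed (use assms in auto)
  then show ?thesis by (rule pd_eqI)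
qed

lemma pd_cong_open:
  assumes "open S" "x \<in> S" "\<And>y. y \<in> S \<Longrightarrow> f y = g y" "f differentiable (at x)"
  shows "pd i f x = pd i g x"
proof -
  have "(g has_derivative (\<lambda>h. pd h f x)) (at x)"
    using assms(4)[THEN frechet_derivative_works[THEN iffD1]] assms(1-3)
    by (rule has_derivative_transform_within_open) auto
  then show ?thesis by (simp add: pd_eqI)
qed

section \<open>Integration by parts on half spaces\<close>

text \<open>Lebesgue measure on a hyperplane orthogonal to the basis vector \<open>e\<close>, in
  coordinates: points of the plane are functions on \<open>Basis - {e}\<close>. This is the factor
  that remains when Fubini splits the coordinate \<open>e\<close> off from \<open>lborel\<close>;
  \<open>pt e c\<close> embeds it at height \<open>c\<close>.\<close>

definition plane_measure :: "'a::euclidean_space \<Rightarrow> ('a \<Rightarrow> real) measure" where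
  "plane_measure e = Pi\<^sub>M (Basis - {e}) (\<lambda>_. lborel)"

definition pt :: "'a::euclidean_space \<Rightarrow> real \<Rightarrow> ('a \<Rightarrow> real) \<Rightarrow> 'a" where
  "pt e c x = c *\<^sub>R e + (\<Sum>b\<in>Basis - {e}. x b *\<^sub>R b)"

lemma pt_inner: "b \<in> Basis \<Longrightarrow> e \<in> Basis \<Longrightarrow> pt e c x \<bullet> b = (if b = e then c else x b)"
  by (auto simp: pt_def inner_add_left inner_sum_left inner_Basis if_distrib sum.If_cases
      inner_scaleR_left cong: if_cong intro!: trans[OF sum.cong[OF refl, of _ _ "\<lambda>j. if j = b then x b else 0"]])

lemma measurable_pt [measurable]: "pt e c \<in> borel_measurable (plane_measure e)"
  unfolding pt_def plane_measure_def by measurable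

text \<open>\<open>lborel\<close> is the image of the product of one-dimensional Lebesgue measures
  under the coordinate map, so this is Fubini with the coordinate \<open>e\<close> integrated
  first.\<close>

lemma lborel_integral_split:
  fixes f :: "'a::euclidean_space \<Rightarrow> real"
  assumes e: "e \<in> Basis" and f: "integrable lborel f"
  shows "integral\<^sup>L lborel f = (LINT x|plane_measure e. LINT s|lborel. f (pt e s x))"
proof -
  interpret product_sigma_finite "\<lambda>_::'a. lborel :: real measure" by standard
  let ?P = "\<lambda>g. \<Sum>b\<in>Basis. g b *\<^sub>R b :: 'a"
  have P: "?P \<in> Pi\<^sub>M Basis (\<lambda>_. lborel) \<rightarrow>\<^sub>M borel" by measurable
  have P_upd: "?P (x(e := s)) = pt e s x" for x s
    unfolding pt_def by (subst sum.remove[OF _ e]) auto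
  have ins: "insert e (Basis - {e}) = Basis" using e by auto
  have fB: "f \<in> borel_measurable borel" using f by auto
  have "integral\<^sup>L lborel f = (LINT g|Pi\<^sub>M Basis (\<lambda>_. lborel). f (?P g))"
    by (subst lborel_eq, rule integral_distr[OF P fB])
  also have "\<dots> = (LINT x|plane_measure e. LINT s|lborel. f (?P (x(e := s))))"
    unfolding plane_measure_def
    by (subst product_integral_insert[of "Basis - {e}" e "\<lambda>g. f (?P g)", unfolded ins, symmetric])
      (use f in \<open>auto simp: lborel_eq[where 'a='a] integrable_distr_eq[OF P fB]\<close>)
  finally show ?thesis unfolding P_upd .
qed

lemma FTC_compact_support:
  fixes G G' :: "real \<Rightarrow> real"
  assumes G: "\<And>s. (G has_real_derivative G' s) (at s)" and G': "continuous_on UNIV G'"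
    and supp: "\<And>s. \<bar>s\<bar> > R \<Longrightarrow> G s = 0"
  shows "(LINT s|lborel. indicator {..<c} s * G' s) = G c" "(LINT s|lborel. G' s) = 0"
proof -
  define M where "M = max R \<bar>c\<bar> + 1"
  have M: "M > R" "M > \<bar>c\<bar>" by (auto simp: M_def)
  have z: "G' s = 0" if "\<bar>s\<bar> > R" for s
  proof (rule DERIV_local_const[OF G])
    show "0 < \<bar>s\<bar> - R" using that by simp
    show "\<forall>y. \<bar>s - y\<bar> < \<bar>s\<bar> - R \<longrightarrow> G s = G y" using that supp by force
  qed
  have z': "- M \<le> s \<and> s \<le> M" if "G' s \<noteq> 0" for s
    using z[of s] that M by argo
  have V: "(G has_vector_derivative G' s) (at s within S)" for s S
    using G[of s] by (simp add: has_real_derivative_iff_has_vector_derivative has_vector_derivative_at_within)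
  \<comment> \<open>\<open>G'\<close> vanishes outside [-M, M], so the two integrands differ at most
    at the point \<open>c\<close>.\<close>
  have "(LINT s|lborel. indicator {..<c} s * G' s) = (LINT s|lborel. indicator {-M..c} s *\<^sub>R G' s)"
    by (intro integral_cong_AE AE_I'[of "{c}"])
      (use G' M z' in \<open>auto simp: indicator_def borel_measurable_continuous_onI intro!: borel_measurable_times\<close>)
  also have "\<dots> = G c - G (-M)"
    using M V G' by (intro integral_FTC_atLeastAtMost) (auto intro: continuous_on_subset)
  finally show "(LINT s|lborel. indicator {..<c} s * G' s) = G c" using supp[of "-M"] M by auto
  have "(LINT s|lborel. G' s) = (LINT s|lborel. indicator {-M..M} s *\<^sub>R G' s)"
    using M z' by (intro Bochner_Integration.integral_cong) (auto simp: indicator_def)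
  also have "\<dots> = G M - G (-M)"
    using M V G' by (intro integral_FTC_atLeastAtMost) (auto intro: continuous_on_subset)
  finally show "(LINT s|lborel. G' s) = 0" using supp[of "-M"] supp[of M] M by auto
qed

lemma integrable_continuous_bounded_support:
  fixes f :: "'a::euclidean_space \<Rightarrow> real"
  assumes "continuous_on UNIV f" "\<And>x. norm x > R \<Longrightarrow> f x = 0"
  shows "integrable lborel f"
proof -
  have "integrable lborel (\<lambda>x. indicator (cball 0 R) x *\<^sub>R f x)"
    by (rule borel_integrable_compact) (auto intro: continuous_on_subset[OF assms(1)])
  also have "(\<lambda>x. indicator (cball 0 R) x *\<^sub>R f x) = f"
    using assms(2) by (force simp: indicator_def)
  finally show ?thesis .
qed

lemma pd_eq_0_outside_closed:
  assumes "closed S" "\<And>x. x \<notin> S \<Longrightarrow> F x = 0" "x \<notin> S"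
  shows "pd i F x = 0"
proof (rule pd_eq_0_outside_support)
  have "closure {x. F x \<noteq> 0} \<subseteq> S"
    by (rule closure_minimal) (use assms(1,2) in blast)+
  then show "x \<notin> closure {x. F x \<noteq> 0}" using assms(3) by blast
qed

lemma pd_eq_0_outside_cball:
  assumes "\<And>x. norm x > R \<Longrightarrow> F x = 0" "norm x > R"
  shows "pd i F x = 0"
  by (rule pd_eq_0_outside_closed[of "cball 0 R"]) (use assms in auto)

context
  fixes F :: "'a::euclidean_space \<Rightarrow> real" and R :: real and i :: 'a
  assumes F: "\<And>x. F differentiable (at x)" and F': "continuous_on UNIV (pd i F)"
    and supp: "\<And>x. norm x > R \<Longrightarrow> F x = 0" and i: "i \<in> Basis"
begin

lemma pd_integrable_on_half_space: "integrable lborel (pd i F)" "integrable lborel (\<lambda>x. indicator {x. x \<bullet> e < c} x * pd i F x)"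
proof -
  show *: "integrable lborel (pd i F)"
    by (rule integrable_continuous_bounded_support[OF F'])
       (rule pd_eq_0_outside_cball[OF supp], assumption+)
  have "{x. x \<bullet> e < c} \<in> sets lborel" by measurable
  from integrable_mult_indicator[OF this *]
  show "integrable lborel (\<lambda>x. indicator {x. x \<bullet> e < c} x * pd i F x)" by simp
qed

lemma line_FTC:
  shows "(LINT s|lborel. indicator {..<c} s * pd i F (pt i s x)) = F (pt i c x)"
    "(LINT s|lborel. pd i F (pt i s x)) = 0"
proof -
  have D: "((\<lambda>s. F (pt i s x)) has_real_derivative pd i F (pt i s x)) (at s)" for s
  proof -
    have p: "((\<lambda>s. pt i s x) has_derivative (\<lambda>h. h *\<^sub>R i)) (at s)"
      unfolding pt_def by (auto intro!: derivative_eq_intros)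
    from has_derivative_compose[OF p F[THEN frechet_derivative_works[THEN iffD1]]]
    have "((\<lambda>s. F (pt i s x)) has_derivative (\<lambda>h. frechet_derivative F (at (pt i s x)) (h *\<^sub>R i))) (at s)" .
    moreover have "frechet_derivative F (at y) (h *\<^sub>R i) = pd i F y * h" for h y
      using linear_frechet_derivative[OF F] by (simp add: linear_cmul)
    ultimately show ?thesis by (simp add: has_field_derivative_def mult_commute_abs)
  qed
  have C: "continuous_on UNIV (\<lambda>s. pd i F (pt i s x))"
    by (rule continuous_on_compose2[OF F']) (auto simp: pt_def intro!: continuous_intros)
  have Z: "F (pt i s x) = 0" if "\<bar>s\<bar> > R" for s
  proof (rule supp)
    have "\<bar>s\<bar> = \<bar>pt i s x \<bullet> i\<bar>" using i by (simp add: pt_inner)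
    also have "\<dots> \<le> norm (pt i s x)" using i by (rule Basis_le_norm)
    finally show "R < norm (pt i s x)" using that by simp
  qed
  show "(LINT s|lborel. indicator {..<c} s * pd i F (pt i s x)) = F (pt i c x)"
    "(LINT s|lborel. pd i F (pt i s x)) = 0"
    using FTC_compact_support[OF D C Z] by auto
qed

lemma integral_pd: "integral\<^sup>L lborel (pd i F) = 0"
  by (subst lborel_integral_split[OF i pd_integrable_on_half_space(1)]) (simp add: line_FTC)

text \<open>By Fubini along the lines in direction \<open>i\<close>. For \<open>i = e\<close> each
  line meets the half space in a ray and contributes the value at its end point; otherwise a line
  lies entirely inside or outside, and compact support gives zero. \<open>F\<close> is only assumed
  to be differentiable with one continuous partial derivative, since it will contain
  \<open>A (f x)\<close> with \<open>A\<close> merely C^1.\<close>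

lemma integral_pd_half_space:
  assumes e: "e \<in> Basis"
  shows "(LINT x|lborel. indicator {x. x \<bullet> e < c} x * pd i F x) =
    (if i = e then LINT x|plane_measure e. F (pt e c x) else 0)"
proof (cases "i = e")
  case True
  then have [simp]: "e = i" by simp
  have "indicator {x. x \<bullet> e < c} (pt i s x) = (indicator {..<c} s :: real)" for s x
    using i by (auto simp: indicator_def pt_inner)
  then show ?thesis
    by (subst lborel_integral_split[OF i pd_integrable_on_half_space(2)]) (simp add: line_FTC)
next
  case False
  then have "indicator {x. x \<bullet> e < c} (pt i s x) = (indicator {y. y e < c} x :: real)" for s x
    using i e by (auto simp: indicator_def pt_inner)
  then show ?thesis using False
    by (subst lborel_integral_split[OF i pd_integrable_on_half_space(2)]) (simp add: line_FTC)
qed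

end

section \<open>Laplacian and Green's identity on a half space\<close>

definition laplacian :: "('a::euclidean_space \<Rightarrow> real) \<Rightarrow> 'a \<Rightarrow> real" where
  "laplacian f x = (\<Sum>i\<in>Basis. pd i (pd i f) x)"

lemma laplacian_eq_0_outside_closed:
  assumes "closed S" "\<And>x. x \<notin> S \<Longrightarrow> F x = 0" "x \<notin> S"
  shows "laplacian F x = 0"
  unfolding laplacian_def
  by (intro sum.neutral ballI pd_eq_0_outside_closed[OF assms(1) _ assms(3)] pd_eq_0_outside_closed[OF assms(1,2)])

lemma laplacian_eq_0_outside_cball:
  assumes "\<And>x. norm x > R \<Longrightarrow> F x = 0" "norm x > R"
  shows "laplacian F x = 0"
  by (rule laplacian_eq_0_outside_closed[of "cball 0 R"]) (use assms in auto)

lemma smooth_laplacian: "smooth f \<Longrightarrow> smooth (laplacian f)"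
  unfolding laplacian_def[abs_def] by (auto intro!: smooth_sum smooth_pd)

text \<open>Divergence theorem for the field \<open>A (f x) *\<^sub>R grad \<Phi> x\<close>, whose
  divergence is the sum of the two volume integrands.\<close>

lemma Green_half_space:
  fixes f \<Phi> :: "'a::euclidean_space \<Rightarrow> real"
  assumes f: "smooth f" and \<Phi>: "smooth \<Phi>" and supp: "\<And>x. norm x > R \<Longrightarrow> \<Phi> x = 0"
    and A: "\<And>s. (A has_real_derivative a s) (at s)" and a: "continuous_on UNIV a" and e: "e \<in> Basis"
  shows "(LINT x|lborel. indicator {x. x \<bullet> e < c} x * (a (f x) * (grad f x \<bullet> grad \<Phi> x))) =
     (LINT x|plane_measure e. A (f (pt e c x)) * pd e \<Phi> (pt e c x)) -
     (LINT x|lborel. indicator {x. x \<bullet> e < c} x * (A (f x) * laplacian \<Phi> x))"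
proof -
  let ?H = "indicator {x. x \<bullet> e < c} :: 'a \<Rightarrow> real"
  have contA: "continuous_on UNIV A"
    using A by (meson DERIV_isCont continuous_at_imp_continuous_on)
  define F where "F i x = A (f x) * pd i \<Phi> x" for i x
  have dA: "(\<lambda>x. A (f x)) differentiable (at x)" and pA: "pd i (\<lambda>x. A (f x)) x = a (f x) * pd i f x" for i x
    using pd_chain[OF smooth_differentiable[OF f] A] by auto
  have dF: "F i differentiable (at x)" and
    pF: "pd i (F i) x = a (f x) * pd i f x * pd i \<Phi> x + A (f x) * pd i (pd i \<Phi>) x" if "i \<in> Basis" for i x
    unfolding F_def
    using pd_mult[where i=i and x=x, OF dA smooth_differentiable[OF smooth_pd[OF \<Phi> that]]] dA
      smooth_differentiable[OF smooth_pd[OF \<Phi> that]] pA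
    by auto
  have cf: "continuous_on UNIV (\<lambda>x. a (f x))" "continuous_on UNIV (\<lambda>x. A (f x))"
    using continuous_on_compose2[OF a smooth_continuous[OF f]] continuous_on_compose2[OF contA smooth_continuous[OF f]] by auto
  have pF_fun: "pd i (F i) = (\<lambda>x. a (f x) * pd i f x * pd i \<Phi> x + A (f x) * pd i (pd i \<Phi>) x)" if "i \<in> Basis" for i
    using pF[OF that] by blast
  have c1: "continuous_on UNIV (\<lambda>x. a (f x) * pd i f x * pd i \<Phi> x)" and c2: "continuous_on UNIV (\<lambda>x. A (f x) * pd i (pd i \<Phi>) x)"
    if "i \<in> Basis" for i
    using that by (auto intro!: continuous_intros cf smooth_continuous[OF smooth_pd[OF f]]
      smooth_continuous[OF smooth_pd[OF \<Phi>]] smooth_continuous[OF smooth_pd[OF smooth_pd[OF \<Phi>]]])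
  have cF: "continuous_on UNIV (pd i (F i))" if "i \<in> Basis" for i
    unfolding pF_fun[OF that] by (rule continuous_on_add[OF c1[OF that] c2[OF that]])
  have sF: "F i x = 0" if "norm x > R" for i x
    unfolding F_def using pd_eq_0_outside_cball[OF supp that] by simp
  have H: "{x. x \<bullet> e < c} \<in> sets lborel" by measurable
  have ig: "integrable lborel (\<lambda>x. ?H x * (a (f x) * (grad f x \<bullet> grad \<Phi> x)))"
  proof -
    have "integrable lborel (\<lambda>x. a (f x) * (grad f x \<bullet> grad \<Phi> x))"
    proof (rule integrable_continuous_bounded_support[of _ R])
      show "continuous_on UNIV (\<lambda>x. a (f x) * (grad f x \<bullet> grad \<Phi> x))"
        by (intro continuous_on_mult continuous_on_inner cf smooth_continuous_grad f \<Phi>)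
    qed (simp add: grad_inner_grad pd_eq_0_outside_cball[OF supp])
    from integrable_mult_indicator[OF H this] show ?thesis by simp
  qed
  have il: "integrable lborel (\<lambda>x. ?H x * (A (f x) * laplacian \<Phi> x))"
  proof -
    have "integrable lborel (\<lambda>x. A (f x) * laplacian \<Phi> x)"
      by (rule integrable_continuous_bounded_support[of _ R])
        (auto intro!: continuous_intros cf smooth_continuous[OF smooth_laplacian[OF \<Phi>]] simp: laplacian_eq_0_outside_cball[OF supp])
    from integrable_mult_indicator[OF H this] show ?thesis by simp
  qed
  have "(LINT x|lborel. ?H x * (a (f x) * (grad f x \<bullet> grad \<Phi> x))) + (LINT x|lborel. ?H x * (A (f x) * laplacian \<Phi> x))
     = (LINT x|lborel. ?H x * (a (f x) * (grad f x \<bullet> grad \<Phi> x)) + ?H x * (A (f x) * laplacian \<Phi> x))"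
    using ig il by simp
  also have "\<dots> = (LINT x|lborel. (\<Sum>i\<in>Basis. ?H x * pd i (F i) x))"
    by (intro Bochner_Integration.integral_cong refl)
      (simp add: pF grad_inner_grad laplacian_def sum_distrib_left sum.distrib algebra_simps)
  also have "\<dots> = (\<Sum>i\<in>Basis. (LINT x|lborel. ?H x * pd i (F i) x))"
    by (intro Bochner_Integration.integral_sum pd_integrable_on_half_space(2)[of _ _ R] dF cF sF)
  also have "\<dots> = (\<Sum>i\<in>Basis. (if i = e then LINT x|plane_measure e. F i (pt e c x) else 0))"
    by (intro sum.cong refl integral_pd_half_space[of _ _ R] dF cF sF e)
  also have "\<dots> = (LINT x|plane_measure e. F e (pt e c x))"
    using e by (simp add: sum.delta)
  finally show ?thesis unfolding F_def by linarith
qed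

section \<open>Weak derivatives and their uniqueness\<close>

lemma test_functionI:
  assumes "smooth \<phi>" "compact K" "K \<subseteq> D" "\<And>x. x \<notin> K \<Longrightarrow> \<phi> x = 0"
  shows "test_function D \<phi>"
proof -
  have "closure {x. \<phi> x \<noteq> 0} \<subseteq> K"
    by (rule closure_minimal) (use assms in \<open>auto intro: compact_imp_closed\<close>)
  moreover have "compact (closure {x. \<phi> x \<noteq> 0})"
    using compact_Int_closed[OF \<open>compact K\<close>, of "closure {x. \<phi> x \<noteq> 0}"] calculation
    by (simp add: Int_absorb1)
  ultimately show ?thesis using assms unfolding test_function_def by auto
qed

lemma test_functionD:
  assumes "test_function D \<phi>"
  shows "smooth \<phi>" "x \<notin> D \<Longrightarrow> \<phi> x = 0" "x \<notin> D \<Longrightarrow> pd i \<phi> x = 0" "x \<notin> D \<Longrightarrow> grad \<phi> x = 0"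
    "\<exists>R. \<forall>x. norm x > R \<longrightarrow> \<phi> x = 0"
proof -
  let ?S = "closure {x. \<phi> x \<noteq> 0}"
  have S: "compact ?S" "?S \<subseteq> D" using assms by (auto simp: test_function_def)
  show "smooth \<phi>" using assms by (simp add: test_function_def)
  have sub: "\<phi> x \<noteq> 0 \<Longrightarrow> x \<in> ?S" for x using closure_subset[of "{x. \<phi> x \<noteq> 0}"] by auto
  then show "x \<notin> D \<Longrightarrow> \<phi> x = 0" using S by blast
  have pd0: "x \<notin> D \<Longrightarrow> pd i \<phi> x = 0" for i using S pd_eq_0_outside_support by blast
  then show "x \<notin> D \<Longrightarrow> pd i \<phi> x = 0" .
  show "x \<notin> D \<Longrightarrow> grad \<phi> x = 0" using pd0 by (simp add: grad_def)
  from S(1) obtain R where "\<forall>x\<in>?S. norm x \<le> R" using compact_imp_bounded bounded_iff by metis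
  then show "\<exists>R. \<forall>x. norm x > R \<longrightarrow> \<phi> x = 0" using sub by (meson not_le)
qed

lemma continuous_bounded_support_bounded:
  fixes f :: "'a::euclidean_space \<Rightarrow> 'b::real_normed_vector"
  assumes "continuous_on UNIV f" "\<And>x. norm x > R \<Longrightarrow> f x = 0"
  shows "\<exists>B>0. \<forall>x. norm (f x) \<le> B"
proof -
  have "compact (f ` cball 0 R)"
    by (intro compact_continuous_image continuous_on_subset[OF assms(1)]) auto
  then obtain B where B: "\<forall>y\<in>f ` cball 0 R. norm y \<le> B" using compact_imp_bounded bounded_iff by metis
  have "norm (f x) \<le> \<bar>B\<bar> + 1" for x
  proof (cases "norm x \<le> R")
    case True
    then have "norm (f x) \<le> B" using B by auto
    then show ?thesis by linarith
  next
    case False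
    then show ?thesis using assms(2)[of x] by simp
  qed
  then show ?thesis by (intro exI[of _ "\<bar>B\<bar> + 1"]) auto
qed

lemma integral_lebesgue_on_eq_lborel:
  fixes f :: "'a::euclidean_space \<Rightarrow> real"
  assumes D: "D \<in> sets lebesgue" and f: "f \<in> borel_measurable borel" and "\<And>x. x \<notin> D \<Longrightarrow> f x = 0"
  shows "integral\<^sup>L (lebesgue_on D) f = integral\<^sup>L lborel f"
proof -
  have "integral\<^sup>L (lebesgue_on D) f = (LINT x|lebesgue. indicator D x *\<^sub>R f x)"
    using D by (subst integral_restrict_space) auto
  also have "(\<lambda>x. indicator D x *\<^sub>R f x) = f" using assms(3) by (force simp: indicator_def)
  finally show ?thesis using f by (simp add: integral_completion)
qed

text \<open>Both integrands vanish outside \<open>D\<close>, so the integrals may be taken over the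
  whole space, where a partial derivative of the compactly supported product integrates to
  zero.\<close>

lemma integration_by_parts_test:
  assumes f: "smooth f" and \<phi>: "test_function D \<phi>" and D: "D \<in> sets lebesgue" and i: "i \<in> Basis"
  shows "(LINT x|lebesgue_on D. f x * pd i \<phi> x) = - (LINT x|lebesgue_on D. pd i f x * \<phi> x)"
proof -
  obtain R where R: "\<And>x. norm x > R \<Longrightarrow> \<phi> x = 0" using test_functionD(5)[OF \<phi>] by blast
  note s\<phi> = test_functionD(1)[OF \<phi>]
  have s: "smooth (\<lambda>x. f x * pd i \<phi> x)" "smooth (\<lambda>x. pd i f x * \<phi> x)"
    using f s\<phi> i by (auto intro: smooth_mult smooth_pd)
  have m: "g \<in> borel_measurable borel" if "smooth g" for g :: "'a \<Rightarrow> real"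
    using that by (intro borel_measurable_continuous_onI smooth_continuous)
  have int: "integrable lborel (\<lambda>x. f x * pd i \<phi> x)" "integrable lborel (\<lambda>x. pd i f x * \<phi> x)"
    by (rule integrable_continuous_bounded_support[of _ R], rule smooth_continuous, rule s,
        simp add: R pd_eq_0_outside_cball[OF R])+
  have "(LINT x|lborel. f x * pd i \<phi> x) + (LINT x|lborel. pd i f x * \<phi> x)
      = (LINT x|lborel. f x * pd i \<phi> x + pd i f x * \<phi> x)"
    using int by simp
  also have "\<dots> = integral\<^sup>L lborel (pd i (\<lambda>x. f x * \<phi> x))"
    by (intro Bochner_Integration.integral_cong refl)
      (simp add: pd_mult smooth_differentiable f s\<phi>)
  also have "\<dots> = 0"
    by (rule integral_pd[of _ _ R])
      (use f s\<phi> R i in \<open>auto intro: smooth_differentiable smooth_continuous smooth_pd smooth_mult\<close>)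
  finally have "(LINT x|lborel. f x * pd i \<phi> x) = - (LINT x|lborel. pd i f x * \<phi> x)" by linarith
  moreover have "(LINT x|lebesgue_on D. f x * pd i \<phi> x) = (LINT x|lborel. f x * pd i \<phi> x)"
    by (rule integral_lebesgue_on_eq_lborel[OF D m[OF s(1)]]) (simp add: test_functionD(3)[OF \<phi>])
  moreover have "(LINT x|lebesgue_on D. pd i f x * \<phi> x) = (LINT x|lborel. pd i f x * \<phi> x)"
    by (rule integral_lebesgue_on_eq_lborel[OF D m[OF s(2)]]) (simp add: test_functionD(2)[OF \<phi>])
  ultimately show ?thesis by simp
qed

text \<open>A smooth function below the indicator of the open box. The parameter \<open>n\<close> is
  a steepness: exp(-1/(n s)) tends to 1 for each s > 0 as \<open>n\<close> grows.\<close>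

definition box_bump :: "'a::euclidean_space \<Rightarrow> 'a \<Rightarrow> nat \<Rightarrow> 'a \<Rightarrow> real" where
  "box_bump a b n x = (\<Prod>i\<in>Basis. flat 0 (real n * (x \<bullet> i - a \<bullet> i)) * flat 0 (real n * (b \<bullet> i - x \<bullet> i)))"

lemma box_bump_bounds: "0 \<le> box_bump a b n x" "box_bump a b n x \<le> 1"
  unfolding box_bump_def
  by (auto intro!: prod_nonneg mult_nonneg_nonneg flat_nonneg prod_le_1 mult_le_one flat_0_le_1)

lemma smooth_box_bump: "smooth (box_bump a b n)"
  unfolding box_bump_def[abs_def]
  by (intro smooth_prod smooth_mult smooth_flat smooth_const smooth_diff smooth_inner_right)

lemma box_bump_outside: "x \<notin> box a b \<Longrightarrow> box_bump a b n x = 0"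
proof -
  assume "x \<notin> box a b"
  then obtain i where "i \<in> Basis" "x \<bullet> i \<le> a \<bullet> i \<or> b \<bullet> i \<le> x \<bullet> i" by (auto simp: mem_box not_less)
  then have "flat 0 (real n * (x \<bullet> i - a \<bullet> i)) * flat 0 (real n * (b \<bullet> i - x \<bullet> i)) = 0"
    by (auto simp: flat_eq_0 mult_le_0_iff)
  with \<open>i \<in> Basis\<close> show ?thesis unfolding box_bump_def by (intro prod_zero) auto
qed

lemma test_function_box_bump: "cbox a b \<subseteq> D \<Longrightarrow> test_function D (box_bump a b n)"
  by (rule test_functionI[of _ "cbox a b"])
    (auto simp: smooth_box_bump intro: box_bump_outside[OF contra_subsetD[OF box_subset_cbox]])

text \<open>The corners are drawn from a countable dense set; this is what makes the exceptional
  null sets in the uniqueness of weak time derivatives harmless.\<close>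

lemma box_bump_approx:
  fixes a b :: "'a::euclidean_space"
  assumes B: "\<And>X::'a set. open X \<Longrightarrow> X \<noteq> {} \<Longrightarrow> \<exists>d\<in>B. d \<in> X" and ab: "\<And>i. i \<in> Basis \<Longrightarrow> a \<bullet> i < b \<bullet> i"
  shows "\<exists>p q. (\<forall>n. p n \<in> B \<and> q n \<in> B \<and> box (p n) (q n) \<subseteq> box a b \<and> cbox (p n) (q n) \<subseteq> cbox a b) \<and>
     (\<forall>x. (\<lambda>n. box_bump (p n) (q n) n x) \<longlonglongrightarrow> indicator (box a b) x)"
proof -
  \<comment> \<open>Tolerance within which the corners are taken from \<open>B\<close>; it shrinks
    to zero, so \<open>p n\<close> and \<open>q n\<close> tend to \<open>a\<close> and
    \<open>b\<close> from inside.\<close>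
  define w where "w n = (b - a) /\<^sub>R (real n + 3)" for n
  have w: "0 < w n \<bullet> i" "w n \<bullet> i \<le> (b \<bullet> i - a \<bullet> i) / 3" if "i \<in> Basis" for i n
  proof -
    have *: "w n \<bullet> i = (b \<bullet> i - a \<bullet> i) / (real n + 3)"
      by (simp add: w_def inner_diff_left divide_inverse_commute)
    show "0 < w n \<bullet> i" using ab[OF that] by (simp add: * add_nonneg_pos)
    show "w n \<bullet> i \<le> (b \<bullet> i - a \<bullet> i) / 3"
      unfolding * using ab[OF that] by (intro divide_left_mono) auto
  qed
  have ex: "\<exists>p\<in>B. p \<in> box a (a + w n)" "\<exists>q\<in>B. q \<in> box (b - w n) b" for n
    by (rule B[OF open_box], use w in \<open>auto simp: box_ne_empty inner_add_left inner_diff_left\<close>)+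
  have "\<forall>n. \<exists>p. p \<in> B \<and> p \<in> box a (a + w n)" using ex(1) by (simp add: Bex_def)
  from choice[OF this] obtain p where p: "\<And>n. p n \<in> B" "\<And>n. p n \<in> box a (a + w n)" by auto
  have "\<forall>n. \<exists>q. q \<in> B \<and> q \<in> box (b - w n) b" using ex(2) by (simp add: Bex_def)
  from choice[OF this] obtain q where q: "\<And>n. q n \<in> B" "\<And>n. q n \<in> box (b - w n) b" by auto
  have pb: "a \<bullet> i < p n \<bullet> i" "p n \<bullet> i < a \<bullet> i + w n \<bullet> i" "b \<bullet> i - w n \<bullet> i < q n \<bullet> i" "q n \<bullet> i < b \<bullet> i"
    if "i \<in> Basis" for i n
    using p(2)[of n, unfolded mem_box inner_add_left, THEN bspec, OF that]
      q(2)[of n, unfolded mem_box inner_diff_left, THEN bspec, OF that] by simp_all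
  have sub: "box (p n) (q n) \<subseteq> box a b" "cbox (p n) (q n) \<subseteq> cbox a b" for n
    by (auto simp only: mem_box intro!: subsetI) (meson pb less_trans le_less_trans less_le_trans less_imp_le)+
  have lim: "(\<lambda>n. box_bump (p n) (q n) n x) \<longlonglongrightarrow> indicator (box a b) x" for x
  proof (cases "x \<in> box a b")
    case False
    then have "box_bump (p n) (q n) n x = 0" for n using sub(1)[of n] box_bump_outside by blast
    then show ?thesis using False by simp
  next
    case True
    then have xi: "a \<bullet> i < x \<bullet> i" "x \<bullet> i < b \<bullet> i" if "i \<in> Basis" for i using that by (auto simp: mem_box)
    \<comment> \<open>Moving corners do no harm: \<open>real n * u n\<close> tends to infinity
      whenever \<open>u\<close> has a positive limit.\<close>
    have flat1: "(\<lambda>n. flat 0 (real n * u n)) \<longlonglongrightarrow> 1" if "u \<longlonglongrightarrow> l" "l > 0" for u l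
    proof -
      have *: "filterlim (\<lambda>n. real n * u n) at_top sequentially"
        by (subst mult.commute)
           (rule filterlim_tendsto_pos_mult_at_top[OF that filterlim_real_sequentially])
      have "((\<lambda>s. exp (- 1 / s)) \<longlongrightarrow> exp 0) (at_top :: real filter)"
        by (intro tendsto_exp real_tendsto_divide_at_top[OF tendsto_const] filterlim_ident)
      from filterlim_compose[OF this *] have "(\<lambda>n. exp (- 1 / (real n * u n))) \<longlonglongrightarrow> 1" by simp
      moreover have "eventually (\<lambda>n. real n * u n > 0) sequentially"
        using * by (simp add: filterlim_at_top_dense)
      then have "eventually (\<lambda>n. exp (- 1 / (real n * u n)) = flat 0 (real n * u n)) sequentially"
        by eventually_elim (simp add: flat_def)
      ultimately show ?thesis by (rule Lim_transform_eventually)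
    qed
    have w0: "(\<lambda>n. w n \<bullet> i) \<longlonglongrightarrow> 0" for i
    proof -
      have "(\<lambda>n. inverse (real n + 3)) \<longlonglongrightarrow> 0"
        using LIMSEQ_ignore_initial_segment[OF LIMSEQ_inverse_real_of_nat, of 2] by (simp add: add.commute)
      from tendsto_mult_left[OF this, of "(b - a) \<bullet> i"] show ?thesis
        by (simp add: w_def mult.commute)
    qed
    have pl: "(\<lambda>n. p n \<bullet> i) \<longlonglongrightarrow> a \<bullet> i" "(\<lambda>n. q n \<bullet> i) \<longlonglongrightarrow> b \<bullet> i" if "i \<in> Basis" for i
    proof -
      show "(\<lambda>n. p n \<bullet> i) \<longlonglongrightarrow> a \<bullet> i"
        by (rule tendsto_sandwich[of "\<lambda>_. a \<bullet> i" _ _ "\<lambda>n. a \<bullet> i + w n \<bullet> i"])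
          (use pb[OF that] tendsto_add[OF tendsto_const w0] in \<open>auto simp: less_imp_le\<close>)
      show "(\<lambda>n. q n \<bullet> i) \<longlonglongrightarrow> b \<bullet> i"
        by (rule tendsto_sandwich[of "\<lambda>n. b \<bullet> i - w n \<bullet> i" _ _ "\<lambda>_. b \<bullet> i"])
          (use pb[OF that] tendsto_diff[OF tendsto_const w0] in \<open>auto simp: less_imp_le\<close>)
    qed
    have "(\<lambda>n. box_bump (p n) (q n) n x) \<longlonglongrightarrow> (\<Prod>i\<in>(Basis::'a set). 1 * 1)"
      unfolding box_bump_def
    proof (intro tendsto_prod tendsto_mult)
      fix i :: 'a assume i: "i \<in> Basis"
      show "(\<lambda>n. flat 0 (real n * (x \<bullet> i - p n \<bullet> i))) \<longlonglongrightarrow> 1"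
        by (rule flat1[OF tendsto_diff[OF tendsto_const pl(1)[OF i]]]) (use xi i in simp)
      show "(\<lambda>n. flat 0 (real n * (q n \<bullet> i - x \<bullet> i))) \<longlonglongrightarrow> 1"
        by (rule flat1[OF tendsto_diff[OF pl(2)[OF i] tendsto_const]]) (use xi i in simp)
    qed
    then show ?thesis using True by simp
  qed
  show ?thesis using p(1) q(1) sub lim by blast
qed

text \<open>Dominated convergence along \<open>box_bump_approx\<close> turns vanishing against the
  family into vanishing integrals over all nondegenerate closed boxes inside \<open>D\<close>;
  Lebesgue differentiation along shrinking cubes then gives zero almost everywhere. The family is
  fixed before \<open>f\<close>, so one countable family serves all functions at once.\<close>

lemma fundamental_lemma_cov:
  fixes D :: "'a::euclidean_space set"
  assumes D: "open D"
  obtains \<T> where "countable \<T>" "\<And>\<phi>. \<phi> \<in> \<T> \<Longrightarrow> test_function D \<phi>"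
    "\<forall>f::'a \<Rightarrow> real. integrable (lebesgue_on D) f \<longrightarrow>
       (\<forall>\<phi>\<in>\<T>. (LINT x|lebesgue_on D. f x * \<phi> x) = 0) \<longrightarrow> (AE x in lebesgue_on D. f x = 0)"
proof -
  obtain B :: "'a set" where B: "countable B" "\<And>X::'a set. open X \<Longrightarrow> X \<noteq> {} \<Longrightarrow> \<exists>d\<in>B. d \<in> X"
    using countable_dense_exists by blast
  define \<T> where "\<T> = {box_bump a b n |a b n. a \<in> B \<and> b \<in> B \<and> cbox a b \<subseteq> D}"
  have "\<T> \<subseteq> (\<lambda>(a, b, n). box_bump a b n) ` (B \<times> B \<times> UNIV)" by (force simp: \<T>_def)
  then have "countable \<T>" by (rule countable_subset) (use B in auto)
  have DL: "D \<in> sets lebesgue" using D by auto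
  have "AE x in lebesgue_on D. f x = 0"
    if f: "integrable (lebesgue_on D) f" and 0: "\<forall>\<phi>\<in>\<T>. (LINT x|lebesgue_on D. f x * \<phi> x) = 0" for f :: "'a \<Rightarrow> real"
  proof -
    define h where "h x = indicator D x * f x" for x
    have h: "integrable lebesgue h"
      using f DL unfolding h_def by (simp add: integrable_restrict_space)
    have box0: "(LINT x|lebesgue. indicator (box a b) x * h x) = 0"
      if ab: "\<And>i. i \<in> Basis \<Longrightarrow> a \<bullet> i < b \<bullet> i" "cbox a b \<subseteq> D" for a b
    proof -
      have "\<exists>p q. (\<forall>n. p n \<in> B \<and> q n \<in> B \<and> box (p n) (q n) \<subseteq> box a b \<and> cbox (p n) (q n) \<subseteq> cbox a b) \<and>
         (\<forall>x. (\<lambda>n. box_bump (p n) (q n) n x) \<longlonglongrightarrow> indicator (box a b) x)"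
        by (rule box_bump_approx) (use B(2) ab(1) in auto)
      then obtain p q where
        pq: "\<forall>n. p n \<in> B \<and> q n \<in> B \<and> box (p n) (q n) \<subseteq> box a b \<and> cbox (p n) (q n) \<subseteq> cbox a b"
        and lim: "\<forall>x. (\<lambda>n. box_bump (p n) (q n) n x) \<longlonglongrightarrow> indicator (box a b) x"
        by (elim exE conjE)
      have z: "(LINT x|lebesgue. box_bump (p n) (q n) n x * h x) = 0" for n
      proof -
        have "box_bump (p n) (q n) n \<in> \<T>" using pq[rule_format, of n] ab(2) unfolding \<T>_def by blast
        then have "0 = (LINT x|lebesgue_on D. f x * box_bump (p n) (q n) n x)" using 0 by simp
        also have "\<dots> = (LINT x|lebesgue. box_bump (p n) (q n) n x * h x)"
          using DL by (subst integral_restrict_space) (auto simp: h_def mult_ac)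
        finally show ?thesis by simp
      qed
      have "(\<lambda>n. LINT x|lebesgue. box_bump (p n) (q n) n x * h x) \<longlonglongrightarrow> (LINT x|lebesgue. indicator (box a b) x * h x)"
      proof (rule integral_dominated_convergence[where w = "\<lambda>x. norm (h x)"])
        have *: "box_bump (p n) (q n) n \<in> borel_measurable lebesgue" for n
          by (intro measurable_completion) (simp add: borel_measurable_continuous_onI smooth_continuous smooth_box_bump)
        show "(\<lambda>x. box_bump (p n) (q n) n x * h x) \<in> borel_measurable lebesgue" for n
          using h * by (intro borel_measurable_times) auto
        show "(\<lambda>x. indicator (box a b) x * h x) \<in> borel_measurable lebesgue"
          using h by (intro borel_measurable_times borel_measurable_indicator) auto
        show "AE x in lebesgue. norm (box_bump (p n) (q n) n x * h x) \<le> norm (h x)" for n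
          using box_bump_bounds[of "p n" "q n" n] by (auto simp: abs_mult intro!: AE_I2 mult_left_le_one_le)
        show "AE x in lebesgue. (\<lambda>n. box_bump (p n) (q n) n x * h x) \<longlonglongrightarrow> indicator (box a b) x * h x"
          using lim by (intro AE_I2 tendsto_mult tendsto_const) auto 
      qed (use h in auto)
      then show ?thesis unfolding z by (simp add: LIMSEQ_const_iff)
    qed
    have hi: "h integrable_on cbox a b" for a b
    proof -
      have "h absolutely_integrable_on UNIV" using h by (simp add: set_integrable_def)
      then have "h absolutely_integrable_on cbox a b" by (rule set_integrable_subset) auto
      then show ?thesis using absolutely_integrable_on_def by blast
    qed
    have int_box: "integral (cbox a b) h = (LINT x|lebesgue. indicator (box a b) x * h x)" for a b
    proof -
      have s: "set_integrable lebesgue (box a b) h" unfolding set_integrable_def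
        using h by (intro integrable_mult_indicator) auto
      have "integral (cbox a b) h = integral (box a b) h" by (simp add: integral_open_interval)
      also have "\<dots> = (LINT x:box a b|lebesgue. h x)"
        using set_lebesgue_integral_eq_integral(2)[OF s] by simp
      finally show ?thesis by (simp add: set_lebesgue_integral_def)
    qed
    obtain N where N: "negligible N" and
      lim: "\<And>x e. \<lbrakk>x \<notin> N; 0 < e\<rbrakk> \<Longrightarrow> \<exists>d>0. \<forall>h'. 0 < h' \<and> h' < d \<longrightarrow>
         norm (integral (cbox x (x + h' *\<^sub>R One)) h /\<^sub>R h' ^ DIM('a) - h x) < e"
      using integrable_ccontinuous_explicit[OF hi] by metis
    have "h x = 0" if "x \<in> D" "x \<notin> N" for x
    proof (rule ccontr)
      assume hx: "h x \<noteq> 0"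
      obtain d where d: "d > 0" "\<And>t. 0 < t \<Longrightarrow> t < d \<Longrightarrow> norm (integral (cbox x (x + t *\<^sub>R One)) h /\<^sub>R t ^ DIM('a) - h x) < norm (h x)"
        using lim[OF \<open>x \<notin> N\<close>, of "norm (h x)"] hx by auto
      obtain r where r: "r > 0" "ball x r \<subseteq> D" using D \<open>x \<in> D\<close> openE by blast
      \<comment> \<open>The Euclidean norm is at most the sum of the absolute coordinates, so a cube
        of side \<open>t\<close> stays in the ball once \<open>t\<close> times the dimension is
        below \<open>r\<close>.\<close>
      define t where "t = min (d / 2) (r / (2 * real DIM('a)))"
      have t: "0 < t" "t < d" "t * real DIM('a) < r" using d r DIM_positive[where 'a='a]
        by (auto simp: t_def min_def field_simps simp del: DIM_positive)
      have "cbox x (x + t *\<^sub>R One) \<subseteq> ball x r"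
      proof
        fix y assume y: "y \<in> cbox x (x + t *\<^sub>R One)"
        have "norm (y - x) \<le> (\<Sum>i\<in>Basis. \<bar>(y - x) \<bullet> i\<bar>)" by (rule norm_le_l1)
        also have "\<dots> \<le> (\<Sum>i\<in>(Basis::'a set). t)"
          using y by (intro sum_mono) (auto simp: mem_box inner_diff_left inner_add_left)
        also have "\<dots> = t * real DIM('a)" by simp
        finally show "y \<in> ball x r" using t by (simp add: dist_norm norm_minus_commute)
      qed
      then have "cbox x (x + t *\<^sub>R One) \<subseteq> D" using r by blast
      moreover have "\<And>i. i \<in> Basis \<Longrightarrow> x \<bullet> i < (x + t *\<^sub>R One) \<bullet> i" using t by (simp add: inner_add_left)
      ultimately have "integral (cbox x (x + t *\<^sub>R One)) h = 0"
        using box0[of x "x + t *\<^sub>R One"] int_box by simp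
      then show False using d(2)[OF t(1,2)] by simp
    qed
    then have "AE x in lebesgue. x \<in> D \<longrightarrow> f x = 0"
      using N by (intro AE_I'[of N]) (auto simp: negligible_iff_null_sets h_def indicator_def)
    then show ?thesis using DL by (subst AE_restrict_space_iff) auto
  qed
  moreover have "test_function D \<phi>" if "\<phi> \<in> \<T>" for \<phi>
    using that test_function_box_bump by (auto simp: \<T>_def)
  ultimately show ?thesis using \<open>countable \<T>\<close> by (intro that[of \<T>]) simp_all
qed

section \<open>Square integrability on bounded domains\<close>

lemma L2_fun_integrable:
  assumes "finite_measure M" "L2_fun M f"
  shows "integrable M f"
proof -
  interpret finite_measure M by fact
  have "integrable M (\<lambda>x. 1 + (norm (f x))\<^sup>2)" using assms by (auto simp: L2_fun_def)
  then show ?thesis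
  proof (rule Bochner_Integration.integrable_bound)
    have "s \<le> 1 + s\<^sup>2" for s :: real
      using zero_le_power2[of "s - 1 / 2"] by (simp add: power2_eq_square algebra_simps)
    then show "AE x in M. norm (f x) \<le> norm (1 + (norm (f x))\<^sup>2)" by (auto intro!: AE_I2)
  qed (use assms in \<open>auto simp: L2_fun_def\<close>)
qed

lemma L2_fun_bounded:
  fixes f :: "'a \<Rightarrow> 'b::euclidean_space"
  assumes "finite_measure M" "f \<in> borel_measurable M" "\<And>x. x \<in> space M \<Longrightarrow> norm (f x) \<le> B"
  shows "L2_fun M f"
proof -
  interpret finite_measure M by fact
  have "integrable M (\<lambda>x. (norm (f x))\<^sup>2)"
    by (rule integrable_const_bound[of _ "B\<^sup>2"])
      (use assms in \<open>auto intro!: AE_I2 power_mono\<close>)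
  then show ?thesis using assms by (simp add: L2_fun_def)
qed

lemma L2_fun_inner_Basis:
  assumes "L2_fun M (f :: 'a \<Rightarrow> 'b::euclidean_space)" "norm i = 1"
  shows "L2_fun M (\<lambda>x. f x \<bullet> i)"
proof -
  have [measurable]: "f \<in> borel_measurable M" using assms by (auto simp: L2_fun_def)
  have "integrable M (\<lambda>x. (norm (f x \<bullet> i))\<^sup>2)"
  proof (rule Bochner_Integration.integrable_bound)
    show "integrable M (\<lambda>x. (norm (f x))\<^sup>2)" using assms by (auto simp: L2_fun_def)
    have "\<bar>f x \<bullet> i\<bar> \<le> norm (f x)" for x using Cauchy_Schwarz_ineq2[of "f x" i] assms by simp
    then have "\<bar>f x \<bullet> i\<bar>\<^sup>2 \<le> (norm (f x))\<^sup>2" for x by (intro power_mono) auto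
    then show "AE x in M. norm ((norm (f x \<bullet> i))\<^sup>2) \<le> norm ((norm (f x))\<^sup>2)"
      by (intro AE_I2) simp
  qed measurable
  then show ?thesis by (auto simp: L2_fun_def)
qed

lemma integrable_mult_bounded_measurable:
  fixes f g :: "'a \<Rightarrow> real"
  assumes "integrable M f" "g \<in> borel_measurable M" "\<And>x. x \<in> space M \<Longrightarrow> \<bar>g x\<bar> \<le> B"
  shows "integrable M (\<lambda>x. f x * g x)"
proof (rule Bochner_Integration.integrable_bound)
  show "integrable M (\<lambda>x. B * f x)" using assms by simp
  have "\<bar>f x\<bar> * \<bar>g x\<bar> \<le> \<bar>B\<bar> * \<bar>f x\<bar>" if "x \<in> space M" for x
    using assms(3)[OF that] mult_right_mono[of "\<bar>g x\<bar>" "\<bar>B\<bar>" "\<bar>f x\<bar>"] by (simp add: mult.commute)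
  then show "AE x in M. norm (f x * g x) \<le> norm (B * f x)" by (auto intro!: AE_I2 simp: abs_mult)
qed (use assms in auto)

lemma finite_measure_time: "finite_measure (time T)"
  by (rule finite_measure_lebesgue_on) simp

lemma finite_measure_open_bounded: "open D \<Longrightarrow> bounded D \<Longrightarrow> finite_measure (lebesgue_on (D :: 'a::euclidean_space set))"
  by (rule finite_measure_lebesgue_on) (simp add: lmeasurable_open)

lemma continuous_measurable_lebesgue_on:
  fixes f :: "'a::euclidean_space \<Rightarrow> 'b::euclidean_space"
  assumes "continuous_on UNIV f"
  shows "f \<in> borel_measurable (lebesgue_on D)"
  by (rule measurable_restrict_space1)
    (use assms in \<open>simp add: measurable_completion borel_measurable_continuous_onI\<close>)

lemma continuous_bounded_on_bounded:
  fixes f :: "'a::euclidean_space \<Rightarrow> 'b::euclidean_space"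
  assumes "continuous_on UNIV f" "bounded D"
  shows "\<exists>B. \<forall>x\<in>D. norm (f x) \<le> B"
proof -
  have "compact (f ` closure D)"
    by (intro compact_continuous_image continuous_on_subset[OF assms(1)]) (use assms in auto)
  then obtain B where "\<forall>y\<in>f ` closure D. norm y \<le> B" using compact_imp_bounded bounded_iff by metis
  then show ?thesis using closure_subset[of D] by (intro exI[of _ B]) auto
qed

lemma L2_fun_continuous:
  fixes f :: "'a::euclidean_space \<Rightarrow> 'b::euclidean_space"
  assumes "open D" "bounded D" "continuous_on UNIV f"
  shows "L2_fun (lebesgue_on D) f"
proof -
  obtain B where "\<forall>x\<in>D. norm (f x) \<le> B" using continuous_bounded_on_bounded[OF assms(3,2)] by blast
  then show ?thesis
    by (intro L2_fun_bounded[of _ _ B] finite_measure_open_bounded continuous_measurable_lebesgue_on assms)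
      (auto simp: space_restrict_space)
qed

lemma H1_grad_smooth:
  fixes f :: "'a::euclidean_space \<Rightarrow> real"
  assumes "open D" "bounded D" "smooth f"
  shows "H1_grad D f (grad f)"
  unfolding H1_grad_def weak_grad_def
  using assms integration_by_parts_test[OF assms(3)]
  by (auto intro!: L2_fun_continuous smooth_continuous smooth_continuous_grad simp: grad_inner_Basis lmeasurable_open fmeasurableD)

text \<open>This lemma and \<open>time_deriv_unique\<close> are needed because
  \<open>spatial_grad\<close> and \<open>time_deriv\<close> are arbitrary choices of
  representatives: they can be computed only through uniqueness.\<close>

lemma weak_grad_unique:
  fixes D :: "'a::euclidean_space set"
  assumes D: "open D" "bounded D" and V: "L2_fun (lebesgue_on D) V" "L2_fun (lebesgue_on D) W"
    and w: "weak_grad D v V" "weak_grad D v W"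
  shows "AE x in lebesgue_on D. V x = W x"
proof -
  note fin = finite_measure_open_bounded[OF D]
  obtain \<T> where \<T>: "countable \<T>" "\<And>\<phi>. \<phi> \<in> \<T> \<Longrightarrow> test_function D \<phi>"
    "\<forall>f::'a \<Rightarrow> real. integrable (lebesgue_on D) f \<longrightarrow>
       (\<forall>\<phi>\<in>\<T>. (LINT x|lebesgue_on D. f x * \<phi> x) = 0) \<longrightarrow> (AE x in lebesgue_on D. f x = 0)"
    by (rule fundamental_lemma_cov[OF D(1)]) (rule that)
  have "AE x in lebesgue_on D. \<forall>i\<in>Basis. V x \<bullet> i - W x \<bullet> i = 0"
  proof (rule AE_finite_allI[OF finite_Basis], rule \<T>(3)[rule_format])
    fix i :: 'a assume i: "i \<in> Basis"
    have int: "integrable (lebesgue_on D) (\<lambda>x. V x \<bullet> i)" "integrable (lebesgue_on D) (\<lambda>x. W x \<bullet> i)"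
      using V i by (auto intro!: L2_fun_integrable[OF fin] L2_fun_inner_Basis)
    then show "integrable (lebesgue_on D) (\<lambda>x. V x \<bullet> i - W x \<bullet> i)" by simp
    fix \<phi> assume "\<phi> \<in> \<T>"
    then have \<phi>: "test_function D \<phi>" by (rule \<T>(2))
    obtain R where "\<And>x. norm x > R \<Longrightarrow> \<phi> x = 0" using test_functionD(5)[OF \<phi>] by blast
    then obtain B where B: "\<And>x. norm (\<phi> x) \<le> B"
      using continuous_bounded_support_bounded[of \<phi> R] smooth_continuous[OF test_functionD(1)[OF \<phi>]] by blast
    have m: "\<phi> \<in> borel_measurable (lebesgue_on D)"
      by (intro continuous_measurable_lebesgue_on smooth_continuous test_functionD(1)[OF \<phi>])
    have i2: "integrable (lebesgue_on D) (\<lambda>x. (V x \<bullet> i) * \<phi> x)" "integrable (lebesgue_on D) (\<lambda>x. (W x \<bullet> i) * \<phi> x)"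
      using integrable_mult_bounded_measurable[OF int(1) m, of B] integrable_mult_bounded_measurable[OF int(2) m, of B] B by auto
    have "(LINT x|lebesgue_on D. (V x \<bullet> i) * \<phi> x) = (LINT x|lebesgue_on D. (W x \<bullet> i) * \<phi> x)"
      using w[unfolded weak_grad_def, rule_format, OF \<phi> i] by simp
    then show "(LINT x|lebesgue_on D. (V x \<bullet> i - W x \<bullet> i) * \<phi> x) = 0"
      using i2 by (simp add: left_diff_distrib)
  qed
  then show ?thesis by eventually_elim (auto intro: euclidean_eqI)
qed

lemma deriv_eq_pd:
  assumes "f differentiable (at x)"
  shows "deriv f x = pd (1::real) f x"
proof -
  have "frechet_derivative f (at x) h = pd 1 f x * h" for h
    using linear_cmul[OF linear_frechet_derivative[OF assms], of h 1] by (simp add: mult.commute)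
  then have "frechet_derivative f (at x) = (*) (pd 1 f x)" by (rule ext)
  then have "(f has_real_derivative pd 1 f x) (at x)"
    using assms unfolding frechet_derivative_works has_field_derivative_def by metis
  then show ?thesis by (rule DERIV_imp_deriv)
qed

text \<open>The null set in \<open>has_time_deriv\<close> depends on the test function. The
  countable family reduces this to one null set of points x; off it the two derivatives agree for
  almost every t, and Fubini exchanges the order of the quantifiers.\<close>

lemma time_deriv_unique:
  assumes fin: "finite_measure \<mu>" and u: "has_time_deriv T \<mu> u v" "has_time_deriv T \<mu> u w"
  shows "AE t in time T. AE x in \<mu>. v t x = w t x"
proof -
  interpret \<mu>: finite_measure \<mu> by (rule fin)
  interpret \<tau>: finite_measure "time T" by (rule finite_measure_time)
  interpret P: pair_sigma_finite "time T" \<mu> ..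
  have finP: "finite_measure (time T \<Otimes>\<^sub>M \<mu>)" by (rule finite_measure_pair_measure) unfold_locales
  have L: "L2_fun (time T \<Otimes>\<^sub>M \<mu>) (\<lambda>(t, x). v t x)" "L2_fun (time T \<Otimes>\<^sub>M \<mu>) (\<lambda>(t, x). w t x)"
    using u by (auto simp: has_time_deriv_def)
  note int = this[THEN L2_fun_integrable[OF finP]]
  have [measurable]: "(\<lambda>(t, x). v t x) \<in> borel_measurable (time T \<Otimes>\<^sub>M \<mu>)" "(\<lambda>(t, x). w t x) \<in> borel_measurable (time T \<Otimes>\<^sub>M \<mu>)"
    using int by auto
  obtain \<T> where \<T>: "countable \<T>" "\<And>\<phi>. \<phi> \<in> \<T> \<Longrightarrow> test_function {0<..<T} \<phi>"
    "\<forall>f::real \<Rightarrow> real. integrable (time T) f \<longrightarrow>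
       (\<forall>\<phi>\<in>\<T>. (LINT x|time T. f x * \<phi> x) = 0) \<longrightarrow> (AE x in time T. f x = 0)"
    by (rule fundamental_lemma_cov[OF open_real_greaterThanLessThan[of 0 T]]) (rule that)
  have 1: "AE x in \<mu>. \<forall>\<phi>\<in>\<T>. (LINT t|time T. u t x * deriv \<phi> t) = - (LINT t|time T. v t x * \<phi> t)"
    using u(1) \<T>(2) by (subst AE_ball_countable[OF \<T>(1)]) (auto simp: has_time_deriv_def)
  have 2: "AE x in \<mu>. \<forall>\<phi>\<in>\<T>. (LINT t|time T. u t x * deriv \<phi> t) = - (LINT t|time T. w t x * \<phi> t)"
    using u(2) \<T>(2) by (subst AE_ball_countable[OF \<T>(1)]) (auto simp: has_time_deriv_def)
  have "AE x in \<mu>. AE t in time T. v t x = w t x"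
    using 1 2 P.AE_integrable_snd[OF int(1)] P.AE_integrable_snd[OF int(2)]
  proof eventually_elim
    case (elim x)
    have "AE t in time T. v t x - w t x = 0"
    proof (rule \<T>(3)[rule_format])
      show "integrable (time T) (\<lambda>t. v t x - w t x)" using elim by simp
      fix \<phi> assume "\<phi> \<in> \<T>"
      then have \<phi>: "test_function {0<..<T} \<phi>" by (rule \<T>(2))
      obtain R where "\<And>x. norm x > R \<Longrightarrow> \<phi> x = 0" using test_functionD(5)[OF \<phi>] by blast
      then obtain B where B: "\<And>x. norm (\<phi> x) \<le> B"
        using continuous_bounded_support_bounded[of \<phi> R] smooth_continuous[OF test_functionD(1)[OF \<phi>]] by blast
      have m: "\<phi> \<in> borel_measurable (time T)"
        by (intro continuous_measurable_lebesgue_on smooth_continuous test_functionD(1)[OF \<phi>])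
      have "integrable (time T) (\<lambda>t. v t x * \<phi> t)" "integrable (time T) (\<lambda>t. w t x * \<phi> t)"
        using elim integrable_mult_bounded_measurable[OF _ m, of _ B] B by auto
      moreover have "(LINT t|time T. v t x * \<phi> t) = (LINT t|time T. w t x * \<phi> t)"
        using bspec[OF elim(1) \<open>\<phi> \<in> \<T>\<close>] bspec[OF elim(2) \<open>\<phi> \<in> \<T>\<close>] by simp
      ultimately show "(LINT t|time T. (v t x - w t x) * \<phi> t) = 0" by (simp add: left_diff_distrib)
    qed
    then show ?case by simp
  qed
  then show ?thesis by (subst P.AE_commute) measurable
qed

section \<open>Separable test functions \<open>\<eta> t * \<Phi> x\<close>\<close>

context
  fixes \<Omega> :: "'a::euclidean_space set" and T :: real and \<eta> :: "real \<Rightarrow> real" and \<Phi> :: "'a \<Rightarrow> real"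
  assumes \<Omega>: "open \<Omega>" "bounded \<Omega>" and \<eta>: "smooth \<eta>" "\<eta> 0 = 0" "\<eta> T = 0" and \<Phi>: "smooth \<Phi>"
begin

lemma L2_fun_product:
  fixes w :: "'a \<Rightarrow> 'b::euclidean_space"
  assumes h: "continuous_on UNIV h" and w: "continuous_on UNIV w"
  shows "L2_fun (time T \<Otimes>\<^sub>M (lebesgue_on \<Omega>)) (\<lambda>(t, x). h t *\<^sub>R w x)"
proof -
  obtain B1 where B1: "\<forall>t\<in>{0<..<T}. norm (h t :: real) \<le> B1"
    using continuous_bounded_on_bounded[OF h, of "{0<..<T}"] by auto
  obtain B2 where B2: "\<forall>x\<in>\<Omega>. norm (w x) \<le> B2"
    using continuous_bounded_on_bounded[OF w \<Omega>(2)] by blast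
  have [measurable]: "h \<in> borel_measurable (time T)" "w \<in> borel_measurable (lebesgue_on \<Omega>)"
    using h w by (auto intro: continuous_measurable_lebesgue_on)
  interpret space: finite_measure "lebesgue_on \<Omega>" by (rule finite_measure_open_bounded[OF \<Omega>])
  interpret \<tau>: finite_measure "time T" by (rule finite_measure_time)
  have finP: "finite_measure (time T \<Otimes>\<^sub>M (lebesgue_on \<Omega>))" by (rule finite_measure_pair_measure) unfold_locales
  show ?thesis
  proof (rule L2_fun_bounded[OF finP, of _ "B1 * B2"])
    fix z assume "z \<in> space (time T \<Otimes>\<^sub>M (lebesgue_on \<Omega>))"
    then obtain t x where z: "z = (t, x)" "t \<in> {0<..<T}" "x \<in> \<Omega>"
      by (auto simp: space_pair_measure space_restrict_space)
    show "norm (case z of (t, x) \<Rightarrow> h t *\<^sub>R w x) \<le> B1 * B2"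
      using B1[rule_format, OF z(2)] B2[rule_format, OF z(3)] by (simp add: z(1) mult_mono')
  qed measurable
qed

lemma product_has_spatial_grad:
  assumes h: "continuous_on UNIV h"
  shows "has_spatial_grad T (lebesgue_on \<Omega>) (H1_grad \<Omega>) (\<lambda>t x. h t * \<Phi> x) (\<lambda>t x. h t *\<^sub>R grad \<Phi> x)"
proof -
  have g: "grad (\<lambda>x. c * \<Phi> x) = (\<lambda>x. c *\<^sub>R grad \<Phi> x)" for c
    using pd_mult[OF smooth_differentiable[OF smooth_const] smooth_differentiable[OF \<Phi>]]
      pd_eqI[OF has_derivative_const]
    by (auto simp: grad_def scaleR_sum_right fun_eq_iff)
  have "H1_grad \<Omega> (\<lambda>x. c * \<Phi> x) (\<lambda>x. c *\<^sub>R grad \<Phi> x)" for c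
    using H1_grad_smooth[OF \<Omega> smooth_mult[OF smooth_const \<Phi>]] by (simp add: g)
  then show ?thesis
    using L2_fun_product[OF h smooth_continuous[OF \<Phi>]] L2_fun_product[OF h smooth_continuous_grad[OF \<Phi>]]
    by (simp add: has_spatial_grad_def)
qed

lemma smooth_deriv: "smooth (deriv \<eta>)"
proof -
  have "deriv \<eta> = (\<lambda>x. pd 1 \<eta> x)"
    using deriv_eq_pd[OF smooth_differentiable[OF \<eta>(1)]] by blast
  then show ?thesis using smooth_pd[OF \<eta>(1), of 1] by simp
qed

lemma product_has_time_deriv:
  "has_time_deriv T (lebesgue_on \<Omega>) (\<lambda>t x. \<eta> t * \<Phi> x) (\<lambda>t x. deriv \<eta> t * \<Phi> x)"
proof -
  have "(LINT t|time T. \<eta> t * \<Phi> x * deriv \<psi> t) = - (LINT t|time T. deriv \<eta> t * \<Phi> x * \<psi> t)"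
    if \<psi>: "test_function {0<..<T} \<psi>" for \<psi> x
  proof -
    have d: "deriv \<psi> t = pd 1 \<psi> t" "deriv \<eta> t = pd 1 \<eta> t" for t
      by (intro deriv_eq_pd smooth_differentiable test_functionD(1)[OF \<psi>] \<eta>)+
    have "(LINT t|time T. \<eta> t * pd 1 \<psi> t) = - (LINT t|time T. pd 1 \<eta> t * \<psi> t)"
      by (rule integration_by_parts_test[OF \<eta>(1) \<psi>]) auto
    then have "\<Phi> x * (LINT t|time T. \<eta> t * pd 1 \<psi> t) = - (\<Phi> x * (LINT t|time T. pd 1 \<eta> t * \<psi> t))" by simp
    then show ?thesis unfolding d by (simp add: mult_ac flip: integral_mult_right_zero)
  qed
  then show ?thesis
    using L2_fun_product[OF smooth_continuous[OF \<eta>(1)] smooth_continuous[OF \<Phi>]]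
      L2_fun_product[OF smooth_continuous[OF smooth_deriv] smooth_continuous[OF \<Phi>]]
    by (auto simp: has_time_deriv_def)
qed

lemma product_in_H10X: "(\<lambda>t x. \<eta> t * \<Phi> x) \<in> H10X T (lebesgue_on \<Omega>) (H1_grad \<Omega>)"
proof -
  note sg = product_has_spatial_grad[OF smooth_continuous[OF \<eta>(1)]] product_has_spatial_grad[OF smooth_continuous[OF smooth_deriv]]
  have "(\<lambda>t x. \<eta> t * \<Phi> x) \<in> H1X T (lebesgue_on \<Omega>) (H1_grad \<Omega>)"
    unfolding H1X_def L2X_def using sg product_has_time_deriv by blast
  moreover have "(\<lambda>t x. \<eta> t * \<Phi> x) \<in> CL2 T (lebesgue_on \<Omega>)"
    unfolding CL2_def
  proof (intro CollectI ballI conjI)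
    fix t
    show L: "L2_fun (lebesgue_on \<Omega>) (\<lambda>x. \<eta> t * \<Phi> x)"
      by (intro L2_fun_continuous \<Omega> continuous_intros smooth_continuous \<Phi>)
    have "L2_fun (lebesgue_on \<Omega>) \<Phi>" by (intro L2_fun_continuous \<Omega> smooth_continuous \<Phi>)
    then have i: "integrable (lebesgue_on \<Omega>) (\<lambda>x. (norm (\<Phi> x))\<^sup>2)" by (simp add: L2_fun_def)
    \<comment> \<open>In time the function only rescales a fixed profile, so its L^2 distance is the
      increment of \<open>\<eta>\<close> times the norm of \<open>\<Phi>\<close>.\<close>
    have eq: "(\<integral>\<^sup>+ x. ennreal ((norm (\<eta> s * \<Phi> x - \<eta> t * \<Phi> x))\<^sup>2) \<partial>(lebesgue_on \<Omega>))
        = ennreal ((\<eta> s - \<eta> t)\<^sup>2 * (LINT x|(lebesgue_on \<Omega>). (norm (\<Phi> x))\<^sup>2))" for s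
    proof -
      have "norm (\<eta> s * \<Phi> x - \<eta> t * \<Phi> x) ^ 2 = (\<eta> s - \<eta> t)\<^sup>2 * (norm (\<Phi> x))\<^sup>2" for x
        by (simp add: power_mult_distrib flip: left_diff_distrib)
      then show ?thesis using i by (simp add: nn_integral_eq_integral)
    qed
    have "((\<lambda>s. (\<eta> s - \<eta> t)\<^sup>2 * (LINT x|(lebesgue_on \<Omega>). (norm (\<Phi> x))\<^sup>2)) \<longlongrightarrow> (\<eta> t - \<eta> t)\<^sup>2 * (LINT x|(lebesgue_on \<Omega>). (norm (\<Phi> x))\<^sup>2)) (at t within {0..T})"
      using smooth_continuous[OF \<eta>(1), of UNIV]
      by (intro tendsto_intros) (metis continuous_on_def UNIV_I continuous_on_eq_continuous_within iso_tuple_UNIV_I continuous_within tendsto_within_subset subset_UNIV)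
    then show "L2_conv (lebesgue_on \<Omega>) (\<lambda>t x. \<eta> t * \<Phi> x) (\<lambda>x. \<eta> t * \<Phi> x) (at t within {0..T})"
      unfolding L2_conv_def eq by (intro tendsto_ennrealI[of _ 0, simplified]) simp
  qed
  ultimately show ?thesis using \<eta> by (simp add: H10X_def)
qed

lemma product_spatial_grad:
  "AE t in time T. AE x in (lebesgue_on \<Omega>). spatial_grad T (lebesgue_on \<Omega>) (H1_grad \<Omega>) (\<lambda>t x. \<eta> t * \<Phi> x) t x = \<eta> t *\<^sub>R grad \<Phi> x"
proof -
  note p = product_has_spatial_grad[OF smooth_continuous[OF \<eta>(1)]]
  then have "has_spatial_grad T (lebesgue_on \<Omega>) (H1_grad \<Omega>) (\<lambda>t x. \<eta> t * \<Phi> x) (spatial_grad T (lebesgue_on \<Omega>) (H1_grad \<Omega>) (\<lambda>t x. \<eta> t * \<Phi> x))"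
    unfolding spatial_grad_def by (rule someI[of "has_spatial_grad T (lebesgue_on \<Omega>) (H1_grad \<Omega>) (\<lambda>t x. \<eta> t * \<Phi> x)"])
  then have "AE t in time T. H1_grad \<Omega> (\<lambda>x. \<eta> t * \<Phi> x) (spatial_grad T (lebesgue_on \<Omega>) (H1_grad \<Omega>) (\<lambda>t x. \<eta> t * \<Phi> x) t)"
    "AE t in time T. H1_grad \<Omega> (\<lambda>x. \<eta> t * \<Phi> x) (\<lambda>x. \<eta> t *\<^sub>R grad \<Phi> x)"
    using p by (auto simp: has_spatial_grad_def)
  then show ?thesis
    by eventually_elim (auto simp: H1_grad_def intro: weak_grad_unique[OF \<Omega>])
qed

lemma product_time_deriv:
  "AE t in time T. AE x in (lebesgue_on \<Omega>). time_deriv T (lebesgue_on \<Omega>) (\<lambda>t x. \<eta> t * \<Phi> x) t x = deriv \<eta> t * \<Phi> x"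
proof -
  have "has_time_deriv T (lebesgue_on \<Omega>) (\<lambda>t x. \<eta> t * \<Phi> x) (time_deriv T (lebesgue_on \<Omega>) (\<lambda>t x. \<eta> t * \<Phi> x))"
    unfolding time_deriv_def by (rule someI[of "has_time_deriv T (lebesgue_on \<Omega>) (\<lambda>t x. \<eta> t * \<Phi> x)"]) (rule product_has_time_deriv)
  then show ?thesis
    by (rule time_deriv_unique[OF finite_measure_open_bounded[OF \<Omega>]]) (rule product_has_time_deriv)
qed

end

section \<open>Flatness of the measured boundary part\<close>

context
  fixes \<Omega> :: "'a::euclidean_space set" and xbar e :: 'a and \<epsilon>0 :: real
  assumes \<Omega>: "open \<Omega>" and e: "norm e = 1" and xbar: "xbar \<in> frontier \<Omega>" and \<epsilon>0: "\<epsilon>0 > 0"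
    and normal: "\<And>x. x \<in> ball xbar \<epsilon>0 \<Longrightarrow> x \<in> frontier \<Omega> \<Longrightarrow> is_outer_normal \<Omega> x e"
begin

private lemma ee: "e \<bullet> e = 1"
  using e by (simp add: norm_eq_1)

private lemma normalE:
  assumes "p \<in> ball xbar \<epsilon>0" "p \<in> frontier \<Omega>" "\<delta> > 0"
  obtains r where "r > 0"
    "\<And>y. y \<in> ball p r \<Longrightarrow> (y - p) \<bullet> e < - \<delta> * norm (y - p) \<Longrightarrow> y \<in> \<Omega>"
    "\<And>y. y \<in> ball p r \<Longrightarrow> (y - p) \<bullet> e > \<delta> * norm (y - p) \<Longrightarrow> y \<notin> \<Omega>"
  using normal[OF assms(1,2)] assms(3) unfolding is_outer_normal_def by meson

text \<open>Going upwards, a vertical line cannot re-enter \<open>\<Omega>\<close>: at the re-entry point \<open>e\<close> would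
  point into \<open>\<Omega>\<close>.\<close>

private lemma downward_closed:
  assumes y: "y \<in> ball xbar \<epsilon>0" "y + s *\<^sub>R e \<in> ball xbar \<epsilon>0" "y + s *\<^sub>R e \<in> \<Omega>" and s: "s > 0"
  shows "y \<in> \<Omega>"
proof (rule ccontr)
  assume "y \<notin> \<Omega>"
  \<comment> \<open>\<open>Z\<close> holds the parameters at which the vertical segment is outside
    \<open>\<Omega>\<close>. Its largest element gives the last exterior point \<open>p\<close>; the
    segment above lies in \<open>\<Omega>\<close>, so \<open>p\<close> is a boundary point at which
    moving along \<open>e\<close> enters \<open>\<Omega>\<close>.\<close>
  define Z where "Z = {0..s} \<inter> (\<lambda>s'. y + s' *\<^sub>R e) -` (- \<Omega>)"
  have "closed ((\<lambda>s'. y + s' *\<^sub>R e) -` (- \<Omega>))"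
    using \<Omega> by (intro continuous_closed_vimage) (auto intro!: continuous_intros)
  then have "compact Z" unfolding Z_def by (intro compact_Int_closed) auto
  moreover have "0 \<in> Z" using \<open>y \<notin> \<Omega>\<close> s by (simp add: Z_def)
  ultimately obtain s0 where s0: "s0 \<in> Z" "\<And>t. t \<in> Z \<Longrightarrow> t \<le> s0"
    using compact_attains_sup[of Z] by auto
  have "s0 \<noteq> s" using s0(1) y(3) by (auto simp: Z_def)
  then have s0s: "0 \<le> s0" "s0 < s" using s0(1) by (auto simp: Z_def)
  have above: "y + t *\<^sub>R e \<in> \<Omega>" if "s0 < t" "t \<le> s" for t
    using s0(2)[of t] s0s that by (auto simp: Z_def)
  define p where "p = y + s0 *\<^sub>R e"
  have "p \<notin> \<Omega>" using s0(1) by (auto simp: Z_def p_def)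
  have "p \<in> frontier \<Omega>" unfolding frontier_straddle
  proof (intro allI impI conjI)
    fix d :: real assume d: "d > 0"
    define t where "t = s0 + min (d / 2) (s - s0)"
    have t: "s0 < t" "t \<le> s" "t - s0 < d" using d s0s by (auto simp: t_def)
    have "dist p (y + t *\<^sub>R e) = norm ((s0 - t) *\<^sub>R e)" by (simp add: p_def dist_norm algebra_simps)
    also have "\<dots> < d" using t e by simp
    finally show "\<exists>x\<in>\<Omega>. dist p x < d" using above[OF t(1,2)] by blast
    show "\<exists>x. x \<notin> \<Omega> \<and> dist p x < d" using \<open>p \<notin> \<Omega>\<close> d by (intro exI[of _ p]) auto
  qed
  moreover have "p \<in> ball xbar \<epsilon>0"
  proof -
    have "(1 - s0 / s) *\<^sub>R y + (s0 / s) *\<^sub>R (y + s *\<^sub>R e) \<in> ball xbar \<epsilon>0"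
      using y s0s s by (intro convexD[OF convex_ball]) auto
    also have "(1 - s0 / s) *\<^sub>R y + (s0 / s) *\<^sub>R (y + s *\<^sub>R e) = p"
      using s by (simp add: p_def algebra_simps)
    finally show ?thesis .
  qed
  ultimately obtain r where r: "r > 0" "\<And>y. y \<in> ball p r \<Longrightarrow> (y - p) \<bullet> e > 1/2 * norm (y - p) \<Longrightarrow> y \<notin> \<Omega>"
    using normalE[of p "1/2"] by (metis half_gt_zero zero_less_one)
  define \<tau> where "\<tau> = min (r / 2) (s - s0)"
  have \<tau>: "0 < \<tau>" "\<tau> < r" "s0 + \<tau> \<le> s" using r s0s by (auto simp: \<tau>_def)
  have "p + \<tau> *\<^sub>R e \<notin> \<Omega>"
    by (rule r(2)) (use \<tau> e ee in \<open>auto simp: dist_norm\<close>)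
  moreover have "p + \<tau> *\<^sub>R e = y + (s0 + \<tau>) *\<^sub>R e" by (simp add: p_def algebra_simps)
  ultimately show False using above[of "s0 + \<tau>"] \<tau> by simp
qed

text \<open>Near \<open>xbar\<close> the set \<open>\<Omega>\<close> lies below the graph of a
  height function \<open>h\<close> over a flat disc \<open>D\<close>. At each graph point the outer
  normal is \<open>e\<close>, which forces the derivative of \<open>h\<close> to vanish;
  \<open>D\<close> is convex, so \<open>h\<close> is constant, and its value at \<open>xbar\<close>
  is zero.\<close>

lemma flat_boundary:
  "\<exists>\<rho>>0. \<rho> \<le> \<epsilon>0 \<and> (\<forall>y\<in>ball xbar \<rho>. y \<in> \<Omega> \<longleftrightarrow> y \<bullet> e < xbar \<bullet> e)"
proof -
  have "xbar \<in> ball xbar \<epsilon>0" using \<epsilon>0 by simp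
  from normalE[OF this xbar, of "1/2"] obtain r where r: "r > 0"
    "\<And>y. y \<in> ball xbar r \<Longrightarrow> (y - xbar) \<bullet> e < - (1/2) * norm (y - xbar) \<Longrightarrow> y \<in> \<Omega>"
    "\<And>y. y \<in> ball xbar r \<Longrightarrow> (y - xbar) \<bullet> e > (1/2) * norm (y - xbar) \<Longrightarrow> y \<notin> \<Omega>"
    by (auto simp: field_simps)
  \<comment> \<open>A quarter, so that points over \<open>D\<close> at heights up to
    \<open>2 * \<rho>\<close> have distance less than \<open>3 * \<rho>\<close> from
    \<open>xbar\<close> and stay in both balls.\<close>
  define \<rho> where "\<rho> = min r \<epsilon>0 / 4"
  have \<rho>: "\<rho> > 0" "4 * \<rho> \<le> r" "4 * \<rho> \<le> \<epsilon>0" using r(1) \<epsilon>0 by (auto simp: \<rho>_def)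
  define D where "D = {x. (x - xbar) \<bullet> e = 0 \<and> norm (x - xbar) < \<rho>}"
  have inball: "norm (x + s *\<^sub>R e - xbar) < \<rho> + \<bar>s\<bar>" "(x + s *\<^sub>R e - xbar) \<bullet> e = s" if "x \<in> D" for x s
  proof -
    have "norm (x + s *\<^sub>R e - xbar) \<le> norm (x - xbar) + norm (s *\<^sub>R e)"
      using norm_triangle_ineq[of "x - xbar" "s *\<^sub>R e"] by (simp add: algebra_simps)
    then show "norm (x + s *\<^sub>R e - xbar) < \<rho> + \<bar>s\<bar>" using that e by (simp add: D_def)
    show "(x + s *\<^sub>R e - xbar) \<bullet> e = s" using that ee by (simp add: D_def inner_diff_left inner_add_left)
  qed
  have ball: "x + s *\<^sub>R e \<in> ball xbar r" "x + s *\<^sub>R e \<in> ball xbar \<epsilon>0" if "x \<in> D" "\<bar>s\<bar> \<le> 2 * \<rho>" for x s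
    using inball(1)[OF that(1), of s] that(2) \<rho> by (auto simp: dist_norm norm_minus_commute)
  \<comment> \<open>Once the height exceeds \<open>\<rho>\<close> in absolute value it is more than
    half the distance to \<open>xbar\<close>, so the cone condition at \<open>xbar\<close> with
    aperture 1/2 decides membership.\<close>
  have low: "x + s *\<^sub>R e \<in> \<Omega>" if "x \<in> D" "- 2 * \<rho> \<le> s" "s < - \<rho>" for x s
    by (rule r(2)[OF ball(1)]) (use inball[OF that(1), of s] that \<rho> in auto)
  have high: "x + s *\<^sub>R e \<notin> \<Omega>" if "x \<in> D" "s \<le> 2 * \<rho>" "s > \<rho>" for x s
    by (rule r(3)[OF ball(1)]) (use inball[OF that(1), of s] that \<rho> in auto)
  define S where "S x = {s. \<bar>s\<bar> \<le> 2 * \<rho> \<and> x + s *\<^sub>R e \<in> \<Omega>}" for x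
  define h where "h x = Sup (S x)" for x
  have S: "S x \<noteq> {}" "bdd_above (S x)" "h x \<le> \<rho>" "- 3/2 * \<rho> \<le> h x" if "x \<in> D" for x
  proof -
    have m: "- 3/2 * \<rho> \<in> S x" using low[OF that, of "- 3/2 * \<rho>"] \<rho> by (simp add: S_def)
    then show "S x \<noteq> {}" by blast
    have u: "s \<le> \<rho>" if "s \<in> S x" for s using high[OF \<open>x \<in> D\<close>, of s] that by (force simp: S_def)
    then show "bdd_above (S x)" by (rule bdd_aboveI)
    show "h x \<le> \<rho>" unfolding h_def using \<open>S x \<noteq> {}\<close> u by (rule cSup_least)
    show "- 3/2 * \<rho> \<le> h x" unfolding h_def using m \<open>bdd_above (S x)\<close> by (rule cSup_upper)
  qed
  have below: "x + s *\<^sub>R e \<in> \<Omega>" if x: "x \<in> D" and s: "\<bar>s\<bar> \<le> 2 * \<rho>" "s < h x" for x s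
  proof -
    obtain s' where s': "s' \<in> S x" "s < s'"
      using less_cSupD[OF S(1)[OF x]] s(2) unfolding h_def by blast
    have eq: "x + s *\<^sub>R e + (s' - s) *\<^sub>R e = x + s' *\<^sub>R e" by (simp add: algebra_simps)
    show ?thesis
      by (rule downward_closed[of _ "s' - s"]) (use s' ball(2)[OF x] s in \<open>auto simp: S_def eq\<close>)
  qed
  have above': "x + s *\<^sub>R e \<notin> \<Omega>" if x: "x \<in> D" and s: "\<bar>s\<bar> \<le> 2 * \<rho>" "s > h x" for x s
    using cSup_upper[of s "S x"] S(2)[OF x] s by (auto simp: S_def h_def)
  \<comment> \<open>If the graph point were in the open set \<open>\<Omega>\<close>, slightly higher
    points would be too, against the supremum.\<close>
  have at: "x + h x *\<^sub>R e \<notin> \<Omega>" if x: "x \<in> D" for x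
  proof
    assume "x + h x *\<^sub>R e \<in> \<Omega>"
    then obtain d where d: "d > 0" "ball (x + h x *\<^sub>R e) d \<subseteq> \<Omega>" using \<Omega> openE by blast
    define t where "t = min (d / 2) (\<rho> / 2)"
    have t: "0 < t" "t < d" "t \<le> \<rho> / 2" using d \<rho> by (auto simp: t_def)
    have "x + (h x + t) *\<^sub>R e \<in> ball (x + h x *\<^sub>R e) d"
      using t e by (simp add: dist_norm algebra_simps)
    then have "x + (h x + t) *\<^sub>R e \<in> \<Omega>" using d by blast
    moreover have "x + (h x + t) *\<^sub>R e \<notin> \<Omega>"
      by (rule above'[OF x]) (use S(3,4)[OF x] t \<rho> in auto)
    ultimately show False by blast
  qed
  have front: "x + h x *\<^sub>R e \<in> frontier \<Omega>" if x: "x \<in> D" for x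
    unfolding frontier_straddle
  proof (intro allI impI conjI)
    fix d :: real assume d: "d > 0"
    define t where "t = min (d / 2) (\<rho> / 2)"
    have t: "0 < t" "t < d" "t \<le> \<rho> / 2" using d \<rho> by (auto simp: t_def)
    have "x + (h x - t) *\<^sub>R e \<in> \<Omega>"
      by (rule below[OF x]) (use S(3,4)[OF x] t \<rho> in auto)
    moreover have "dist (x + h x *\<^sub>R e) (x + (h x - t) *\<^sub>R e) < d"
      using t e by (simp add: dist_norm algebra_simps)
    ultimately show "\<exists>y\<in>\<Omega>. dist (x + h x *\<^sub>R e) y < d" by blast
    show "\<exists>y. y \<notin> \<Omega> \<and> dist (x + h x *\<^sub>R e) y < d" using at[OF x] d by (intro exI[of _ "x + h x *\<^sub>R e"]) auto
  qed
  have "convex D"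
  proof -
    have "D = {x. e \<bullet> x = e \<bullet> xbar} \<inter> ball xbar \<rho>"
      by (auto simp: D_def dist_norm norm_minus_commute inner_diff_left inner_commute[of e])
    then show ?thesis by (simp add: convex_Int convex_hyperplane)
  qed
  moreover have "(h has_derivative (\<lambda>_. 0)) (at x within D)" if x: "x \<in> D" for x
    unfolding has_derivative_within_alt
  proof (intro conjI allI impI)
    fix \<epsilon> :: real assume \<epsilon>: "\<epsilon> > 0"
    \<comment> \<open>Over a horizontal displacement of length \<Delta>, vertical offsets of size 2
      \<delta> \<Delta> are tested. As \<delta> is at most 1/4, the distance to \<open>p\<close>
      stays below 2 \<Delta>, so both test points fall into the cones of aperture \<delta>; the
      bound of 2 \<delta> by \<epsilon> then gives the derivative estimate.\<close>
    define \<delta> where "\<delta> = min (\<epsilon> / 2) (1 / 4)"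
    have \<delta>: "0 < \<delta>" "2 * \<delta> \<le> \<epsilon>" "\<delta> \<le> 1/4" using \<epsilon> by (auto simp: \<delta>_def)
    define p where "p = x + h x *\<^sub>R e"
    have hx: "\<bar>h x\<bar> \<le> 2 * \<rho>" using S(3,4)[OF x] \<rho> by auto
    obtain r' where r': "r' > 0"
      "\<And>y. y \<in> ball p r' \<Longrightarrow> (y - p) \<bullet> e < - \<delta> * norm (y - p) \<Longrightarrow> y \<in> \<Omega>"
      "\<And>y. y \<in> ball p r' \<Longrightarrow> (y - p) \<bullet> e > \<delta> * norm (y - p) \<Longrightarrow> y \<notin> \<Omega>"
      using normalE[OF ball(2)[OF x hx] front[OF x] \<delta>(1)] unfolding p_def by metis
    define d where "d = min (r' / 2) \<rho>"
    have "norm (h y - h x - 0) \<le> \<epsilon> * norm (y - x)" if y: "y \<in> D" "norm (y - x) < d" for y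
    proof (cases "y = x")
      case False
      define \<Delta> where "\<Delta> = norm (y - x)"
      have \<Delta>: "0 < \<Delta>" "\<Delta> < \<rho>" "2 * \<Delta> < r'" using False y(2) by (auto simp: \<Delta>_def d_def)
      have \<delta>\<Delta>: "2 * \<delta> * \<Delta> \<le> \<rho> / 2" "\<delta> * \<Delta> > 0"
        using mult_mono[of "2 * \<delta>" "1/2" \<Delta> \<rho>] \<delta> \<Delta> by auto
      have yx: "(y - x) \<bullet> e = 0" using x y(1) by (auto simp: D_def inner_diff_left)
      have q: "norm (y + (h x + t) *\<^sub>R e - p) < 2 * \<Delta>" "(y + (h x + t) *\<^sub>R e - p) \<bullet> e = t" if "\<bar>t\<bar> = 2 * \<delta> * \<Delta>" for t
      proof -
        have eq: "y + (h x + t) *\<^sub>R e - p = (y - x) + t *\<^sub>R e" by (simp add: p_def algebra_simps)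
        have "norm ((y - x) + t *\<^sub>R e) \<le> \<Delta> + 2 * \<delta> * \<Delta>"
          using norm_triangle_ineq[of "y - x" "t *\<^sub>R e"] e that by (simp add: \<Delta>_def)
        also have "\<dots> < 2 * \<Delta>" using mult_right_mono[of "2 * \<delta>" "1/2" \<Delta>] \<delta> \<Delta> by auto
        finally show "norm (y + (h x + t) *\<^sub>R e - p) < 2 * \<Delta>" unfolding eq .
        show "(y + (h x + t) *\<^sub>R e - p) \<bullet> e = t" unfolding eq using yx ee by (simp add: inner_add_left)
      qed
      have q': "\<delta> * norm (y + (h x + t) *\<^sub>R e - p) < 2 * \<delta> * \<Delta>" "y + (h x + t) *\<^sub>R e \<in> ball p r'" if "\<bar>t\<bar> = 2 * \<delta> * \<Delta>" for t
        using mult_strict_left_mono[OF q(1)[OF that] \<delta>(1)] q(1)[OF that] \<Delta>(3)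
        by (auto simp: dist_norm norm_minus_commute)
      have abs: "\<bar>- 2 * \<delta> * \<Delta>\<bar> = 2 * \<delta> * \<Delta>" "\<bar>2 * \<delta> * \<Delta>\<bar> = 2 * \<delta> * \<Delta>"
        using \<delta> \<Delta> by (simp_all add: abs_mult)
      have "y + (h x + (- 2 * \<delta> * \<Delta>)) *\<^sub>R e \<in> \<Omega>"
        by (rule r'(2)) (use q(2)[OF abs(1)] q'[OF abs(1)] in auto)
      then have "h x + (- 2 * \<delta> * \<Delta>) \<le> h y"
        using above'[OF y(1), of "h x + (- 2 * \<delta> * \<Delta>)"] S(3,4)[OF x] \<delta>\<Delta> \<rho> by force
      moreover have "y + (h x + 2 * \<delta> * \<Delta>) *\<^sub>R e \<notin> \<Omega>"
        by (rule r'(3)) (use q(2)[OF abs(2)] q'[OF abs(2)] in auto)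
      then have "h y \<le> h x + 2 * \<delta> * \<Delta>"
        using below[OF y(1), of "h x + 2 * \<delta> * \<Delta>"] S(3,4)[OF x] \<delta>\<Delta> \<rho> by force
      ultimately have "\<bar>h y - h x\<bar> \<le> 2 * \<delta> * \<Delta>" by auto
      also have "\<dots> \<le> \<epsilon> * \<Delta>" using \<delta>(2) \<Delta>(1) by (intro mult_right_mono) auto
      finally show ?thesis by (simp add: \<Delta>_def)
    qed simp
    moreover have "d > 0" using r'(1) \<rho> by (simp add: d_def)
    ultimately show "\<exists>d>0. \<forall>y\<in>D. norm (y - x) < d \<longrightarrow> norm (h y - h x - 0) \<le> \<epsilon> * norm (y - x)" by blast
  qed simp
  ultimately obtain c where c: "\<And>x. x \<in> D \<Longrightarrow> h x = c"
    using has_derivative_zero_constant[of D h] by auto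
  have xD: "xbar \<in> D" using \<rho> by (simp add: D_def)
  \<comment> \<open>On the vertical axis through \<open>xbar\<close> the cone condition holds at
    every small nonzero height, which excludes either sign of \<open>h xbar\<close>.\<close>
  have "h xbar = 0"
  proof (rule antisym)
    show "h xbar \<le> 0"
    proof (rule ccontr)
      assume "\<not> h xbar \<le> 0"
      then have pos: "0 < h xbar / 2" "h xbar / 2 < h xbar" "h xbar / 2 \<le> 2 * \<rho>" using S(3)[OF xD] \<rho> by auto
      have "xbar + (h xbar / 2) *\<^sub>R e \<in> \<Omega>" by (rule below[OF xD]) (use pos in auto)
      moreover have "xbar + (h xbar / 2) *\<^sub>R e \<notin> \<Omega>"
        by (rule r(3)[OF ball(1)[OF xD]]) (use pos e ee in auto)
      ultimately show False by blast
    qed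
    show "0 \<le> h xbar"
    proof (rule ccontr)
      assume "\<not> 0 \<le> h xbar"
      then have neg: "h xbar / 2 < 0" "h xbar / 2 > h xbar" "- (2 * \<rho>) \<le> h xbar / 2" using S(4)[OF xD] \<rho> by auto
      have "xbar + (h xbar / 2) *\<^sub>R e \<notin> \<Omega>" by (rule above'[OF xD]) (use neg in auto)
      moreover have "xbar + (h xbar / 2) *\<^sub>R e \<in> \<Omega>"
        by (rule r(2)[OF ball(1)[OF xD]]) (use neg e ee in auto)
      ultimately show False by blast
    qed
  qed
  then have h0: "h x = 0" if "x \<in> D" for x using c[OF that] c[OF xD] by simp
  have "y \<in> \<Omega> \<longleftrightarrow> y \<bullet> e < xbar \<bullet> e" if y: "y \<in> ball xbar \<rho>" for y
  proof -
    define s where "s = (y - xbar) \<bullet> e"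
    define x where "x = y - s *\<^sub>R e"
    have sy: "\<bar>s\<bar> \<le> norm (y - xbar)" using Cauchy_Schwarz_ineq2[of "y - xbar" e] e by (simp add: s_def)
    have "(norm (x - xbar))\<^sup>2 = (norm (y - xbar))\<^sup>2 - s\<^sup>2"
      unfolding x_def power2_norm_eq_inner using ee
      by (simp add: inner_diff_left inner_diff_right s_def inner_commute algebra_simps power2_eq_square)
    then have "(norm (x - xbar))\<^sup>2 \<le> (norm (y - xbar))\<^sup>2" using zero_le_power2[of s] by linarith
    then have "norm (x - xbar) \<le> norm (y - xbar)" by (rule power2_le_imp_le) (rule norm_ge_zero)
    then have x: "x \<in> D" using y ee
      by (simp add: D_def dist_norm norm_minus_commute) (simp add: x_def s_def inner_diff_left)
    have s: "\<bar>s\<bar> \<le> 2 * \<rho>" using sy y \<rho> by (simp add: dist_norm norm_minus_commute)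
    have y_eq: "y = x + s *\<^sub>R e" by (simp add: x_def)
    have "s < 0 \<Longrightarrow> y \<in> \<Omega>" "s > 0 \<Longrightarrow> y \<notin> \<Omega>" "s = 0 \<Longrightarrow> y \<notin> \<Omega>"
      using below[OF x s] above'[OF x s] at[OF x] h0[OF x] by (simp_all flip: y_eq) (simp add: x_def)
    then have "y \<in> \<Omega> \<longleftrightarrow> s < 0" by linarith
    then show ?thesis by (simp add: s_def inner_diff_left)
  qed
  then show ?thesis using \<rho> by (intro exI[of _ \<rho>]) auto
qed

end

section \<open>Comparison of surface measure and Lebesgue measure on a hyperplane\<close>

text \<open>In plane coordinates a covering set of diameter d lies in a cube of side 2d around one
  of its points. The volume (2d)^N of the cube is \<open>4 ^ N / unit_ball_vol (real N)\<close>
  times the contribution of that set to the Hausdorff sum, where \<open>N\<close> is the dimension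
  of the plane.\<close>

lemma emeasure_plane_le_hausdorff_pre:
  fixes e :: "'a::euclidean_space" and E :: "'a set"
  assumes e: "e \<in> Basis" and E: "E \<in> sets borel"
  defines "N \<equiv> DIM('a) - 1"
  shows "emeasure (plane_measure e) {x \<in> space (plane_measure e). pt e c x \<in> E}
    \<le> ennreal (4 ^ N / unit_ball_vol (real N)) * hausdorff_pre N \<delta> E"
proof -
  interpret product_sigma_finite "\<lambda>_::'a. lborel :: real measure" by standard
  let ?C = "4 ^ N / unit_ball_vol (real N)"
  have \<omega>: "unit_ball_vol (real N) > 0" by simp
  have C0: "0 \<le> ?C" using \<omega> by simp
  have card: "card (Basis - {e}) = N" using e by (simp add: N_def card_Diff_singleton)
  have "emeasure (plane_measure e) {x \<in> space (plane_measure e). pt e c x \<in> E}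
     \<le> ennreal ?C * (\<Sum>i. ennreal (unit_ball_vol (real N) * (diameter (U i) / 2) ^ N))"
    if U: "E \<subseteq> (\<Union>i. U i)" "\<And>i. bounded (U i)" for U :: "nat \<Rightarrow> 'a set"
  proof -
    have "\<exists>B. B \<in> sets (plane_measure e) \<and> {x \<in> space (plane_measure e). pt e c x \<in> U i} \<subseteq> B \<and>
       emeasure (plane_measure e) B \<le> ennreal (?C * (unit_ball_vol (real N) * (diameter (U i) / 2) ^ N))" for i
    proof (cases "U i = {}")
      case False
      then obtain u where u: "u \<in> U i" by blast
      define d where "d = diameter (U i)"
      have d: "d \<ge> 0" unfolding d_def using U(2) by (rule diameter_ge_0)
      define B where "B = Pi\<^sub>E (Basis - {e}) (\<lambda>b. {u \<bullet> b - d .. u \<bullet> b + d})"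
      have "{x \<in> space (plane_measure e). pt e c x \<in> U i} \<subseteq> B"
      proof clarify
        fix x assume x: "x \<in> space (plane_measure e)" "pt e c x \<in> U i"
        have bd: "\<bar>x b - u \<bullet> b\<bar> \<le> d" if b: "b \<in> Basis - {e}" for b
        proof -
          have "\<bar>x b - u \<bullet> b\<bar> = \<bar>(pt e c x - u) \<bullet> b\<bar>" using b e by (simp add: inner_diff_left pt_inner)
          also have "\<dots> \<le> norm (pt e c x - u)" using b by (intro Basis_le_norm) auto
          also have "\<dots> \<le> d" unfolding d_def using diameter_bounded_bound[OF U(2) x(2) u] by (simp add: dist_norm)
          finally show ?thesis .
        qed
        have "x \<in> extensional (Basis - {e})" using x(1) by (simp add: plane_measure_def space_PiM PiE_iff)
        moreover have "u \<bullet> b - d \<le> x b \<and> x b \<le> u \<bullet> b + d" if "b \<in> Basis - {e}" for b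
          using bd[OF that] by (simp add: abs_le_iff)
        ultimately show "x \<in> B" unfolding B_def PiE_iff by simp
      qed
      moreover have "B \<in> sets (plane_measure e)"
        unfolding B_def plane_measure_def by (intro sets_PiM_I_finite) auto
      moreover have "emeasure (plane_measure e) B = (\<Prod>b\<in>Basis - {e}. emeasure lborel {u \<bullet> b - d .. u \<bullet> b + d})"
        unfolding B_def plane_measure_def by (intro emeasure_PiM) auto
      then have "emeasure (plane_measure e) B = ennreal ((2 * d) ^ N)"
        using d by (simp add: card ennreal_power)
      moreover have "(2 * d) ^ N = ?C * (unit_ball_vol (real N) * (d / 2) ^ N)"
      proof -
        have "(2 * d) ^ N = (4 * (d / 2)) ^ N" by simp
        then show ?thesis using less_imp_neq[OF \<omega>] by (simp add: power_mult_distrib del: times_divide_eq_right)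
      qed
      ultimately show ?thesis unfolding d_def[symmetric] by (intro exI[of _ B]) auto
    qed (auto intro!: exI[of _ "{}"])
    then have "\<forall>i. \<exists>B. B \<in> sets (plane_measure e) \<and> {x \<in> space (plane_measure e). pt e c x \<in> U i} \<subseteq> B \<and>
       emeasure (plane_measure e) B \<le> ennreal (?C * (unit_ball_vol (real N) * (diameter (U i) / 2) ^ N))"
      by (intro allI)
    from choice[OF this] obtain B where B: "\<And>i. B i \<in> sets (plane_measure e)"
      "\<And>i. {x \<in> space (plane_measure e). pt e c x \<in> U i} \<subseteq> B i"
      "\<And>i. emeasure (plane_measure e) (B i) \<le> ennreal (?C * (unit_ball_vol (real N) * (diameter (U i) / 2) ^ N))"
      by (elim exE) auto
    have "emeasure (plane_measure e) {x \<in> space (plane_measure e). pt e c x \<in> E} \<le> emeasure (plane_measure e) (\<Union>i. B i)"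
    proof (rule emeasure_mono)
      show "{x \<in> space (plane_measure e). pt e c x \<in> E} \<subseteq> (\<Union>i. B i)"
      proof clarify
        fix x assume x: "x \<in> space (plane_measure e)" "pt e c x \<in> E"
        then obtain i where "pt e c x \<in> U i" using U(1) by blast
        then show "x \<in> (\<Union>i. B i)" using B(2)[of i] x(1) by blast
      qed
      show "(\<Union>i. B i) \<in> sets (plane_measure e)" using B(1) by (intro sets.countable_UN) auto
    qed
    also have "\<dots> \<le> (\<Sum>i. emeasure (plane_measure e) (B i))"
      by (rule emeasure_subadditive_countably) (use B(1) in auto)
    also have "\<dots> \<le> (\<Sum>i. ennreal (?C * (unit_ball_vol (real N) * (diameter (U i) / 2) ^ N)))"
      by (intro suminf_le B(3)) auto
    also have "\<dots> = ennreal ?C * (\<Sum>i. ennreal (unit_ball_vol (real N) * (diameter (U i) / 2) ^ N))"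
      unfolding ennreal_mult'[OF C0] by (rule ennreal_suminf_cmult)
    finally show ?thesis .
  qed
  note * = this
  \<comment> \<open>Reciprocal of the constant: the estimate holds for every cover separately, so
    the constant is moved to the left before passing to the infimum and moved back
    afterwards.\<close>
  define c' where "c' = unit_ball_vol (real N) / 4 ^ N"
  let ?X = "emeasure (plane_measure e) {x \<in> space (plane_measure e). pt e c x \<in> E}"
  have "c' * ?C = 1" using less_imp_neq[OF \<omega>] by (simp add: c'_def)
  then have cC: "ennreal c' * ennreal ?C = 1"
    by (metis C0 ennreal_1 ennreal_mult'')
  have "ennreal c' * ?X \<le> hausdorff_pre N \<delta> E"
    unfolding hausdorff_pre_def
  proof (rule INF_greatest, clarify)
    fix U :: "nat \<Rightarrow> 'a set"
    let ?S = "\<Sum>i. ennreal (unit_ball_vol (real N) * (diameter (U i) / 2) ^ N)"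
    assume U: "E \<subseteq> \<Union> (range U)" "\<forall>i. bounded (U i) \<and> diameter (U i) \<le> \<delta>"
    have "ennreal c' * ?X \<le> ennreal c' * (ennreal ?C * ?S)"
      by (rule mult_left_mono[OF *]) (use U in auto)
    also have "\<dots> = ?S" unfolding mult.assoc[symmetric] cC by simp
    finally show "ennreal c' * ?X \<le> ?S" .
  qed
  from mult_left_mono[OF this, of "ennreal ?C"] show ?thesis
    unfolding mult.assoc[symmetric] mult.commute[of "ennreal ?C" "ennreal c'"] cC by simp
qed

section \<open>The surface measure on the boundary\<close>

lemma sets_surface: "sets (surface \<Omega>) = {A. A \<in> sets borel \<and> A \<subseteq> frontier (\<Omega> :: 'a::euclidean_space set)}"
proof -
  have sig: "sigma_sets UNIV (sets borel) = (sets borel :: 'a set set)"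
    by (metis sets.sigma_sets_eq space_borel)
  have "sets (hausdorff_measure (DIM('a) - 1) :: 'a measure) = sets borel"
    unfolding hausdorff_measure_def by (simp add: sig)
  moreover have "frontier \<Omega> \<in> sets borel" by (simp add: borel_closed)
  ultimately show ?thesis unfolding surface_def
    by (intro set_eqI) (auto simp: sets_restrict_space_iff hausdorff_measure_def)
qed

lemma emeasure_surface:
  fixes \<Omega> :: "'a::euclidean_space set"
  assumes nz: "emeasure (surface \<Omega>) \<Gamma> \<noteq> 0" and E: "E \<in> sets borel" "E \<subseteq> frontier \<Omega>"
  shows "emeasure (surface \<Omega>) E = (SUP \<delta>\<in>{0<..}. hausdorff_pre (DIM('a) - 1) \<delta> E)"
proof -
  let ?h = "\<lambda>A::'a set. SUP \<delta>\<in>{0<..}. hausdorff_pre (DIM('a) - 1) \<delta> A"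
  let ?H = "hausdorff_measure (DIM('a) - 1) :: 'a measure"
  have sig: "sigma_sets UNIV (sets borel) = (sets borel :: 'a set set)"
    by (metis sets.sigma_sets_eq space_borel)
  \<comment> \<open>\<open>measure_of\<close> yields the null measure when its set function is not a
    measure; the nonzero value on \<open>\<Gamma>\<close> will exclude this branch.\<close>
  have conv: "emeasure ?H = (\<lambda>B. if B \<in> sets borel \<and> measure_space UNIV (sets borel) ?h then ?h B else 0)"
    unfolding hausdorff_measure_def emeasure_measure_of_conv sig ..
  have setsH: "sets ?H = sets borel" "space ?H = UNIV"
    unfolding hausdorff_measure_def by (simp_all add: sig)
  have surf: "emeasure (surface \<Omega>) A = emeasure ?H A" if "A \<subseteq> frontier \<Omega>" for A
    unfolding surface_def using that
    by (subst emeasure_restrict_space) (auto simp: setsH[unfolded One_nat_def] borel_closed)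
  have ms: "measure_space UNIV (sets borel) ?h"
  proof (rule ccontr)
    assume "\<not> measure_space UNIV (sets borel) ?h"
    then have z: "emeasure ?H A = 0" for A unfolding conv by simp
    have "\<Gamma> \<in> sets (surface \<Omega>)" using nz emeasure_notin_sets by blast
    then have "\<Gamma> \<subseteq> frontier \<Omega>"
      by (simp add: sets_surface)
    then show False using nz surf z by simp
  qed
  show ?thesis using surf[OF E(2)] ms E(1) unfolding conv by simp
qed

lemma space_surface: "space (surface \<Omega>) = frontier \<Omega>"
  by (simp add: surface_def space_restrict_space hausdorff_measure_def space_measure_of_conv)

lemma continuous_measurable_surface:
  fixes f :: "'a::euclidean_space \<Rightarrow> 'b::euclidean_space"
  assumes "continuous_on UNIV f"
  shows "f \<in> borel_measurable (surface \<Omega>)"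
proof (rule measurableI)
  fix A :: "'b set" assume A: "A \<in> sets borel"
  have "f -` A \<in> sets borel"
    using measurable_sets[OF borel_measurable_continuous_onI[OF assms] A] by simp
  then show "f -` A \<inter> space (surface \<Omega>) \<in> sets (surface \<Omega>)"
    by (auto simp: sets_surface space_surface borel_closed)
qed simp

text \<open>The image under \<open>pt e c\<close> of plane measure, restricted to the part that
  lands in \<open>U\<close>, is dominated as a measure by a constant times
  \<open>surface \<Omega>\<close>, and integrals are monotone in the measure. The restriction to
  \<open>D\<close> matters: \<open>f\<close> is measurable on the boundary, and points of
  \<open>D\<close> are the ones known to land there.\<close>

lemma nn_integral_plane_le_surface:
  fixes \<Omega> :: "'a::euclidean_space set"
  assumes nz: "emeasure (surface \<Omega>) \<Gamma> \<noteq> 0" and e: "e \<in> Basis"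
    and U: "open U" "\<And>y. y \<in> U \<Longrightarrow> y \<bullet> e = c \<Longrightarrow> y \<in> frontier \<Omega>"
    and f: "f \<in> borel_measurable (surface \<Omega>)"
  shows "(\<integral>\<^sup>+x. f (pt e c x) * indicator U (pt e c x) \<partial>plane_measure e)
     \<le> ennreal (4 ^ (DIM('a) - 1) / unit_ball_vol (real (DIM('a) - 1))) * integral\<^sup>N (surface \<Omega>) f"
proof -
  let ?C = "ennreal (4 ^ (DIM('a) - 1) / unit_ball_vol (real (DIM('a) - 1)))"
  let ?P = "plane_measure e"
  define D where "D = {x \<in> space ?P. pt e c x \<in> U}"
  have D: "D \<in> sets ?P" 
  proof -
    have "D = pt e c -` U \<inter> space ?P" by (auto simp: D_def)
    then show ?thesis using measurable_sets[OF measurable_pt borel_open[OF U(1)]] by simp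
  qed
  have ptD: "pt e c x \<in> frontier \<Omega>" if "x \<in> D" for x
    using that U(2) e by (auto simp: D_def pt_inner)
  have m: "pt e c \<in> restrict_space ?P D \<rightarrow>\<^sub>M surface \<Omega>"
  proof (rule measurableI)
    show "pt e c x \<in> space (surface \<Omega>)" if "x \<in> space (restrict_space ?P D)" for x
      using that ptD by (auto simp: space_surface space_restrict_space)
    fix A assume A: "A \<in> sets (surface \<Omega>)"
    have "pt e c -` A \<inter> space ?P \<in> sets ?P"
      using A by (intro measurable_sets[OF measurable_pt]) (simp add: sets_surface)
    then have "D \<inter> (pt e c -` A \<inter> space ?P) \<in> sets (restrict_space ?P D)"
      unfolding sets_restrict_space by blast
    then show "pt e c -` A \<inter> space (restrict_space ?P D) \<in> sets (restrict_space ?P D)"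
      by (simp add: space_restrict_space Int_ac)
  qed
  have le: "emeasure (distr (restrict_space ?P D) (surface \<Omega>) (pt e c)) A \<le> emeasure (scale_measure ?C (surface \<Omega>)) A" for A
  proof (cases "A \<in> sets (surface \<Omega>)")
    case True
    then have A: "A \<in> sets borel" "A \<subseteq> frontier \<Omega>" by (auto simp: sets_surface)
    have "emeasure (distr (restrict_space ?P D) (surface \<Omega>) (pt e c)) A
       = emeasure (restrict_space ?P D) (pt e c -` A \<inter> space (restrict_space ?P D))"
      by (rule emeasure_distr[OF m True])
    also have "\<dots> = emeasure ?P (pt e c -` A \<inter> space (restrict_space ?P D))"
      using D by (subst emeasure_restrict_space) (auto simp: space_restrict_space)
    also have "\<dots> \<le> emeasure ?P {x \<in> space ?P. pt e c x \<in> A}"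
      using A by (intro emeasure_mono) (auto simp: space_restrict_space)
    \<comment> \<open>Any scale will do in place of 1, since the surface measure is a supremum over
      all scales.\<close>
    also have "\<dots> \<le> ?C * hausdorff_pre (DIM('a) - 1) 1 A"
      by (rule emeasure_plane_le_hausdorff_pre[OF e A(1)])
    also have "\<dots> \<le> ?C * emeasure (surface \<Omega>) A"
      unfolding emeasure_surface[OF nz A] by (intro mult_left_mono SUP_upper) auto
    finally show ?thesis by simp
  qed (simp add: emeasure_notin_sets)
  have "(\<integral>\<^sup>+x. f (pt e c x) * indicator U (pt e c x) \<partial>?P) = (\<integral>\<^sup>+x. f (pt e c x) * indicator D x \<partial>?P)"
    by (intro nn_integral_cong) (simp add: D_def indicator_def)
  also have "\<dots> = (\<integral>\<^sup>+x. f (pt e c x) \<partial>restrict_space ?P D)"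
    using D by (subst nn_integral_restrict_space) auto
  also have "\<dots> = integral\<^sup>N (distr (restrict_space ?P D) (surface \<Omega>) (pt e c)) f"
    by (rule nn_integral_distr[OF m, symmetric]) (simp add: f)
  also have "\<dots> \<le> integral\<^sup>N (scale_measure ?C (surface \<Omega>)) f"
    by (rule nn_integral_mono_measure) (use le in \<open>auto simp: le_measure_iff le_fun_def space_scale_measure\<close>)
  also have "\<dots> = ?C * integral\<^sup>N (surface \<Omega>) f" by (rule nn_integral_scale_measure[OF f])
  finally show ?thesis .
qed

text \<open>Before its starting time a peak is a constant function, which is square integrable over
  the boundary for almost every such time; a nonzero constant forces finite measure.\<close>

lemma finite_measure_surface:
  fixes \<Omega> :: "'a::euclidean_space set"
  assumes C_G: "data_bound_large_enough T \<Omega> xbar \<epsilon>0 g_lo g_up C\<^sub>G"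
    and pos: "T > 0" "g_lo < g_up" "\<epsilon>0 > 0"
  shows "finite_measure (surface \<Omega>)"
proof -
  \<comment> \<open>The base value must be nonzero: if \<open>g_lo\<close> is zero then
    \<open>g_up\<close> is positive and its half is admissible.\<close>
  define g1 where "g1 = (if g_lo \<noteq> 0 then g_lo else g_up / 2)"
  have g1: "g_lo \<le> g1" "g1 < g_up" "g1 \<noteq> 0" using pos by (auto simp: g1_def)
  \<comment> \<open>Starting at \<open>T / 2\<close> leaves a time interval of positive measure on
    which the peak is constant; it must contain a time at which the almost everywhere property
    holds.\<close>
  let ?g = "peak_data T xbar \<epsilon>0 (T / 2) T g1 g_up \<epsilon>0 :: real \<Rightarrow> 'a \<Rightarrow> real"
  have "?g \<in> H1X T (surface \<Omega>) (bdry_H1_grad \<Omega>)"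
    using C_G g1 pos unfolding data_bound_large_enough_def by auto
  then obtain Dg where "AE t in time T. bdry_H1_grad \<Omega> (?g t) (Dg t)"
    by (auto simp: H1X_def L2X_def has_spatial_grad_def)
  then have ae: "AE t in time T. L2_fun (surface \<Omega>) (?g t)"
    by eventually_elim (simp add: bdry_H1_grad_def)
  have "\<exists>t\<in>{0<..<T/2}. L2_fun (surface \<Omega>) (?g t)"
  proof (rule ccontr)
    assume "\<not> ?thesis"
    with ae have "AE t in time T. t \<notin> {0<..<T/2}" by (auto elim!: eventually_mono)
    then have "{0<..<T/2} \<in> null_sets (time T)"
      using pos by (subst (asm) AE_iff_null_sets[symmetric]) (auto simp: sets_restrict_space intro!: image_eqI[of _ _ "{0<..<T/2}"])
    then have "emeasure (time T) {0<..<T/2} = 0" by auto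
    also have "emeasure (time T) {0<..<T/2} = ennreal (T / 2)"
      using pos by (subst emeasure_restrict_space) auto
    finally show False using pos by (simp add: ennreal_eq_0_iff)
  qed
  then obtain t where t: "0 < t" "t < T / 2" "L2_fun (surface \<Omega>) (?g t)" by auto
  have "(t - T / 2) * (T - t) \<le> 0" using t by (intro mult_nonpos_nonneg) auto
  then have "?g t = (\<lambda>x. g1)" by (auto simp: peak_data_def time_cutoff_def Let_def)
  then have "integrable (surface \<Omega>) (\<lambda>x. g1\<^sup>2)" using t(3) by (simp add: L2_fun_def)
  then have "(\<integral>\<^sup>+x. ennreal (g1\<^sup>2) \<partial>surface \<Omega>) < \<infinity>" by (simp add: integrable_iff_bounded)
  then have "ennreal (g1\<^sup>2) * emeasure (surface \<Omega>) (space (surface \<Omega>)) < \<infinity>" by simp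
  then show ?thesis using g1(3)
    by (intro finite_measureI) (auto simp: ennreal_mult_less_top ennreal_eq_0_iff)
qed

section \<open>Green's formula for functions with a trace\<close>

lemma ennreal_squeeze_0:
  fixes f g :: "nat \<Rightarrow> ennreal"
  assumes "\<And>n. f n \<le> c * g n" "g \<longlonglongrightarrow> 0" "c < top"
  shows "f \<longlonglongrightarrow> 0"
proof -
  have "(\<lambda>n. c * g n) \<longlonglongrightarrow> 0"
    using ennreal_tendsto_cmult[OF assms(3,2)] by simp
  then show ?thesis
    by (intro tendsto_sandwich[of "\<lambda>_. 0" f sequentially "\<lambda>n. c * g n" 0] tendsto_const) (simp_all add: assms(1))
qed

lemma L2_conv_imp_L1_conv:
  fixes f :: "nat \<Rightarrow> 'a \<Rightarrow> 'b::euclidean_space"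
  assumes "finite_measure M" and m: "\<And>k. f k \<in> borel_measurable M" "h \<in> borel_measurable M"
    and conv: "L2_conv M f h sequentially"
  shows "(\<lambda>k. \<integral>\<^sup>+x. ennreal (norm (f k x - h x)) \<partial>M) \<longlonglongrightarrow> 0"
proof -
  interpret finite_measure M by fact
  let ?I = "\<lambda>k. \<integral>\<^sup>+x. ennreal (norm (f k x - h x)) \<partial>M"
  let ?J = "\<lambda>k. \<integral>\<^sup>+x. ennreal ((norm (f k x - h x))\<^sup>2) \<partial>M"
  let ?V = "emeasure M (space M)"
  have le: "(?I k)\<^sup>2 \<le> ?V * ?J k" for k
    using Cauchy_Schwarz_nn_integral[of "\<lambda>x. ennreal (norm (f k x - h x))" M "\<lambda>_. 1"] m
    by (simp add: ennreal_power mult.commute)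
  have "(\<lambda>k. (?I k)\<^sup>2) \<longlonglongrightarrow> 0"
    by (rule ennreal_squeeze_0[OF le]) (use conv in \<open>auto simp: L2_conv_def less_top[symmetric]\<close>)
  show ?thesis
  proof (rule order_tendstoI)
    fix a :: ennreal assume a: "0 < a"
    then have "0 < a\<^sup>2" by (simp add: zero_less_iff_neq_zero)
    from order_tendstoD(2)[OF \<open>(\<lambda>k. (?I k)\<^sup>2) \<longlonglongrightarrow> 0\<close> this]
    show "eventually (\<lambda>k. ?I k < a) sequentially"
    proof eventually_elim
      case (elim k)
      show ?case
      proof (rule ccontr)
        assume "\<not> ?I k < a"
        then have "a\<^sup>2 \<le> (?I k)\<^sup>2" by (simp add: power2_eq_square mult_mono)
        then show False using elim by simp
      qed
    qed
  qed simp
qed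

lemma tendsto_integral_of_bound:
  fixes F :: "nat \<Rightarrow> 'a \<Rightarrow> real"
  assumes "\<And>n. integrable M (F n)" "integrable M F0" and w: "\<And>n. w n \<in> borel_measurable M"
    and bound: "\<And>n x. x \<in> space M \<Longrightarrow> \<bar>F n x - F0 x\<bar> \<le> K * w n x" and K: "K \<ge> 0"
    and lim: "(\<lambda>n. \<integral>\<^sup>+x. ennreal (w n x) \<partial>M) \<longlonglongrightarrow> 0"
  shows "(\<lambda>n. integral\<^sup>L M (F n)) \<longlonglongrightarrow> integral\<^sup>L M F0"
proof (rule tendsto_L1_int[OF assms(1,2)])
  have le: "(\<integral>\<^sup>+x. norm (F n x - F0 x) \<partial>M) \<le> ennreal K * (\<integral>\<^sup>+x. ennreal (w n x) \<partial>M)" for n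
  proof -
    have "(\<integral>\<^sup>+x. norm (F n x - F0 x) \<partial>M) \<le> (\<integral>\<^sup>+x. ennreal (K * w n x) \<partial>M)"
      using bound by (intro nn_integral_mono ennreal_leI) simp
    also have "\<dots> = ennreal K * (\<integral>\<^sup>+x. ennreal (w n x) \<partial>M)"
      using w K by (simp add: ennreal_mult' nn_integral_cmult)
    finally show ?thesis .
  qed
  show "(\<lambda>n. \<integral>\<^sup>+x. norm (F n x - F0 x) \<partial>M) \<longlonglongrightarrow> 0"
    by (rule ennreal_squeeze_0[OF le lim]) simp
qed

lemma abs_diff_mult_le:
  fixes s t l :: real
  assumes "\<bar>s - t\<bar> \<le> M * d" "\<bar>l\<bar> \<le> B"
  shows "\<bar>s * l - t * l\<bar> \<le> M * B * d"
proof -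
  have "\<bar>s * l - t * l\<bar> = \<bar>s - t\<bar> * \<bar>l\<bar>" by (simp add: abs_mult flip: left_diff_distrib)
  also have "\<dots> \<le> (M * d) * B" using assms by (intro mult_mono) auto
  finally show ?thesis by (simp add: mult_ac)
qed

lemma integrable_plane_bounded_support:
  fixes g :: "'a::euclidean_space \<Rightarrow> real"
  assumes e: "e \<in> Basis" and g: "continuous_on UNIV g" "\<And>y. norm y > R \<Longrightarrow> g y = 0"
  shows "integrable (plane_measure e) (\<lambda>x. g (pt e c x))"
proof -
  interpret product_sigma_finite "\<lambda>_::'a. lborel :: real measure" by standard
  obtain B where B: "B > 0" "\<And>y. norm (g y) \<le> B" using continuous_bounded_support_bounded[OF g] by blast
  define Q where "Q = Pi\<^sub>E (Basis - {e}) (\<lambda>_. {- R .. R})"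
  have Q: "Q \<in> sets (plane_measure e)" unfolding Q_def plane_measure_def by (intro sets_PiM_I_finite) auto
  have "emeasure (plane_measure e) Q = (\<Prod>b\<in>Basis - {e}. emeasure lborel {-R .. R})"
    unfolding Q_def plane_measure_def by (intro emeasure_PiM) auto
  also have "\<dots> < \<infinity>"
    by (simp add: emeasure_lborel_Icc_eq less_top[symmetric] power_eq_top_ennreal)
  finally have "integrable (plane_measure e) (\<lambda>x. B * indicator Q x)" using Q by (simp add: integrable_real_indicator)
  then show ?thesis
  proof (rule Bochner_Integration.integrable_bound)
    show "(\<lambda>x. g (pt e c x)) \<in> borel_measurable (plane_measure e)"
      by (rule measurable_compose[OF measurable_pt borel_measurable_continuous_onI[OF g(1)]])
    have "\<bar>g (pt e c x)\<bar> \<le> B * indicator Q x" if x: "x \<in> space (plane_measure e)" for x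
    proof (cases "norm (pt e c x) > R")
      case True
      then show ?thesis using g(2) B(1) by (simp add: indicator_def)
    next
      case False
      have "\<bar>x b\<bar> \<le> R" if "b \<in> Basis - {e}" for b
        using Basis_le_norm[of b "pt e c x"] that e False by (simp add: pt_inner)
      moreover have "x \<in> extensional (Basis - {e})" using x by (simp add: plane_measure_def space_PiM PiE_iff)
      ultimately have "x \<in> Q" unfolding Q_def PiE_iff by (simp add: abs_le_iff minus_le_iff)
      then show ?thesis using B(2) by simp
    qed
    then show "AE x in plane_measure e. norm (g (pt e c x)) \<le> norm (B * indicator Q x)"
      using B(1) by (intro AE_I2) (simp add: abs_mult)
  qed
qed

text \<open>Green's identity holds for the smooth approximants in \<open>has_trace\<close>, and each
  of its three terms passes to the limit. The terms with \<open>A\<close> depend on the approximants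
  in a Lipschitz way; for the boundary term, convergence on the surface is carried to the plane by
  \<open>nn_integral_plane_le_surface\<close>. The gradient term takes more care because
  \<open>a\<close> is merely continuous.\<close>

lemma trace_Green:
  fixes \<Omega> :: "'a::euclidean_space set"
  assumes \<Omega>: "open \<Omega>" "bounded \<Omega>" and e: "e \<in> Basis"
    and half: "\<And>y. y \<in> ball xbar \<rho> \<Longrightarrow> y \<in> \<Omega> \<longleftrightarrow> y \<bullet> e < c"
    and front: "\<And>y. y \<in> ball xbar \<rho> \<Longrightarrow> y \<bullet> e = c \<Longrightarrow> y \<in> frontier \<Omega>"
    and nz: "emeasure (surface \<Omega>) \<Gamma> \<noteq> 0" and fin: "finite_measure (surface \<Omega>)"
    and \<Phi>: "smooth \<Phi>" "\<rho>' < \<rho>" "\<And>x. x \<notin> cball xbar \<rho>' \<Longrightarrow> \<Phi> x = 0"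
    and A: "\<And>s. (A has_real_derivative a s) (at s)" and a: "continuous_on UNIV a" "\<And>s. \<bar>a s\<bar> \<le> M"
    and v: "has_trace \<Omega> v h" and h: "continuous_on UNIV h" and V: "H1_grad \<Omega> v V"
  shows "(LINT x|lebesgue_on \<Omega>. a (v x) * (V x \<bullet> grad \<Phi> x)) =
     (LINT x|plane_measure e. A (h (pt e c x)) * pd e \<Phi> (pt e c x)) -
     (LINT x|lebesgue_on \<Omega>. A (v x) * laplacian \<Phi> x)"
proof -
  let ?\<mu> = "lebesgue_on \<Omega>" and ?P = "plane_measure e" and ?H = "{x. x \<bullet> e < c}"
  note fin\<Omega> = finite_measure_open_bounded[OF \<Omega>]
  define R where "R = norm xbar + \<bar>\<rho>'\<bar>"
  have supp: "\<Phi> x = 0" if "norm x > R" for x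
  proof (rule \<Phi>(3))
    show "x \<notin> cball xbar \<rho>'" using that norm_triangle_sub[of x xbar] by (auto simp: R_def dist_norm norm_minus_commute)
  qed
  have off: "pd i \<Phi> x = 0" "laplacian \<Phi> x = 0" if "x \<notin> ball xbar \<rho>" for x i
  proof -
    have x: "x \<notin> cball xbar \<rho>'" using that \<Phi>(2) by auto
    show "pd i \<Phi> x = 0" by (rule pd_eq_0_outside_closed[OF closed_cball _ x]) (rule \<Phi>(3))
    show "laplacian \<Phi> x = 0" by (rule laplacian_eq_0_outside_closed[OF closed_cball _ x]) (rule \<Phi>(3))
  qed
  have goff: "grad \<Phi> x = 0" if "x \<notin> ball xbar \<rho>" for x using off(1)[OF that] by (simp add: grad_def)
  have lip: "\<bar>A s - A t\<bar> \<le> M * \<bar>s - t\<bar>" for s t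
  proof -
    have "norm (A s - A t) \<le> M * norm (s - t)"
      by (rule field_differentiable_bound[of UNIV A a]) (use A a in \<open>auto intro: DERIV_subset\<close>)
    then show ?thesis by simp
  qed
  have M: "M \<ge> 0" using a(2)[of 0] by linarith
  have contA: "continuous_on UNIV A"
    using A by (meson DERIV_isCont continuous_at_imp_continuous_on)
  have "grad \<Phi> x = 0" if "norm x > R" for x
    using pd_eq_0_outside_cball[OF supp that] by (simp add: grad_def)
  then obtain Bg where Bg: "Bg > 0" "\<And>x. norm (grad \<Phi> x) \<le> Bg"
    using continuous_bounded_support_bounded[of "grad \<Phi>" R] smooth_continuous_grad[OF \<Phi>(1)] by blast
  have "\<exists>B>0. \<forall>x. norm (laplacian \<Phi> x) \<le> B"
    by (rule continuous_bounded_support_bounded[OF smooth_continuous[OF smooth_laplacian[OF \<Phi>(1)]]])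
      (rule laplacian_eq_0_outside_cball[OF supp])
  then obtain Bl where Bl: "Bl > 0" "\<And>x. \<bar>laplacian \<Phi> x\<bar> \<le> Bl" by auto
  have Be: "\<bar>pd e \<Phi> x\<bar> \<le> Bg" for x
    using Bg(2)[of x] Basis_le_norm[OF e, of "grad \<Phi> x"] e by (simp add: grad_inner_Basis)
  from v obtain V' f where V': "H1_grad \<Omega> v V'" and f: "\<And>k. smooth (f k)"
    and conv: "L2_conv ?\<mu> f v sequentially" "L2_conv ?\<mu> (\<lambda>k. grad (f k)) V' sequentially" "L2_conv (surface \<Omega>) f h sequentially"
    unfolding has_trace_def by blast
  have L2: "L2_fun ?\<mu> v" "L2_fun ?\<mu> V'" "L2_fun ?\<mu> V" using V' V by (auto simp: H1_grad_def)
  then have vm: "v \<in> borel_measurable ?\<mu>" and V'm: "V' \<in> borel_measurable ?\<mu>" and Vm: "V \<in> borel_measurable ?\<mu>"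
    by (auto simp: L2_fun_def)
  have vi: "integrable ?\<mu> v" and V'i: "integrable ?\<mu> V'" by (rule L2_fun_integrable[OF fin\<Omega>], rule L2)+
  have fm: "f k \<in> borel_measurable ?\<mu>" "grad (f k) \<in> borel_measurable ?\<mu>" "f k \<in> borel_measurable (surface \<Omega>)" for k
    by (auto intro!: continuous_measurable_lebesgue_on continuous_measurable_surface smooth_continuous[OF f] smooth_continuous_grad[OF f])
  have gm: "grad \<Phi> \<in> borel_measurable ?\<mu>" "laplacian \<Phi> \<in> borel_measurable ?\<mu>"
    by (auto intro!: continuous_measurable_lebesgue_on smooth_continuous_grad[OF \<Phi>(1)] smooth_continuous[OF smooth_laplacian[OF \<Phi>(1)]])
  have hm: "h \<in> borel_measurable (surface \<Omega>)" by (rule continuous_measurable_surface[OF h])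
  have am: "a \<in> borel_measurable borel" "A \<in> borel_measurable borel"
    using a contA by (auto intro: borel_measurable_continuous_onI)
  note [measurable] = vm V'm Vm fm gm hm am
  note L1 = L2_conv_imp_L1_conv[OF fin\<Omega> fm(1) vm conv(1)] L2_conv_imp_L1_conv[OF fin\<Omega> fm(2) V'm conv(2)]
    L2_conv_imp_L1_conv[OF fin fm(3) hm conv(3)]
  have fi: "integrable ?\<mu> (f k)" "integrable ?\<mu> (grad (f k))" for k
    by (auto intro!: L2_fun_integrable[OF fin\<Omega>] L2_fun_continuous[OF \<Omega>] smooth_continuous[OF f] smooth_continuous_grad[OF f])
  have to_\<Omega>: "(LINT x|lborel. indicator ?H x * g x) = integral\<^sup>L ?\<mu> g"
    if "continuous_on UNIV g" "\<And>x. x \<notin> ball xbar \<rho> \<Longrightarrow> g x = 0" for g :: "'a \<Rightarrow> real"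
  proof -
    have g: "g \<in> borel_measurable borel" using that(1) by (rule borel_measurable_continuous_onI)
    have "integral\<^sup>L ?\<mu> g = (LINT x|lebesgue. indicator \<Omega> x *\<^sub>R g x)"
      using \<Omega> by (subst integral_restrict_space) auto
    also have "\<dots> = (LINT x|lebesgue. indicator ?H x * g x)"
      using half that(2) by (intro Bochner_Integration.integral_cong) (auto simp: indicator_def)
    also have "\<dots> = (LINT x|lborel. indicator ?H x * g x)"
    proof (rule integral_completion)
      have "?H \<in> sets borel" by measurable
      then show "(\<lambda>x. indicator ?H x * g x) \<in> borel_measurable lborel" using g by simp
    qed
    finally show ?thesis by simp
  qed
  have Green: "(LINT x|?\<mu>. a (f k x) * (grad (f k) x \<bullet> grad \<Phi> x)) =
     (LINT x|?P. A (f k (pt e c x)) * pd e \<Phi> (pt e c x)) - (LINT x|?\<mu>. A (f k x) * laplacian \<Phi> x)" for k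
  proof -
    have ca: "continuous_on UNIV (\<lambda>x. a (f k x))" "continuous_on UNIV (\<lambda>x. A (f k x))"
      using continuous_on_compose2[OF a(1) smooth_continuous[OF f]] continuous_on_compose2[OF contA smooth_continuous[OF f]] by auto
    have 1: "(LINT x|lborel. indicator ?H x * (a (f k x) * (grad (f k) x \<bullet> grad \<Phi> x))) = (LINT x|?\<mu>. a (f k x) * (grad (f k) x \<bullet> grad \<Phi> x))"
      by (rule to_\<Omega>) (auto intro!: continuous_on_mult continuous_on_inner ca smooth_continuous_grad[OF f] smooth_continuous_grad[OF \<Phi>(1)] simp: goff)
    have 2: "(LINT x|lborel. indicator ?H x * (A (f k x) * laplacian \<Phi> x)) = (LINT x|?\<mu>. A (f k x) * laplacian \<Phi> x)"
      by (rule to_\<Omega>) (auto intro!: continuous_on_mult ca smooth_continuous[OF smooth_laplacian[OF \<Phi>(1)]] simp: off)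
    show ?thesis using Green_half_space[where R = R and c = c, OF f[of k] \<Phi>(1) supp A a(1) e] unfolding 1 2 .
  qed
  have Av: "integrable ?\<mu> (\<lambda>x. A (w x))" if "integrable ?\<mu> w" for w
  proof (rule Bochner_Integration.integrable_bound)
    show "integrable ?\<mu> (\<lambda>x. M * \<bar>w x\<bar> + \<bar>A 0\<bar>)"
      by (intro Bochner_Integration.integrable_add integrable_mult_right integrable_abs that finite_measure.integrable_const[OF fin\<Omega>])
    show "(\<lambda>x. A (w x)) \<in> borel_measurable ?\<mu>" using that by auto
    show "AE x in ?\<mu>. norm (A (w x)) \<le> norm (M * \<bar>w x\<bar> + \<bar>A 0\<bar>)"
      using lip[of _ 0] M by (intro AE_I2) (smt (verit) mult_nonneg_nonneg real_norm_def)
  qed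
  have lim2: "(\<lambda>k. LINT x|?\<mu>. A (f k x) * laplacian \<Phi> x) \<longlonglongrightarrow> (LINT x|?\<mu>. A (v x) * laplacian \<Phi> x)"
  proof (rule tendsto_integral_of_bound[where K = "M * Bl" and w = "\<lambda>k x. norm (f k x - v x)"])
    show "integrable ?\<mu> (\<lambda>x. A (f k x) * laplacian \<Phi> x)" "integrable ?\<mu> (\<lambda>x. A (v x) * laplacian \<Phi> x)" for k
      by (auto intro!: integrable_mult_bounded_measurable[where B = Bl] Av fi vi gm Bl)
    show "\<bar>A (f k x) * laplacian \<Phi> x - A (v x) * laplacian \<Phi> x\<bar> \<le> M * Bl * norm (f k x - v x)" for k x
      using abs_diff_mult_le[OF lip Bl(2)] by simp
    show "(\<lambda>n. \<integral>\<^sup>+ x. ennreal (norm (f n x - v x)) \<partial>?\<mu>) \<longlonglongrightarrow> 0" by (rule L1(1))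
  qed (use M Bl in auto)
  have lim3: "(\<lambda>k. LINT x|?P. A (f k (pt e c x)) * pd e \<Phi> (pt e c x)) \<longlonglongrightarrow> (LINT x|?P. A (h (pt e c x)) * pd e \<Phi> (pt e c x))"
  proof (rule tendsto_integral_of_bound[where K = "M * Bg" and w = "\<lambda>k x. norm (f k (pt e c x) - h (pt e c x)) * indicator (ball xbar \<rho>) (pt e c x)"])
    have i: "integrable ?P (\<lambda>x. A (w (pt e c x)) * pd e \<Phi> (pt e c x))" if "continuous_on UNIV w" for w
      by (rule integrable_plane_bounded_support[OF e, of "\<lambda>y. A (w y) * pd e \<Phi> y" R])
        (auto intro!: continuous_on_mult continuous_on_compose2[OF contA that] smooth_continuous[OF smooth_pd[OF \<Phi>(1) e]]
          simp: pd_eq_0_outside_cball[OF supp])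
    show "integrable ?P (\<lambda>x. A (f k (pt e c x)) * pd e \<Phi> (pt e c x))" "integrable ?P (\<lambda>x. A (h (pt e c x)) * pd e \<Phi> (pt e c x))" for k
      by (auto intro!: i h smooth_continuous[OF f])
    have bm: "(\<lambda>y. norm (f k y - h y) * indicator (ball xbar \<rho>) y) \<in> borel_measurable borel" for k
      by (rule borel_measurable_times, rule borel_measurable_continuous_onI,
          intro continuous_intros smooth_continuous[OF f] h, rule borel_measurable_indicator, simp)
    then show "(\<lambda>x. norm (f k (pt e c x) - h (pt e c x)) * indicator (ball xbar \<rho>) (pt e c x)) \<in> borel_measurable ?P" for k
      by (rule measurable_compose[OF measurable_pt])
    show "\<bar>A (f k (pt e c x)) * pd e \<Phi> (pt e c x) - A (h (pt e c x)) * pd e \<Phi> (pt e c x)\<bar>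
        \<le> M * Bg * (norm (f k (pt e c x) - h (pt e c x)) * indicator (ball xbar \<rho>) (pt e c x))" for k x
    proof (cases "pt e c x \<in> ball xbar \<rho>")
      case True
      then show ?thesis
        using abs_diff_mult_le[OF lip Be] by simp
    qed (simp add: off)
    let ?C = "ennreal (4 ^ (DIM('a) - 1) / unit_ball_vol (real (DIM('a) - 1)))"
    have le: "(\<integral>\<^sup>+x. ennreal (norm (f k (pt e c x) - h (pt e c x)) * indicator (ball xbar \<rho>) (pt e c x)) \<partial>?P)
       \<le> ?C * (\<integral>\<^sup>+x. ennreal (norm (f k x - h x)) \<partial>surface \<Omega>)" for k
    proof -
      have "(\<integral>\<^sup>+x. ennreal (norm (f k (pt e c x) - h (pt e c x))) * indicator (ball xbar \<rho>) (pt e c x) \<partial>?P)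
        \<le> ?C * (\<integral>\<^sup>+x. ennreal (norm (f k x - h x)) \<partial>surface \<Omega>)"
        by (rule nn_integral_plane_le_surface[OF nz e open_ball front]) auto
      then show ?thesis by (simp add: ennreal_mult'' ennreal_indicator)
    qed
    show "(\<lambda>k. \<integral>\<^sup>+x. ennreal (norm (f k (pt e c x) - h (pt e c x)) * indicator (ball xbar \<rho>) (pt e c x)) \<partial>?P) \<longlonglongrightarrow> 0"
      by (rule ennreal_squeeze_0[OF le L1(3)]) simp
  qed (use M Bg in auto)
  have "(\<lambda>k. LINT x|?\<mu>. norm (f k x - v x)) \<longlonglongrightarrow> 0"
  proof -
    have "(\<integral>\<^sup>+x. ennreal (norm (f k x - v x)) \<partial>?\<mu>) = ennreal (LINT x|?\<mu>. norm (f k x - v x))" for k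
      using fi(1) vi by (intro nn_integral_eq_integral) auto
    with L1(1) show ?thesis by (simp flip: ennreal_0)
  qed
  \<comment> \<open>Continuity of \<open>a\<close> acts on pointwise limits, hence the passage to a
    subsequence converging almost everywhere.\<close>
  then obtain r where r: "strict_mono r" and ae: "AE x in ?\<mu>. (\<lambda>n. f (r n) x - v x) \<longlonglongrightarrow> 0"
    using tendsto_L1_AE_subseq[of ?\<mu> "\<lambda>k x. f k x - v x"] fi(1) vi by auto
  have gi: "integrable ?\<mu> (\<lambda>x. a (w x) * (W x \<bullet> grad \<Phi> x))" "integrable ?\<mu> (\<lambda>x. M * Bg * norm (W x))"
    "norm (a (w x) * (W x \<bullet> grad \<Phi> x)) \<le> M * Bg * norm (W x)"
    if [measurable]: "w \<in> borel_measurable ?\<mu>" and W: "integrable ?\<mu> W" for w W x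
  proof -
    show i: "integrable ?\<mu> (\<lambda>x. M * Bg * norm (W x))" using W by simp
    have b: "norm (a (w x) * (W x \<bullet> grad \<Phi> x)) \<le> M * Bg * norm (W x)" for x
    proof -
      have "\<bar>W x \<bullet> grad \<Phi> x\<bar> \<le> norm (W x) * Bg"
        using Cauchy_Schwarz_ineq2[of "W x" "grad \<Phi> x"] mult_left_mono[OF Bg(2)[of x] norm_ge_zero[of "W x"]] by linarith
      from mult_mono[OF a(2)[of "w x"] this M] show ?thesis by (simp add: abs_mult mult_ac)
    qed
    then show "norm (a (w x) * (W x \<bullet> grad \<Phi> x)) \<le> M * Bg * norm (W x)" .
    have [measurable]: "W \<in> borel_measurable ?\<mu>" using W by auto
    show "integrable ?\<mu> (\<lambda>x. a (w x) * (W x \<bullet> grad \<Phi> x))"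
    proof (rule Bochner_Integration.integrable_bound[OF i])
      show "AE x in ?\<mu>. norm (a (w x) * (W x \<bullet> grad \<Phi> x)) \<le> norm (M * Bg * norm (W x))"
        using b M Bg(1) by (intro AE_I2) simp
    qed measurable
  qed
  \<comment> \<open>The gradient term is split: the difference of gradients tends to zero in L^1
    against bounded factors, while with the limit gradient held fixed dominated convergence
    applies.\<close>
  have "(\<lambda>n. LINT x|?\<mu>. a (f (r n) x) * ((grad (f (r n)) x - V' x) \<bullet> grad \<Phi> x)) \<longlonglongrightarrow> (LINT x|?\<mu>. 0)"
  proof (rule tendsto_integral_of_bound[where K = "M * Bg" and w = "\<lambda>n x. norm (grad (f (r n)) x - V' x)"])
    show "integrable ?\<mu> (\<lambda>x. a (f (r n) x) * ((grad (f (r n)) x - V' x) \<bullet> grad \<Phi> x))" for n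
      using fi(2) V'i by (intro gi(1)) auto
    show "\<bar>a (f (r n) x) * ((grad (f (r n)) x - V' x) \<bullet> grad \<Phi> x) - 0\<bar> \<le> M * Bg * norm (grad (f (r n)) x - V' x)" for n x
      using gi(3)[of "f (r n)" "\<lambda>x. grad (f (r n)) x - V' x" x] fi(2) V'i by simp
    show "(\<lambda>n. \<integral>\<^sup>+ x. ennreal (norm (grad (f (r n)) x - V' x)) \<partial>?\<mu>) \<longlonglongrightarrow> 0"
      using LIMSEQ_subseq_LIMSEQ[OF L1(2) r] by (simp add: o_def)
  qed (use M Bg in auto)
  moreover have "(\<lambda>n. LINT x|?\<mu>. a (f (r n) x) * (V' x \<bullet> grad \<Phi> x)) \<longlonglongrightarrow> (LINT x|?\<mu>. a (v x) * (V' x \<bullet> grad \<Phi> x))"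
  proof (rule integral_dominated_convergence[where w = "\<lambda>x. M * Bg * norm (V' x)"])
    show "AE x in ?\<mu>. (\<lambda>n. a (f (r n) x) * (V' x \<bullet> grad \<Phi> x)) \<longlonglongrightarrow> a (v x) * (V' x \<bullet> grad \<Phi> x)"
      using ae
    proof eventually_elim
      case (elim x)
      then have "(\<lambda>n. f (r n) x) \<longlonglongrightarrow> v x" by (simp add: LIM_zero_iff)
      then have "(\<lambda>n. a (f (r n) x)) \<longlonglongrightarrow> a (v x)"
        using a(1) by (metis UNIV_I continuous_on_tendsto_compose eventually_sequentiallyI)
      then show ?case by (intro tendsto_mult tendsto_const)
    qed
  qed (use gi V'i vm fm in auto)
  ultimately have "(\<lambda>n. (LINT x|?\<mu>. a (f (r n) x) * ((grad (f (r n)) x - V' x) \<bullet> grad \<Phi> x)) + (LINT x|?\<mu>. a (f (r n) x) * (V' x \<bullet> grad \<Phi> x)))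
     \<longlonglongrightarrow> (LINT x|?\<mu>. 0) + (LINT x|?\<mu>. a (v x) * (V' x \<bullet> grad \<Phi> x))"
    by (rule tendsto_add)
  moreover have "(LINT x|?\<mu>. a (f (r n) x) * ((grad (f (r n)) x - V' x) \<bullet> grad \<Phi> x)) + (LINT x|?\<mu>. a (f (r n) x) * (V' x \<bullet> grad \<Phi> x))
      = (LINT x|?\<mu>. a (f (r n) x) * (grad (f (r n)) x \<bullet> grad \<Phi> x))" for n
    using fi(2) V'i
    by (subst Bochner_Integration.integral_add[symmetric]) (auto intro!: gi(1) simp: inner_diff_left algebra_simps)
  ultimately have lim1: "(\<lambda>n. LINT x|?\<mu>. a (f (r n) x) * (grad (f (r n)) x \<bullet> grad \<Phi> x)) \<longlonglongrightarrow> (LINT x|?\<mu>. a (v x) * (V' x \<bullet> grad \<Phi> x))"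
    by simp
  have "(\<lambda>n. LINT x|?\<mu>. a (f (r n) x) * (grad (f (r n)) x \<bullet> grad \<Phi> x)) \<longlonglongrightarrow>
     (LINT x|?P. A (h (pt e c x)) * pd e \<Phi> (pt e c x)) - (LINT x|?\<mu>. A (v x) * laplacian \<Phi> x)"
    unfolding Green
    using LIMSEQ_subseq_LIMSEQ[OF lim3 r] LIMSEQ_subseq_LIMSEQ[OF lim2 r]
    by (intro tendsto_diff) (simp_all add: o_def)
  from LIMSEQ_unique[OF lim1 this]
  have "(LINT x|?\<mu>. a (v x) * (V' x \<bullet> grad \<Phi> x)) = (LINT x|?P. A (h (pt e c x)) * pd e \<Phi> (pt e c x)) - (LINT x|?\<mu>. A (v x) * laplacian \<Phi> x)" .
  \<comment> \<open>The gradient \<open>V'\<close> supplied by \<open>has_trace\<close> and the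
    given \<open>V\<close> agree almost everywhere by uniqueness.\<close>
  moreover have "(LINT x|?\<mu>. a (v x) * (V x \<bullet> grad \<Phi> x)) = (LINT x|?\<mu>. a (v x) * (V' x \<bullet> grad \<Phi> x))"
  proof (rule integral_cong_AE)
    have "AE x in ?\<mu>. V x = V' x"
      using V V' by (intro weak_grad_unique[OF \<Omega>, of _ _ v]) (auto simp: H1_grad_def)
    then show "AE x in ?\<mu>. a (v x) * (V x \<bullet> grad \<Phi> x) = a (v x) * (V' x \<bullet> grad \<Phi> x)"
      by eventually_elim simp
  qed measurable
  ultimately show ?thesis by simp
qed

section \<open>The singular test function\<close>

lemma nn_integral_abs_powr_finite:
  fixes \<sigma> :: real
  assumes "\<sigma> < 1"
  shows "(\<integral>\<^sup>+t. ennreal (\<bar>t\<bar> powr (- \<sigma>) * indicator {-1..1} t) \<partial>lborel) < \<infinity>"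
proof -
  define f where "f t = ennreal (indicator {0..1} t * t powr (- \<sigma>))" for t :: real
  have [measurable]: "f \<in> borel_measurable borel" unfolding f_def by measurable
  have "((\<lambda>t. t powr (- \<sigma>)) has_integral (1 powr (- \<sigma> + 1) / (- \<sigma> + 1))) {0..1}"
    using assms by (intro has_integral_powr_from_0) auto
  then have "integral\<^sup>N lborel f = ennreal (1 powr (- \<sigma> + 1) / (- \<sigma> + 1))"
    unfolding f_def by (intro nn_integral_has_integral_lebesgue) auto
  then have fin: "integral\<^sup>N lborel f < \<infinity>" by simp
  have "integral\<^sup>N lborel f = (\<integral>\<^sup>+t. f (- t) \<partial>lborel)"
    using nn_integral_real_affine[of f "-1" 0] by simp
  then have fin': "(\<integral>\<^sup>+t. f (- t) \<partial>lborel) < \<infinity>" using fin by simp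
  have "(\<integral>\<^sup>+t. ennreal (\<bar>t\<bar> powr (- \<sigma>) * indicator {-1..1} t) \<partial>lborel) \<le> (\<integral>\<^sup>+t. f t + f (- t) \<partial>lborel)"
    by (intro nn_integral_mono) (auto simp: f_def indicator_def abs_if)
  also have "\<dots> = integral\<^sup>N lborel f + (\<integral>\<^sup>+t. f (- t) \<partial>lborel)"
    by (intro nn_integral_add) auto
  also have "\<dots> < \<infinity>" using fin fin' by simp
  finally show ?thesis .
qed

text \<open>Bounding \<open>\<bar>x\<bar>\<close> below by each coordinate reduces the integral to one dimension.\<close>

lemma integrable_norm_powr_ball:
  fixes xbar :: "'a::euclidean_space"
  assumes s: "0 \<le> s" "s < real DIM('a)"
  shows "integrable lborel (\<lambda>x. norm (x - xbar) powr (- s) * indicator (ball xbar 1) x)"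
proof -
  \<comment> \<open>The exponent is shared equally among the coordinates; each one-dimensional
    exponent is then below 1, hence integrable at zero.\<close>
  define \<sigma> where "\<sigma> = s / real DIM('a)"
  have \<sigma>: "0 \<le> \<sigma>" "\<sigma> < 1" "\<sigma> * real DIM('a) = s" using s by (auto simp: \<sigma>_def field_simps)
  let ?F = "\<lambda>x::'a. norm x powr (- s) * indicator (ball 0 1) x"
  \<comment> \<open>The coordinate hyperplanes are excluded because
    \<open>0 powr (- \<sigma>)\<close> is 0 and would break the comparison; they form a null
    set.\<close>
  have le: "ennreal (?F x) \<le> (\<Prod>b\<in>Basis. ennreal (\<bar>x \<bullet> b\<bar> powr (- \<sigma>) * indicator {-1..1} (x \<bullet> b)))"
    if x: "x \<notin> (\<Union>b\<in>Basis. {x. x \<bullet> b = 0})" for x :: 'a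
  proof (cases "x \<in> ball 0 1")
    case True
    have nz: "x \<bullet> b \<noteq> 0" if "b \<in> Basis" for b using x that by auto
    have le1: "\<bar>x \<bullet> b\<bar> \<le> norm x" if "b \<in> Basis" for b using that by (rule Basis_le_norm)
    have "x \<noteq> 0" using nz[OF SOME_Basis] by auto
    have "?F x = (norm x powr (- \<sigma>)) ^ DIM('a)"
      using True \<open>x \<noteq> 0\<close> \<sigma>(3) by (simp add: powr_powr flip: powr_realpow)
    also have "\<dots> = (\<Prod>b\<in>(Basis::'a set). norm x powr (- \<sigma>))" by simp
    also have "\<dots> \<le> (\<Prod>b\<in>Basis. \<bar>x \<bullet> b\<bar> powr (- \<sigma>) * indicator {-1..1} (x \<bullet> b))"
    proof (rule prod_mono)
      fix b :: 'a assume b: "b \<in> Basis"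
      have "norm x powr (- \<sigma>) \<le> \<bar>x \<bullet> b\<bar> powr (- \<sigma>)"
        using nz[OF b] le1[OF b] \<sigma>(1) by (intro powr_mono2') auto
      moreover have "x \<bullet> b \<in> {-1..1}" using le1[OF b] True by (auto simp: abs_le_iff)
      ultimately show "0 \<le> norm x powr (- \<sigma>) \<and> norm x powr (- \<sigma>) \<le> \<bar>x \<bullet> b\<bar> powr (- \<sigma>) * indicator {-1..1} (x \<bullet> b)"
        by simp
    qed
    finally have "ennreal (?F x) \<le> ennreal (\<Prod>b\<in>Basis. \<bar>x \<bullet> b\<bar> powr (- \<sigma>) * indicator {-1..1} (x \<bullet> b))"
      by (rule ennreal_leI)
    also have "\<dots> = (\<Prod>b\<in>Basis. ennreal (\<bar>x \<bullet> b\<bar> powr (- \<sigma>) * indicator {-1..1} (x \<bullet> b)))"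
      by (rule prod_ennreal[symmetric]) auto
    finally show ?thesis .
  qed simp
  have null: "(\<Union>b\<in>Basis. {x::'a. x \<bullet> b = 0}) \<in> null_sets lborel"
  proof (rule null_sets.finite_UN)
    fix b :: 'a assume b: "b \<in> Basis"
    have "negligible {x. b \<bullet> x = 0}" using b by (intro negligible_hyperplane) auto
    then have "{x. b \<bullet> x = 0} \<in> null_sets lebesgue" by (simp add: negligible_iff_null_sets)
    moreover have "{x. b \<bullet> x = 0} \<in> sets lborel" by simp
    ultimately show "{x. x \<bullet> b = 0} \<in> null_sets lborel"
      by (simp add: null_sets_completion_iff inner_commute)
  qed simp
  have "(\<integral>\<^sup>+x. ennreal (?F x) \<partial>lborel) \<le> (\<integral>\<^sup>+(x::'a). (\<Prod>b\<in>Basis. ennreal (\<bar>x \<bullet> b\<bar> powr (- \<sigma>) * indicator {-1..1} (x \<bullet> b))) \<partial>lborel)"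
  proof (rule nn_integral_mono_AE)
    show "AE x in lborel. ennreal (?F x) \<le> (\<Prod>b\<in>Basis. ennreal (\<bar>x \<bullet> b\<bar> powr (- \<sigma>) * indicator {-1..1} (x \<bullet> b)))"
      using AE_not_in[OF null] by eventually_elim (rule le)
  qed
  also have "\<dots> = (\<Prod>b\<in>(Basis::'a set). (\<integral>\<^sup>+t. ennreal (\<bar>t\<bar> powr (- \<sigma>) * indicator {-1..1} t) \<partial>lborel))"
    by (rule nn_integral_lborel_prod) auto
  also have "\<dots> < \<infinity>"
    using nn_integral_abs_powr_finite[OF \<sigma>(2)] by (simp add: ennreal_prod_eq_top less_top[symmetric] power_eq_top_ennreal)
  finally have fin: "(\<integral>\<^sup>+x. ennreal (?F x) \<partial>lborel) < \<infinity>" .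
  have "integrable lborel ?F"
  proof (rule integrableI_nonneg)
    show "?F \<in> borel_measurable lborel"
      by (intro borel_measurable_times powr_real_measurable borel_measurable_indicator) auto
  qed (use fin in auto)
  then have "integrable lborel (\<lambda>x. ?F (- xbar + x))"
    using integrable_distr_eq[of "(+) (- xbar)" lborel borel ?F] lborel_distr_plus[of "- xbar"]
    by (simp add: borel_measurable_integrable[of lborel, simplified])
  moreover have "(\<lambda>x. ?F (- xbar + x)) = (\<lambda>x. norm (x - xbar) powr (- s) * indicator (ball xbar 1) x)"
    by (auto simp: fun_eq_iff indicator_def dist_norm norm_minus_commute)
  ultimately show ?thesis by simp
qed

lemma laplacian_mult:
  assumes "smooth f" "smooth g"
  shows "laplacian (\<lambda>x. f x * g x) x = laplacian f x * g x + 2 * (grad f x \<bullet> grad g x) + f x * laplacian g x"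
proof -
  have "pd i (pd i (\<lambda>x. f x * g x)) x = pd i (pd i f) x * g x + 2 * (pd i f x * pd i g x) + f x * pd i (pd i g) x"
    if i: "i \<in> Basis" for i
  proof -
    note d = smooth_differentiable[OF assms(1)] smooth_differentiable[OF assms(2)]
      smooth_differentiable[OF smooth_pd[OF assms(1) i]] smooth_differentiable[OF smooth_pd[OF assms(2) i]]
    have "pd i (\<lambda>x. f x * g x) = (\<lambda>x. pd i f x * g x + f x * pd i g x)"
      by (intro ext pd_mult d)
    then have "pd i (pd i (\<lambda>x. f x * g x)) x = pd i (\<lambda>x. pd i f x * g x) x + pd i (\<lambda>x. f x * pd i g x) x"
      by (simp only:) (intro pd_add differentiable_mult d)
    then show ?thesis by (simp add: pd_mult d algebra_simps)
  qed
  then show ?thesis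
    unfolding laplacian_def grad_inner_grad
    by (simp add: sum.distrib sum_distrib_left sum_distrib_right)
qed

section \<open>A smooth radial cutoff\<close>

context
  fixes xbar :: "'a::euclidean_space" and r :: real
  assumes r: "0 < r"
begin

text \<open>The usual quotient p / (p + q), with p positive exactly inside radius \<open>r\<close>
  and q positive exactly outside radius \<open>r / 2\<close>. The reciprocal is written with
  \<open>powr\<close> so that \<open>smooth_powr\<close> applies.\<close>

definition cutoff :: "'a \<Rightarrow> real" where
  "cutoff x = flat 0 (r\<^sup>2 - (norm (x - xbar))\<^sup>2) *
     (flat 0 (r\<^sup>2 - (norm (x - xbar))\<^sup>2) + flat 0 ((norm (x - xbar))\<^sup>2 - (r / 2)\<^sup>2)) powr (- 1)"

lemma cutoff_denominator_pos:
  "flat 0 (r\<^sup>2 - (norm (x - xbar))\<^sup>2) + flat 0 ((norm (x - xbar))\<^sup>2 - (r / 2)\<^sup>2) > 0"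
proof (cases "norm (x - xbar) < r")
  case True
  then have "(norm (x - xbar))\<^sup>2 < r\<^sup>2" by (intro power_strict_mono) auto
  then show ?thesis using flat_pos flat_nonneg by (simp add: add_pos_nonneg)
next
  case False
  then have "(r / 2)\<^sup>2 < (norm (x - xbar))\<^sup>2" using r by (intro power_strict_mono) auto
  then show ?thesis using flat_pos flat_nonneg by (simp add: add_nonneg_pos)
qed

lemma smooth_cutoff: "smooth cutoff"
  unfolding cutoff_def[abs_def]
  by (intro smooth_mult smooth_powr smooth_add smooth_flat smooth_diff smooth_const smooth_norm_diff_sq
      cutoff_denominator_pos)

lemma cutoff_eq_0: "norm (x - xbar) \<ge> r \<Longrightarrow> cutoff x = 0"
  unfolding cutoff_def using r by (simp add: flat_eq_0 power_mono)

lemma cutoff_eq_1: "norm (x - xbar) < r / 2 \<Longrightarrow> cutoff x = 1"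
proof -
  assume x: "norm (x - xbar) < r / 2"
  then have "(norm (x - xbar))\<^sup>2 \<le> (r / 2)\<^sup>2" by (intro power_mono) auto
  then have 0: "flat 0 ((norm (x - xbar))\<^sup>2 - (r / 2)\<^sup>2) = 0" by (simp add: flat_eq_0)
  show ?thesis using cutoff_denominator_pos[of x] unfolding cutoff_def 0 by (simp add: powr_minus_divide)
qed

lemma cutoff_bounds: "0 \<le> cutoff x" "cutoff x \<le> 1"
proof -
  let ?p = "flat 0 (r\<^sup>2 - (norm (x - xbar))\<^sup>2)" and ?d = "flat 0 ((norm (x - xbar))\<^sup>2 - (r / 2)\<^sup>2)"
  have "(?p + ?d) powr (- 1) = 1 / (?p + ?d)"
    using less_imp_le[OF cutoff_denominator_pos[of x]] unfolding powr_minus_divide by (subst powr_one) auto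
  then have eq: "cutoff x = ?p / (?p + ?d)" unfolding cutoff_def by simp
  show "0 \<le> cutoff x"
    unfolding eq by (intro divide_nonneg_nonneg add_nonneg_nonneg flat_nonneg)
  show "cutoff x \<le> 1"
    unfolding eq by (rule divide_le_eq_1_pos[THEN iffD2, OF cutoff_denominator_pos]) (simp add: flat_nonneg)
qed

lemma cutoff_locally_constant:
  assumes x: "norm (x - xbar) < r / 2"
  shows "pd i cutoff x = 0" "laplacian cutoff x = 0"
proof -
  have z: "pd i cutoff y = 0" if "y \<in> ball xbar (r / 2)" for y i
  proof -
    have "pd i cutoff y = pd i (\<lambda>_. 1) y"
      by (rule pd_cong_open[OF open_ball that _ smooth_differentiable[OF smooth_cutoff]])
        (auto intro!: cutoff_eq_1 simp: dist_norm norm_minus_commute)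
    then show ?thesis by (simp add: pd_eqI[OF has_derivative_const])
  qed
  have xb: "x \<in> ball xbar (r / 2)" using x by (simp add: dist_norm norm_minus_commute)
  then show "pd i cutoff x = 0" by (rule z)
  have "pd i (pd i cutoff) x = 0" if i: "i \<in> Basis" for i
  proof -
    have "pd i (pd i cutoff) x = pd i (\<lambda>_. 0) x"
      by (rule pd_cong_open[OF open_ball xb _ smooth_differentiable[OF smooth_pd[OF smooth_cutoff i]]]) (rule z)
    then show ?thesis by (simp add: pd_eqI[OF has_derivative_const])
  qed
  then show "laplacian cutoff x = 0" by (simp add: laplacian_def)
qed

end

section \<open>The regularised dipole\<close>

context
  fixes xbar e :: "'a::euclidean_space" and \<epsilon> :: real
  assumes e: "e \<in> Basis" and \<epsilon>: "0 < \<epsilon>"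
begin

text \<open>The second summand is zero for \<open>(x - xbar) \<bullet> e \<le> 0\<close>; it removes the singularity of the
  dipole at \<open>xbar + \<epsilon> e\<close> without changing it on the half space.\<close>

definition reg :: "'a \<Rightarrow> real" where
  "reg x = (norm (x - (xbar + \<epsilon> *\<^sub>R e)))\<^sup>2 + flat 0 ((x - xbar) \<bullet> e)"

text \<open>Where the correction in \<open>reg\<close> vanishes this is -(z . e) / |z|^N, with z the
  vector from the pole \<open>xbar + \<epsilon> *\<^sub>R e\<close> to x: up to a constant factor,
  the derivative in direction \<open>e\<close> of the fundamental solution of the Laplacian.\<close>

definition dipole :: "'a \<Rightarrow> real" where
  "dipole x = (\<epsilon> - (x - xbar) \<bullet> e) * reg x powr (- real DIM('a) / 2)"

lemma reg_pos: "reg x > 0"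
proof (cases "x = xbar + \<epsilon> *\<^sub>R e")
  case True
  then have "(x - xbar) \<bullet> e = \<epsilon>" using e by simp
  then show ?thesis using True \<epsilon> flat_pos by (simp add: reg_def)
next
  case False
  then show ?thesis using flat_nonneg by (auto simp: reg_def intro!: add_pos_nonneg)
qed

lemma smooth_reg: "smooth reg"
  unfolding reg_def[abs_def] inner_diff_left
  by (intro smooth_add smooth_norm_diff_sq smooth_flat smooth_diff smooth_inner_right smooth_const)

lemma smooth_dipole: "smooth dipole"
  unfolding dipole_def[abs_def] inner_diff_left
  by (intro smooth_mult smooth_diff smooth_const smooth_inner_right smooth_powr smooth_reg reg_pos)

lemma pd_reg: "pd i reg x = 2 * ((x - (xbar + \<epsilon> *\<^sub>R e)) \<bullet> i) + flat 2 ((x - xbar) \<bullet> e) * (i \<bullet> e)"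
proof -
  have 1: "((\<lambda>x. (norm (x - y))\<^sup>2) has_derivative (\<lambda>h. 2 * ((x - y) \<bullet> h))) (at x)" for y
    unfolding power2_norm_eq_inner
    by (auto intro!: derivative_eq_intros simp: inner_commute)
  have "(flat 0 has_derivative (\<lambda>h. flat 2 s * h)) (at s)" for s
    using flat_has_derivative[of 0 s] by (simp add: has_field_derivative_def numeral_2_eq_2)
  moreover have "((\<lambda>x. (x - xbar) \<bullet> e) has_derivative (\<lambda>h. h \<bullet> e)) (at x)"
    by (auto intro!: derivative_eq_intros)
  ultimately have 2: "((\<lambda>x. flat 0 ((x - xbar) \<bullet> e)) has_derivative (\<lambda>h. flat 2 ((x - xbar) \<bullet> e) * (h \<bullet> e))) (at x)"
    using has_derivative_compose by blast
  show ?thesis unfolding reg_def[abs_def] using has_derivative_add[OF 1 2] by (rule pd_eqI)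
qed

text \<open>All functions \<open>flat m\<close> vanish on the closed half line, so the correction
  leaves no trace in these derivatives, even on the bounding plane itself.\<close>

lemma pd_pd_reg:
  assumes x: "(x - xbar) \<bullet> e \<le> 0" and i: "i \<in> Basis"
  shows "pd i (pd i reg) x = 2"
proof -
  have "(flat 2 has_derivative (\<lambda>h. (flat 4 s - 2 * flat 3 s) * h)) (at s)" for s
    using flat_has_derivative[of 2 s] by (simp add: has_field_derivative_def)
  moreover have "((\<lambda>x. (x - xbar) \<bullet> e) has_derivative (\<lambda>h. h \<bullet> e)) (at x)"
    by (auto intro!: derivative_eq_intros)
  ultimately have "((\<lambda>x. flat 2 ((x - xbar) \<bullet> e)) has_derivative (\<lambda>h. (flat 4 ((x - xbar) \<bullet> e) - 2 * flat 3 ((x - xbar) \<bullet> e)) * (h \<bullet> e))) (at x)"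
    using has_derivative_compose by blast
  then have 2: "((\<lambda>x. flat 2 ((x - xbar) \<bullet> e)) has_derivative (\<lambda>h. 0)) (at x)"
    using x by (simp add: flat_eq_0)
  have "((\<lambda>x. 2 * ((x - (xbar + \<epsilon> *\<^sub>R e)) \<bullet> i) + flat 2 ((x - xbar) \<bullet> e) * (i \<bullet> e)) has_derivative (\<lambda>h. 2 * (h \<bullet> i))) (at x)"
    using 2 by (auto intro!: derivative_eq_intros)
  then have "pd i (\<lambda>x. 2 * ((x - (xbar + \<epsilon> *\<^sub>R e)) \<bullet> i) + flat 2 ((x - xbar) \<bullet> e) * (i \<bullet> e)) x = 2 * (i \<bullet> i)"
    by (rule pd_eqI)
  moreover have "pd i reg = (\<lambda>x. 2 * ((x - (xbar + \<epsilon> *\<^sub>R e)) \<bullet> i) + flat 2 ((x - xbar) \<bullet> e) * (i \<bullet> e))"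
    by (rule ext) (rule pd_reg)
  ultimately have "pd i (pd i reg) x = 2 * (i \<bullet> i)" by (simp only:)
  then show ?thesis using i by simp
qed

lemma pd_reg_powr: "pd i (\<lambda>x. reg x powr a) x = a * reg x powr (a - 1) * pd i reg x"
  by (rule pd_chain(1)[OF smooth_differentiable[OF smooth_reg]])
    (rule has_real_derivative_powr[OF reg_pos])

text \<open>On the half space \<open>reg\<close> is |z|^2 for the vector z from the pole, so this is
  the radial formula: the Laplacian of |z|^(2a) is 2a(2a - 2 + N) |z|^(2a - 2).\<close>

lemma laplacian_reg_powr:
  assumes x: "(x - xbar) \<bullet> e \<le> 0"
  shows "laplacian (\<lambda>x. reg x powr a) x = a * (4 * (a - 1) + 2 * real DIM('a)) * reg x powr (a - 1)"
proof -
  have "pd i (pd i (\<lambda>x. reg x powr a)) x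
     = a * (a - 1) * reg x powr (a - 2) * (2 * ((x - (xbar + \<epsilon> *\<^sub>R e)) \<bullet> i))\<^sup>2 + a * reg x powr (a - 1) * 2"
    if i: "i \<in> Basis" for i
  proof -
    have "pd i (\<lambda>x. reg x powr a) = (\<lambda>x. (a * reg x powr (a - 1)) * pd i reg x)"
      by (rule ext) (rule pd_reg_powr)
    then have "pd i (pd i (\<lambda>x. reg x powr a)) x = pd i (\<lambda>x. a * reg x powr (a - 1)) x * pd i reg x + a * reg x powr (a - 1) * pd i (pd i reg) x"
      by (simp only:) (intro pd_mult smooth_differentiable smooth_mult smooth_const smooth_powr smooth_reg smooth_pd reg_pos i)
    also have "pd i (\<lambda>x. a * reg x powr (a - 1)) x = a * ((a - 1) * reg x powr (a - 2) * pd i reg x)"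
      using pd_mult[OF smooth_differentiable[OF smooth_const] smooth_differentiable[OF smooth_powr[OF smooth_reg reg_pos]]]
      by (simp add: pd_reg_powr pd_eqI[OF has_derivative_const])
    finally show ?thesis
      unfolding pd_pd_reg[OF x i] unfolding pd_reg flat_eq_0[OF x] by (simp add: power2_eq_square)
  qed
  then have "laplacian (\<lambda>x. reg x powr a) x = (\<Sum>i\<in>Basis. a * (a - 1) * reg x powr (a - 2) * (2 * ((x - (xbar + \<epsilon> *\<^sub>R e)) \<bullet> i))\<^sup>2 + a * reg x powr (a - 1) * 2)"
    unfolding laplacian_def by (rule sum.cong[OF refl])
  also have "\<dots> = a * (a - 1) * reg x powr (a - 2) * 4 * (\<Sum>i\<in>Basis. ((x - (xbar + \<epsilon> *\<^sub>R e)) \<bullet> i)\<^sup>2) + real DIM('a) * (a * reg x powr (a - 1) * 2)"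
    by (simp add: sum.distrib power_mult_distrib flip: sum_distrib_left)
  also have "(\<Sum>i\<in>Basis. ((x - (xbar + \<epsilon> *\<^sub>R e)) \<bullet> i)\<^sup>2) = reg x"
    unfolding reg_def flat_eq_0[OF x] power2_norm_eq_inner by (simp only: euclidean_inner[symmetric] power2_eq_square add_0_right)
  also have "a * (a - 1) * reg x powr (a - 2) * 4 * reg x = a * (a - 1) * 4 * reg x powr (a - 1)"
    using powr_mult_base[of "reg x" "a - 2"] reg_pos[of x] by (simp add: mult_ac)
  finally show ?thesis by (simp add: algebra_simps)
qed

lemma pd_affine: "pd i (\<lambda>x. \<epsilon> - (x - xbar) \<bullet> e) x = - (i \<bullet> e)"
  by (rule pd_eqI) (auto intro!: derivative_eq_intros)

lemma pd_dipole:
  assumes x: "(x - xbar) \<bullet> e \<le> 0"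
  defines "z \<equiv> x - (xbar + \<epsilon> *\<^sub>R e)"
  shows "pd i dipole x = - (i \<bullet> e) * reg x powr (- real DIM('a) / 2)
    - real DIM('a) * (\<epsilon> - (x - xbar) \<bullet> e) * (z \<bullet> i) * reg x powr (- real DIM('a) / 2 - 1)"
proof -
  have s: "smooth (\<lambda>x. \<epsilon> - (x - xbar) \<bullet> e)"
    unfolding inner_diff_left by (intro smooth_diff smooth_const smooth_inner_right)
  have "pd i dipole x = pd i (\<lambda>x. \<epsilon> - (x - xbar) \<bullet> e) x * reg x powr (- real DIM('a) / 2)
     + (\<epsilon> - (x - xbar) \<bullet> e) * pd i (\<lambda>x. reg x powr (- real DIM('a) / 2)) x"
    unfolding dipole_def[abs_def]
    by (intro pd_mult smooth_differentiable smooth_powr smooth_reg reg_pos s)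
  then show ?thesis
    using x unfolding pd_affine pd_reg_powr pd_reg z_def by (simp add: flat_eq_0)
qed

text \<open>Product rule for an affine factor p and a radial factor. The cross term is -2 N p
  \<open>reg x\<close>^(-N/2 - 1), and the radial formula with a = -N/2 makes the last term its
  negative.\<close>

lemma laplacian_dipole:
  assumes x: "(x - xbar) \<bullet> e \<le> 0"
  shows "laplacian dipole x = 0"
proof -
  let ?N = "real DIM('a)" and ?p = "\<lambda>x. \<epsilon> - (x - xbar) \<bullet> e" and ?w = "\<lambda>x. reg x powr (- real DIM('a) / 2)"
  have s: "smooth ?p" "smooth ?w"
    unfolding inner_diff_left by (intro smooth_diff smooth_const smooth_inner_right smooth_powr smooth_reg reg_pos)+
  have "pd i ?p = (\<lambda>_. - (i \<bullet> e))" for i by (rule ext) (rule pd_affine)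
  then have lp: "laplacian ?p x = 0" by (simp add: laplacian_def pd_eqI[OF has_derivative_const])
  have "grad ?p x \<bullet> grad ?w x = (\<Sum>i\<in>Basis. (if i = e then - pd e ?w x else 0))"
    unfolding grad_inner_grad pd_affine using e by (intro sum.cong) (auto simp: inner_Basis)
  then have gp: "grad ?p x \<bullet> grad ?w x = - pd e ?w x" using e by simp
  have pw: "pd e ?w x = ?N * (\<epsilon> - (x - xbar) \<bullet> e) * reg x powr (- ?N / 2 - 1)"
  proof -
    have "(x - (xbar + \<epsilon> *\<^sub>R e)) \<bullet> e = (x - xbar) \<bullet> e - \<epsilon>" using e by (simp add: inner_diff_left inner_add_left)
    then show ?thesis unfolding pd_reg_powr pd_reg flat_eq_0[OF x] by (simp only:) (simp add: field_simps)
  qed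
  have "laplacian dipole x = laplacian ?p x * ?w x + 2 * (grad ?p x \<bullet> grad ?w x) + ?p x * laplacian ?w x"
    unfolding dipole_def[abs_def] by (rule laplacian_mult[OF s])
  also have "laplacian ?w x = 2 * ?N * reg x powr (- ?N / 2 - 1)"
    unfolding laplacian_reg_powr[OF x] by (simp add: field_simps)
  finally show ?thesis unfolding lp gp pw by (simp add: algebra_simps)
qed

text \<open>Expanding the square, |z|^2 is the sum of |x - xbar|^2, \<epsilon>^2 and a term that is
  nonnegative on the half space; so |z| dominates both \<epsilon> and |x - xbar|.\<close>

lemma reg_lower:
  assumes x: "(x - xbar) \<bullet> e \<le> 0"
  defines "z \<equiv> x - (xbar + \<epsilon> *\<^sub>R e)"
  shows "reg x = (norm z)\<^sup>2" "\<epsilon> \<le> norm z" "norm (x - xbar) \<le> norm z"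
    "reg x = (norm (x - xbar))\<^sup>2 + \<epsilon>\<^sup>2 - 2 * \<epsilon> * ((x - xbar) \<bullet> e)" "norm z \<le> norm (x - xbar) + \<epsilon>"
proof -
  show a: "reg x = (norm z)\<^sup>2" using x by (simp add: reg_def z_def flat_eq_0)
  have zx: "z = (x - xbar) - \<epsilon> *\<^sub>R e" by (simp add: z_def)
  have b: "(norm z)\<^sup>2 = (norm (x - xbar))\<^sup>2 + \<epsilon>\<^sup>2 - 2 * \<epsilon> * ((x - xbar) \<bullet> e)"
    unfolding zx power2_norm_eq_inner using e
    by (simp add: inner_diff_left inner_diff_right inner_commute power2_eq_square algebra_simps)
  then show "reg x = (norm (x - xbar))\<^sup>2 + \<epsilon>\<^sup>2 - 2 * \<epsilon> * ((x - xbar) \<bullet> e)" using a by simp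
  have p: "\<epsilon> * ((x - xbar) \<bullet> e) \<le> 0" using x \<epsilon> by (simp add: mult_nonneg_nonpos)
  have "\<epsilon>\<^sup>2 \<le> (norm z)\<^sup>2" unfolding b using p zero_le_power2[of "norm (x - xbar)"] by linarith
  then show "\<epsilon> \<le> norm z" by (rule power2_le_imp_le) simp
  have "(norm (x - xbar))\<^sup>2 \<le> (norm z)\<^sup>2" unfolding b using p zero_le_power2[of \<epsilon>] by linarith
  then show "norm (x - xbar) \<le> norm z" by (rule power2_le_imp_le) simp
  show "norm z \<le> norm (x - xbar) + \<epsilon>"
    unfolding zx using norm_triangle_ineq4[of "x - xbar" "\<epsilon> *\<^sub>R e"] e \<epsilon> by simp
qed

lemma dipole_bounds:
  assumes x: "(x - xbar) \<bullet> e \<le> 0" and i: "i \<in> Basis"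
  defines "z \<equiv> x - (xbar + \<epsilon> *\<^sub>R e)"
  shows "\<bar>dipole x\<bar> \<le> norm z * norm z powr (- real DIM('a))"
    "\<bar>pd i dipole x\<bar> \<le> (1 + real DIM('a)) * norm z powr (- real DIM('a))"
proof -
  let ?N = "real DIM('a)"
  have z0: "norm z > 0" using reg_lower(2)[OF x] \<epsilon> unfolding z_def by linarith
  have reg: "reg x = (norm z)\<^sup>2" using reg_lower(1)[OF x] by (simp add: z_def)
  have w: "reg x powr (- ?N / 2) = norm z powr (- ?N)"
    unfolding reg using z0 by (simp add: powr_powr flip: powr_numeral)
  have w1: "(norm z)\<^sup>2 * reg x powr (- ?N / 2 - 1) = norm z powr (- ?N)"
    using powr_mult_base[of "reg x" "- ?N / 2 - 1"] reg_pos[of x] w unfolding reg by simp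
  have "\<epsilon> - (x - xbar) \<bullet> e = - (z \<bullet> e)" using e by (simp add: z_def inner_diff_left inner_add_left)
  then have p: "\<bar>\<epsilon> - (x - xbar) \<bullet> e\<bar> \<le> norm z" using Basis_le_norm[OF e, of z] by simp
  show "\<bar>dipole x\<bar> \<le> norm z * norm z powr (- ?N)"
    unfolding dipole_def w abs_mult using p by (intro mult_mono) auto
  have ie: "\<bar>i \<bullet> e\<bar> \<le> 1" using i e by (auto simp: inner_Basis)
  have "\<bar>pd i dipole x\<bar> \<le> \<bar>- (i \<bullet> e) * reg x powr (- ?N / 2)\<bar> + \<bar>?N * (\<epsilon> - (x - xbar) \<bullet> e) * (z \<bullet> i) * reg x powr (- ?N / 2 - 1)\<bar>"
    unfolding pd_dipole[OF x] z_def by (rule abs_triangle_ineq4)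
  also have "\<bar>- (i \<bullet> e) * reg x powr (- ?N / 2)\<bar> \<le> 1 * norm z powr (- ?N)"
    unfolding abs_mult w using ie by (intro mult_mono) auto
  also have "\<bar>?N * (\<epsilon> - (x - xbar) \<bullet> e) * (z \<bullet> i) * reg x powr (- ?N / 2 - 1)\<bar> \<le> ?N * norm z * norm z * reg x powr (- ?N / 2 - 1)"
    unfolding abs_mult using p Basis_le_norm[OF i, of z] by (intro mult_mono) auto
  also have "?N * norm z * norm z * reg x powr (- ?N / 2 - 1) = ?N * norm z powr (- ?N)"
    using w1 by (simp add: power2_eq_square mult_ac)
  finally show "\<bar>pd i dipole x\<bar> \<le> (1 + ?N) * norm z powr (- ?N)" by (simp add: algebra_simps)
qed

text \<open>The sign is positive within radius \<epsilon> sqrt(N - 1) of \<open>xbar\<close> and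
  negative beyond. This is why the peak has the same width \<epsilon> as the distance of the pole:
  within radius \<epsilon> the sign is right for N at least 2.\<close>

lemma pd_dipole_plane:
  assumes x: "(x - xbar) \<bullet> e = 0"
  shows "pd e dipole x = reg x powr (- real DIM('a) / 2 - 1) * ((real DIM('a) - 1) * \<epsilon>\<^sup>2 - (norm (x - xbar))\<^sup>2)"
proof -
  let ?N = "real DIM('a)"
  have reg: "reg x = (norm (x - xbar))\<^sup>2 + \<epsilon>\<^sup>2" using reg_lower(4)[of x] x by simp
  have w: "reg x powr (- ?N / 2) = reg x * reg x powr (- ?N / 2 - 1)"
    using powr_mult_base[of "reg x" "- ?N / 2 - 1"] reg_pos[of x] by simp
  have "(x - (xbar + \<epsilon> *\<^sub>R e)) \<bullet> e = - \<epsilon>" using x e by (simp add: inner_diff_left inner_add_left)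
  then have "pd e dipole x = - (reg x powr (- ?N / 2)) + ?N * \<epsilon>\<^sup>2 * reg x powr (- ?N / 2 - 1)"
    using pd_dipole[of x e] x e by (simp add: power2_eq_square)
  also have "\<dots> = reg x powr (- ?N / 2 - 1) * (?N * \<epsilon>\<^sup>2 - reg x)"
    unfolding w by (simp add: algebra_simps)
  finally show ?thesis unfolding reg by (simp add: algebra_simps)
qed

end

text \<open>The properties of the cut-off dipole on which the flux estimate rests, with
  \<open>K\<close> and \<open>\<kappa>\<close> to be independent of \<epsilon>. The weight in the
  first two bounds is a fixed integrable function; 1/4 is one choice among the positive exponents
  below 1/2.\<close>

definition singular_test ::
  "'a::euclidean_space \<Rightarrow> 'a \<Rightarrow> real \<Rightarrow> real \<Rightarrow> real \<Rightarrow> real \<Rightarrow> ('a \<Rightarrow> real) \<Rightarrow> bool" where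
  "singular_test xbar e \<rho> K \<kappa> \<epsilon> \<Phi> \<longleftrightarrow> smooth \<Phi> \<and> (\<forall>x. x \<notin> cball xbar (\<rho> / 2) \<longrightarrow> \<Phi> x = 0) \<and>
    (\<forall>x. (x - xbar) \<bullet> e < 0 \<longrightarrow>
       \<bar>\<Phi> x\<bar> \<le> K * \<epsilon> powr (-1/4) * (norm (x - xbar) powr (- (real DIM('a) - 1/4)) * indicator (ball xbar 1) x) \<and>
       norm (grad \<Phi> x) \<le> K * \<epsilon> powr (-1/4) * (norm (x - xbar) powr (- (real DIM('a) - 1/4)) * indicator (ball xbar 1) x) \<and>
       \<bar>laplacian \<Phi> x\<bar> \<le> K) \<and>
    (\<forall>x. (x - xbar) \<bullet> e = 0 \<and> norm (x - xbar) < \<epsilon> \<longrightarrow> 0 \<le> pd e \<Phi> x) \<and>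
    (\<forall>x. (x - xbar) \<bullet> e = 0 \<and> norm (x - xbar) \<le> \<epsilon> / 2 \<longrightarrow> \<kappa> * \<epsilon> powr (- real DIM('a)) \<le> pd e \<Phi> x)"

lemma singular_test_function:
  fixes xbar e :: "'a::euclidean_space" and \<rho> :: real
  assumes e: "e \<in> Basis" and \<rho>: "0 < \<rho>" "\<rho> \<le> 1" and N: "DIM('a) \<ge> 2"
  shows "\<exists>K>0. \<exists>\<kappa>>0. \<forall>\<epsilon>. 0 < \<epsilon> \<and> \<epsilon> < \<rho> / 4 \<longrightarrow> (\<exists>\<Phi>. singular_test xbar e \<rho> K \<kappa> \<epsilon> \<Phi>)"
proof -
  let ?N = "real DIM('a)"
  define r where "r = \<rho> / 2"
  have r: "0 < r" "r \<le> 1/2" using \<rho> by (auto simp: r_def)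
  let ?c = "cutoff xbar r"
  note sc = smooth_cutoff[OF r(1), of xbar]
  have supp_c: "?c x = 0" if "norm x > norm xbar + r" for x
    by (rule cutoff_eq_0[OF r(1)]) (use norm_triangle_sub[of x xbar] that in linarith)
  have "grad ?c x = 0" if "norm x > norm xbar + r" for x
    using pd_eq_0_outside_cball[OF supp_c that] by (simp add: grad_def)
  then have "\<exists>B>0. \<forall>x. norm (grad ?c x) \<le> B"
    by (rule continuous_bounded_support_bounded[OF smooth_continuous_grad[OF sc]])
  then obtain B1 where B1: "B1 > 0" "\<And>x. norm (grad ?c x) \<le> B1" by blast
  have B1': "\<bar>pd i ?c x\<bar> \<le> B1" if "i \<in> Basis" for i x
    using Basis_le_norm[OF that, of "grad ?c x"] B1(2)[of x] that by (simp add: grad_inner_Basis)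
  have "\<exists>B>0. \<forall>x. norm (laplacian ?c x) \<le> B"
    by (rule continuous_bounded_support_bounded[OF smooth_continuous[OF smooth_laplacian[OF sc]], of "norm xbar + r"])
      (rule laplacian_eq_0_outside_cball[OF supp_c])
  then obtain B2 where B2: "B2 > 0" "\<And>x. \<bar>laplacian ?c x\<bar> \<le> B2" by auto
  \<comment> \<open>Bound for |z|^(-N) where the cutoff varies: there |z| is at least
    \<open>r / 2\<close> whatever \<epsilon> is, so the Laplacian is bounded uniformly.\<close>
  define W0 where "W0 = (r / 2) powr (- ?N)"
  have W0: "W0 > 0" using r by (simp add: W0_def)
  define K1 where "K1 = ?N * (B1 + 1 + ?N)"
  define K2 where "K2 = B2 * W0 + 2 * (?N * (B1 * ((1 + ?N) * W0)))"
  define K where "K = 1 + K1 + K2"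
  have K: "K1 > 0" "K2 > 0" "K > 0" "1 \<le> K" "K1 \<le> K" "K2 \<le> K"
    using B1 B2 W0 by (auto simp: K1_def K2_def K_def intro!: add_pos_pos mult_pos_pos)
  \<comment> \<open>On the plane within distance \<epsilon>/2 of \<open>xbar\<close>,
    \<open>reg\<close> is at most 2 \<epsilon>^2 and the bracket in \<open>pd_dipole_plane\<close>
    at least 3/4 \<epsilon>^2; these give the two factors.\<close>
  define \<kappa> where "\<kappa> = 3/4 * 2 powr (- ?N / 2 - 1)"
  have \<kappa>: "\<kappa> > 0" by (simp add: \<kappa>_def)
  have "\<exists>\<Phi>. singular_test xbar e \<rho> K \<kappa> \<epsilon> \<Phi>"
    if \<epsilon>: "0 < \<epsilon>" "\<epsilon> < \<rho> / 4" for \<epsilon>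
  proof -
    let ?d = "dipole xbar e \<epsilon>"
    note sd = smooth_dipole[OF e \<epsilon>(1), of xbar]
    define \<Phi> where "\<Phi> x = ?c x * ?d x" for x
    have s: "smooth \<Phi>" unfolding \<Phi>_def[abs_def] by (rule smooth_mult[OF sc sd])
    have off: "\<Phi> x = 0" if "x \<notin> cball xbar r" for x
      using cutoff_eq_0[OF r(1), of x xbar] that by (simp add: \<Phi>_def dist_norm norm_minus_commute)
    have pd_off: "pd i \<Phi> x = 0" and lap_off: "laplacian \<Phi> x = 0" if "x \<notin> cball xbar r" for x i
    proof -
      show "pd i \<Phi> x = 0" by (rule pd_eq_0_outside_closed[OF closed_cball _ that]) (rule off)
      show "laplacian \<Phi> x = 0" by (rule laplacian_eq_0_outside_closed[OF closed_cball _ that]) (rule off)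
    qed
    have pd\<Phi>: "pd i \<Phi> x = pd i ?c x * ?d x + ?c x * pd i ?d x" for i x
      unfolding \<Phi>_def[abs_def] by (intro pd_mult smooth_differentiable sc sd)
    have main: "\<bar>\<Phi> x\<bar> \<le> K * \<epsilon> powr (-1/4) * (norm (x - xbar) powr (- (?N - 1/4)) * indicator (ball xbar 1) x) \<and>
       norm (grad \<Phi> x) \<le> K * \<epsilon> powr (-1/4) * (norm (x - xbar) powr (- (?N - 1/4)) * indicator (ball xbar 1) x) \<and>
       \<bar>laplacian \<Phi> x\<bar> \<le> K" if x: "(x - xbar) \<bullet> e < 0" for x
    proof (cases "x \<in> cball xbar r")
      case False
      then show ?thesis using off[OF False] pd_off[OF False] lap_off[OF False] K by (simp add: grad_def)
    next
      case True
      then have xr: "norm (x - xbar) \<le> r" by (simp add: dist_norm norm_minus_commute)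
      have xb: "x \<in> ball xbar 1" using xr r by (simp add: dist_norm norm_minus_commute)
      have x0: "norm (x - xbar) > 0" using x by auto
      define z where "z = x - (xbar + \<epsilon> *\<^sub>R e)"
      define W where "W = norm z powr (- ?N)"
      note z = reg_lower[OF e \<epsilon>(1) less_imp_le[OF x], folded z_def]
      have z1: "norm z \<le> 1" using z(5) xr r \<epsilon> by (simp add: r_def)
      have z0: "norm z > 0" using z(2) \<epsilon>(1) by linarith
      have W: "W \<ge> 0" by (simp add: W_def)
      have d: "\<bar>?d x\<bar> \<le> W"
        using dipole_bounds(1)[OF e \<epsilon>(1) less_imp_le[OF x] e, folded z_def W_def] mult_right_mono[OF z1 W] by linarith
      have dp: "\<bar>pd i ?d x\<bar> \<le> (1 + ?N) * W" if "i \<in> Basis" for i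
        using dipole_bounds(2)[OF e \<epsilon>(1) less_imp_le[OF x] that, folded z_def W_def] .
      have c: "\<bar>?c x\<bar> \<le> 1" using cutoff_bounds[OF r(1), of xbar x] by simp
      \<comment> \<open>The power 1/4 of |z| is estimated by \<epsilon> and the rest by |x - xbar|,
        both being lower bounds for |z|.\<close>
      have Wle: "W \<le> \<epsilon> powr (-1/4) * (norm (x - xbar) powr (- (?N - 1/4)) * indicator (ball xbar 1) x)"
      proof -
        have "W = norm z powr (-1/4) * norm z powr (- (?N - 1/4))"
          unfolding W_def by (simp flip: powr_add)
        also have "\<dots> \<le> \<epsilon> powr (-1/4) * norm (x - xbar) powr (- (?N - 1/4))"
          using z(2,3) \<epsilon>(1) x0 N by (intro mult_mono powr_mono2') auto
        finally show ?thesis using xb by simp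
      qed
      have p1: "\<bar>\<Phi> x\<bar> \<le> 1 * W"
        unfolding \<Phi>_def abs_mult using c d by (intro mult_mono) auto
      have p2: "\<bar>pd i \<Phi> x\<bar> \<le> (B1 + 1 + ?N) * W" if i: "i \<in> Basis" for i
      proof -
        have "\<bar>pd i \<Phi> x\<bar> \<le> \<bar>pd i ?c x\<bar> * \<bar>?d x\<bar> + \<bar>?c x\<bar> * \<bar>pd i ?d x\<bar>"
          unfolding pd\<Phi> using abs_triangle_ineq by (simp flip: abs_mult)
        also have "\<dots> \<le> B1 * W + 1 * ((1 + ?N) * W)"
          using B1'[OF i] d c dp[OF i] B1(1) W by (intro add_mono mult_mono) auto
        finally show ?thesis by (simp add: algebra_simps)
      qed
      have p3: "norm (grad \<Phi> x) \<le> K1 * W"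
      proof -
        have "norm (grad \<Phi> x) \<le> (\<Sum>i\<in>Basis. \<bar>grad \<Phi> x \<bullet> i\<bar>)" by (rule norm_le_l1)
        also have "\<dots> \<le> (\<Sum>i\<in>(Basis::'a set). (B1 + 1 + ?N) * W)"
          using p2 by (intro sum_mono) (simp add: grad_inner_Basis)
        finally show ?thesis by (simp add: K1_def)
      qed
      have p4: "\<bar>laplacian \<Phi> x\<bar> \<le> K2"
      proof (cases "norm (x - xbar) < r / 2")
        case True
        \<comment> \<open>Inside radius \<open>r / 2\<close> the cutoff is constant, so only the
          Laplacian of the harmonic dipole could remain.\<close>
        have "laplacian \<Phi> x = laplacian ?c x * ?d x + 2 * (grad ?c x \<bullet> grad ?d x) + ?c x * laplacian ?d x"
          unfolding \<Phi>_def[abs_def] by (rule laplacian_mult[OF sc sd])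
        also have "\<dots> = 0"
          using cutoff_locally_constant[OF r(1) True] laplacian_dipole[OF e \<epsilon>(1) less_imp_le[OF x]]
          by (simp add: grad_def)
        finally show ?thesis using K by simp
      next
        case False
        have WW: "W \<le> W0" unfolding W_def W0_def using False z(3) r by (intro powr_mono2') auto
        have "laplacian \<Phi> x = laplacian ?c x * ?d x + 2 * (grad ?c x \<bullet> grad ?d x) + ?c x * laplacian ?d x"
          unfolding \<Phi>_def[abs_def] by (rule laplacian_mult[OF sc sd])
        also have "\<dots> = laplacian ?c x * ?d x + 2 * (\<Sum>i\<in>Basis. pd i ?c x * pd i ?d x)"
          using laplacian_dipole[OF e \<epsilon>(1) less_imp_le[OF x]] by (simp add: grad_inner_grad)
        finally have "\<bar>laplacian \<Phi> x\<bar> \<le> \<bar>laplacian ?c x * ?d x\<bar> + 2 * \<bar>\<Sum>i\<in>Basis. pd i ?c x * pd i ?d x\<bar>" by linarith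
        moreover have "\<bar>laplacian ?c x * ?d x\<bar> \<le> B2 * W0"
          unfolding abs_mult using B2 d WW by (intro mult_mono) auto
        moreover have "\<bar>\<Sum>i\<in>Basis. pd i ?c x * pd i ?d x\<bar> \<le> ?N * (B1 * ((1 + ?N) * W0))"
        proof -
          have "\<bar>\<Sum>i\<in>Basis. pd i ?c x * pd i ?d x\<bar> \<le> (\<Sum>i\<in>Basis. \<bar>pd i ?c x * pd i ?d x\<bar>)" by (rule sum_abs)
          also have "\<dots> \<le> (\<Sum>i\<in>(Basis::'a set). B1 * ((1 + ?N) * W0))"
          proof (rule sum_mono)
            fix i :: 'a assume i: "i \<in> Basis"
            have "\<bar>pd i ?d x\<bar> \<le> (1 + ?N) * W0"
              using dp[OF i] mult_left_mono[OF WW, of "1 + ?N"] by linarith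
            then show "\<bar>pd i ?c x * pd i ?d x\<bar> \<le> B1 * ((1 + ?N) * W0)"
              unfolding abs_mult using B1'[OF i] B1(1) by (intro mult_mono) auto
          qed
          finally show ?thesis by simp
        qed
        ultimately show ?thesis unfolding K2_def by linarith
      qed
      let ?w = "\<epsilon> powr (-1/4) * (norm (x - xbar) powr (- (?N - 1/4)) * indicator (ball xbar 1) x)"
      have "1 * W \<le> K * ?w" "K1 * W \<le> K * ?w"
        using K Wle W by (intro mult_mono; simp)+
      then show ?thesis using p1 p3 p4 K by (simp add: mult.assoc)
    qed
    \<comment> \<open>\<epsilon> is below \<open>\<rho> / 4\<close>, which is \<open>r / 2\<close>,
      so the disc of radius \<epsilon> lies where the cutoff is 1.\<close>
    have plane: "pd e \<Phi> x = reg xbar e \<epsilon> x powr (- ?N / 2 - 1) * ((?N - 1) * \<epsilon>\<^sup>2 - (norm (x - xbar))\<^sup>2)"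
      if x: "(x - xbar) \<bullet> e = 0" "norm (x - xbar) < \<epsilon>" for x
    proof -
      have xr: "norm (x - xbar) < r / 2" using x \<epsilon> by (simp add: r_def)
      show ?thesis
        unfolding pd\<Phi> cutoff_eq_1[OF r(1) xr] cutoff_locally_constant(1)[OF r(1) xr] pd_dipole_plane[OF e \<epsilon>(1) x(1)] by simp
    qed
    have nn: "0 \<le> pd e \<Phi> x" if x: "(x - xbar) \<bullet> e = 0" "norm (x - xbar) < \<epsilon>" for x
    proof -
      have "(norm (x - xbar))\<^sup>2 \<le> \<epsilon>\<^sup>2" using x(2) by (intro power_mono) auto
      also have "1 * \<epsilon>\<^sup>2 \<le> (?N - 1) * \<epsilon>\<^sup>2" using N by (intro mult_right_mono) auto
      finally show ?thesis unfolding plane[OF x] by (intro mult_nonneg_nonneg) auto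
    qed
    have low: "\<kappa> * \<epsilon> powr (- ?N) \<le> pd e \<Phi> x" if x: "(x - xbar) \<bullet> e = 0" "norm (x - xbar) \<le> \<epsilon> / 2" for x
    proof -
      have sq: "(norm (x - xbar))\<^sup>2 \<le> \<epsilon>\<^sup>2 / 4"
        using power_mono[OF x(2), of 2] by (simp add: power_divide)
      have reg: "reg xbar e \<epsilon> x = (norm (x - xbar))\<^sup>2 + \<epsilon>\<^sup>2"
        using reg_lower(4)[OF e \<epsilon>(1), of x xbar] x(1) by simp
      have "reg xbar e \<epsilon> x \<le> 2 * \<epsilon>\<^sup>2" unfolding reg using sq zero_le_power2[of \<epsilon>] by linarith
      then have "(2 * \<epsilon>\<^sup>2) powr (- ?N / 2 - 1) \<le> reg xbar e \<epsilon> x powr (- ?N / 2 - 1)"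
        using reg_pos[OF e \<epsilon>(1), of xbar x] by (intro powr_mono2') auto
      also have "(2 * \<epsilon>\<^sup>2) powr (- ?N / 2 - 1) = 2 powr (- ?N / 2 - 1) * \<epsilon> powr (- ?N - 2)"
        using \<epsilon>(1) by (simp add: powr_mult powr_powr algebra_simps flip: powr_numeral)
      finally have 1: "2 powr (- ?N / 2 - 1) * \<epsilon> powr (- ?N - 2) \<le> reg xbar e \<epsilon> x powr (- ?N / 2 - 1)" .
      have "1 * \<epsilon>\<^sup>2 \<le> (?N - 1) * \<epsilon>\<^sup>2" using N by (intro mult_right_mono) auto
      then have 2: "3/4 * \<epsilon>\<^sup>2 \<le> (?N - 1) * \<epsilon>\<^sup>2 - (norm (x - xbar))\<^sup>2" using sq by linarith
      have "\<kappa> * \<epsilon> powr (- ?N) = (2 powr (- ?N / 2 - 1) * \<epsilon> powr (- ?N - 2)) * (3/4 * \<epsilon>\<^sup>2)"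
        using \<epsilon>(1) by (simp add: \<kappa>_def powr_diff)
      also have "\<dots> \<le> reg xbar e \<epsilon> x powr (- ?N / 2 - 1) * ((?N - 1) * \<epsilon>\<^sup>2 - (norm (x - xbar))\<^sup>2)"
        using 1 2 by (intro mult_mono) auto
      also have "\<dots> = pd e \<Phi> x" using plane[OF x(1)] x(2) \<epsilon>(1) by simp
      finally show ?thesis .
    qed
    show ?thesis
      using s off main nn low unfolding r_def singular_test_def by (intro exI[of _ \<Phi>]) blast
  qed
  then show ?thesis using K(3) \<kappa> by blast
qed

lemma plane_integral_lower_bound:
  fixes xbar e :: "'a::euclidean_space" and \<psi> :: "'a \<Rightarrow> real"
  assumes e: "e \<in> Basis" and \<epsilon>: "0 < \<epsilon>" and m: "m \<ge> 0"
    and int: "integrable (plane_measure e) (\<lambda>x. \<psi> (pt e (xbar \<bullet> e) x))"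
    and nonneg: "\<And>y. y \<bullet> e = xbar \<bullet> e \<Longrightarrow> \<psi> y \<ge> 0"
    and lower: "\<And>y. y \<bullet> e = xbar \<bullet> e \<Longrightarrow> norm (y - xbar) \<le> \<epsilon> / 2 \<Longrightarrow> \<psi> y \<ge> m"
  shows "m * (\<epsilon> / real DIM('a)) ^ (DIM('a) - 1) \<le> (LINT x|plane_measure e. \<psi> (pt e (xbar \<bullet> e) x))"
proof -
  interpret product_sigma_finite "\<lambda>_::'a. lborel :: real measure" by standard
  let ?N = "real DIM('a)"
  \<comment> \<open>Half the side of a cube that fits into the ball of radius \<epsilon>/2, as the
    norm is at most the sum of the absolute coordinates.\<close>
  define \<delta> where "\<delta> = \<epsilon> / (2 * ?N)"
  have \<delta>: "\<delta> > 0" using \<epsilon> by (simp add: \<delta>_def)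
  define Q where "Q = Pi\<^sub>E (Basis - {e}) (\<lambda>b. {xbar \<bullet> b - \<delta> .. xbar \<bullet> b + \<delta>})"
  have Q: "Q \<in> sets (plane_measure e)" unfolding Q_def plane_measure_def by (intro sets_PiM_I_finite) auto
  have "emeasure (plane_measure e) Q = (\<Prod>b\<in>Basis - {e}. emeasure lborel {xbar \<bullet> b - \<delta> .. xbar \<bullet> b + \<delta>})"
    unfolding Q_def plane_measure_def by (intro emeasure_PiM) auto
  also have "\<dots> = ennreal ((\<epsilon> / ?N) ^ (DIM('a) - 1))"
    using \<delta> e by (simp add: card_Diff_singleton ennreal_power \<delta>_def)
  finally have eQ: "emeasure (plane_measure e) Q = ennreal ((\<epsilon> / ?N) ^ (DIM('a) - 1))" .
  have pos: "0 \<le> (\<epsilon> / ?N) ^ (DIM('a) - 1)" using \<epsilon> by simp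
  have mQ: "measure (plane_measure e) Q = (\<epsilon> / ?N) ^ (DIM('a) - 1)"
    unfolding measure_def eQ using pos by simp
  have "m * (\<epsilon> / ?N) ^ (DIM('a) - 1) = (LINT x|plane_measure e. m * indicator Q x)"
    using Q mQ by simp
  also have "\<dots> \<le> (LINT x|plane_measure e. \<psi> (pt e (xbar \<bullet> e) x))"
  proof (rule integral_mono[OF _ int])
    show "integrable (plane_measure e) (\<lambda>x. m * indicator Q x)"
      using Q eQ by (simp add: integrable_real_indicator)
    fix x
    let ?y = "pt e (xbar \<bullet> e) x"
    have ye: "?y \<bullet> e = xbar \<bullet> e" using e by (simp add: pt_inner)
    show "m * indicator Q x \<le> \<psi> ?y"
    proof (cases "x \<in> Q")
      case True
      have "\<bar>(?y - xbar) \<bullet> b\<bar> \<le> \<delta>" if b: "b \<in> Basis" for b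
      proof (cases "b = e")
        case True
        then show ?thesis using ye \<delta> by (simp add: inner_diff_left)
      next
        case False
        then have "x b \<in> {xbar \<bullet> b - \<delta> .. xbar \<bullet> b + \<delta>}" using \<open>x \<in> Q\<close> b by (auto simp: Q_def PiE_iff)
        then show ?thesis using False b e by (auto simp: inner_diff_left pt_inner abs_le_iff)
      qed
      then have "(\<Sum>b\<in>Basis. \<bar>(?y - xbar) \<bullet> b\<bar>) \<le> (\<Sum>b\<in>(Basis::'a set). \<delta>)" by (rule sum_mono)
      also have "\<dots> = \<epsilon> / 2" by (simp add: \<delta>_def)
      finally have "norm (?y - xbar) \<le> \<epsilon> / 2" using norm_le_l1[of "?y - xbar"] by linarith
      then show ?thesis using lower[OF ye] True by simp
    next
      case False
      then show ?thesis using nonneg[OF ye] by simp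
    qed
  qed
  finally show ?thesis .
qed

text \<open>\<open>D\<close> stands for the difference of the two primitives. At distance at least
  \<epsilon>, where the normal derivative of \<open>\<Phi>\<close> may be negative, the datum equals
  \<open>g1\<close> and \<open>D\<close> vanishes; closer in, both factors are nonnegative, and
  within \<epsilon>/2 both have lower bounds.\<close>

lemma peak_gain:
  fixes xbar e :: "'a::euclidean_space" and D h :: "_ \<Rightarrow> real"
  assumes e: "e \<in> Basis" and \<epsilon>: "0 < \<epsilon>" and c0: "c0 \<ge> 0" and m: "m \<ge> 0" and k: "k \<ge> 0"
    and \<Phi>: "smooth \<Phi>" "\<And>x. x \<notin> cball xbar R \<Longrightarrow> \<Phi> x = 0"
      "\<And>x. (x - xbar) \<bullet> e = 0 \<Longrightarrow> norm (x - xbar) < \<epsilon> \<Longrightarrow> 0 \<le> pd e \<Phi> x"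
      "\<And>x. (x - xbar) \<bullet> e = 0 \<Longrightarrow> norm (x - xbar) \<le> \<epsilon> / 2 \<Longrightarrow> k \<le> pd e \<Phi> x"
    and h: "continuous_on UNIV h" "\<And>x. g1 \<le> h x" "\<And>x. h x \<le> g2" "\<And>x. norm (x - xbar) \<ge> \<epsilon> \<Longrightarrow> h x = g1"
      "\<And>x. norm (x - xbar) \<le> \<epsilon> / 2 \<Longrightarrow> g1 + m \<le> h x"
    and D: "continuous_on UNIV D" "D g1 = 0" "\<And>s. g1 \<le> s \<Longrightarrow> s \<le> g2 \<Longrightarrow> c0 * (s - g1) \<le> D s"
  shows "c0 * m * k * (\<epsilon> / real DIM('a)) ^ (DIM('a) - 1)
    \<le> (LINT x|plane_measure e. D (h (pt e (xbar \<bullet> e) x)) * pd e \<Phi> (pt e (xbar \<bullet> e) x))"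
proof (rule plane_integral_lower_bound[OF e \<epsilon>])
  show "0 \<le> c0 * m * k" using c0 m k by simp
  have supp: "\<Phi> x = 0" if "norm x > norm xbar + \<bar>R\<bar>" for x
    by (rule \<Phi>(2)) (use norm_triangle_sub[of x xbar] that in \<open>auto simp: dist_norm norm_minus_commute\<close>)
  show "integrable (plane_measure e) (\<lambda>x. D (h (pt e (xbar \<bullet> e) x)) * pd e \<Phi> (pt e (xbar \<bullet> e) x))"
    by (rule integrable_plane_bounded_support[OF e, of "\<lambda>y. D (h y) * pd e \<Phi> y" "norm xbar + \<bar>R\<bar>"])
      (auto intro!: continuous_on_mult continuous_on_compose2[OF D(1) h(1)] smooth_continuous[OF smooth_pd[OF \<Phi>(1) e]]
        simp: pd_eq_0_outside_cball[OF supp])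
  fix y assume y: "y \<bullet> e = xbar \<bullet> e"
  then have y0: "(y - xbar) \<bullet> e = 0" by (simp add: inner_diff_left)
  have Dh: "c0 * (h y - g1) \<le> D (h y)" using D(3) h by blast
  have Dh0: "0 \<le> c0 * (h y - g1)" using c0 h(2)[of y] by simp
  show "0 \<le> D (h y) * pd e \<Phi> y"
  proof (cases "norm (y - xbar) < \<epsilon>")
    case True
    then show ?thesis using \<Phi>(3)[OF y0] Dh Dh0 by simp
  next
    case False
    then show ?thesis using h(4)[of y] D(2) by simp
  qed
  assume n: "norm (y - xbar) \<le> \<epsilon> / 2"
  have "c0 * m \<le> c0 * (h y - g1)" using c0 h(5)[OF n] by (intro mult_left_mono) auto
  then show "c0 * m * k \<le> D (h y) * pd e \<Phi> y"
    using \<Phi>(4)[OF y0 n] Dh Dh0 k by (intro mult_mono) auto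
qed

section \<open>The Neumann flux as a time integral\<close>

text \<open>Serves the coefficients, which are known to be continuous on their open domains:
  extended by zero they become Borel functions.\<close>

lemma measurable_compose_continuous_on:
  fixes F :: "'b::topological_space \<Rightarrow> real"
  assumes F: "continuous_on S F" and S: "S \<in> sets borel" and w: "w \<in> borel_measurable M"
    and in_S: "\<And>x. x \<in> space M \<Longrightarrow> w x \<in> S"
  shows "(\<lambda>x. F (w x)) \<in> borel_measurable M"
proof -
  have "(\<lambda>y. indicator S y *\<^sub>R F y) \<in> borel_measurable borel"
    by (rule borel_measurable_continuous_on_indicator[OF S F])
  from measurable_compose[OF w this] show ?thesis
    by (rule measurable_cong[THEN iffD1, rotated]) (simp add: in_S)
qed

lemma antiderivative_exists:
  fixes a :: "real \<Rightarrow> real"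
  assumes a: "continuous_on UNIV a"
  shows "\<exists>A. (\<forall>s. (A has_real_derivative a s) (at s)) \<and> A c = 0"
proof (intro exI conjI allI)
  fix s
  let ?l = "min c s - 1" and ?r = "max c s + 1"
  have "((\<lambda>u. LBINT y=c..u. a y) has_vector_derivative a s) (at s within {?l..?r})"
    by (rule interval_integral_FTC2) (use a in \<open>auto intro: continuous_on_subset\<close>)
  moreover have "at s within {?l..?r} = at s" by (rule at_within_interior) auto
  ultimately show "((\<lambda>u. LBINT y=c..u. a y) has_real_derivative a s) (at s)"
    by (simp add: has_real_derivative_iff_has_vector_derivative)
qed simp

definition flux_density where
  "flux_density T \<Omega> P u \<phi> t =
     (let \<mu> = lebesgue_on \<Omega>; Dx = spatial_grad T \<mu> (H1_grad \<Omega>) in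
        L2_inner \<mu> (\<lambda>x. coef_a P t (u t x) *\<^sub>R Dx u t x + coef_b P x t (u t x)) (Dx \<phi> t)
         + L2_inner \<mu> (\<lambda>x. coef_c P x t (u t x) (Dx u t x)) (\<phi> t)
         + L2_inner \<mu> (\<lambda>x. coef_d P t (u t x)) (time_deriv T \<mu> \<phi> t))"

lemma neumann_flux_eq: "neumann_flux T \<Omega> P u \<phi> = (LINT t|time T. flux_density T \<Omega> P u \<phi> t)"
  by (simp add: neumann_flux_def flux_density_def Let_def)

lemma L2X_spatial_grad: "u \<in> L2X T \<mu> R \<Longrightarrow> has_spatial_grad T \<mu> R u (spatial_grad T \<mu> R u)"
proof -
  assume "u \<in> L2X T \<mu> R"
  then obtain Du where "has_spatial_grad T \<mu> R u Du" by (auto simp: L2X_def)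
  then show ?thesis unfolding spatial_grad_def by (rule someI[of "has_spatial_grad T \<mu> R u"])
qed

context
  fixes \<Omega> :: "'a::euclidean_space set" and T C\<^sub>A C\<^sub>0 a_lo a_up :: real and P :: "'a pde_data"
    and g u :: "real \<Rightarrow> 'a \<Rightarrow> real" and \<eta> :: "real \<Rightarrow> real" and \<Phi> :: "'a \<Rightarrow> real"
  assumes \<Omega>: "open \<Omega>" "bounded \<Omega>" and a_lo: "a_lo > 0"
    and coeff: "coefficient_assumption T \<Omega> C\<^sub>A C\<^sub>0 a_lo a_up P"
    and sol: "weak_solution T \<Omega> P g u"
    and \<eta>: "smooth \<eta>" "\<eta> 0 = 0" "\<eta> T = 0" and \<Phi>: "smooth \<Phi>"
begin

private abbreviation (input) "mu \<equiv> lebesgue_on \<Omega>"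
private abbreviation (input) "Du \<equiv> spatial_grad T (lebesgue_on \<Omega>) (H1_grad \<Omega>) u"
private abbreviation (input) "phi \<equiv> (\<lambda>t x. \<eta> t * \<Phi> x)"
private abbreviation (input) "Dphi \<equiv> spatial_grad T (lebesgue_on \<Omega>) (H1_grad \<Omega>) (\<lambda>t x. \<eta> t * \<Phi> x)"
private abbreviation (input) "phi' \<equiv> time_deriv T (lebesgue_on \<Omega>) (\<lambda>t x. \<eta> t * \<Phi> x)"

lemma coefficient_continuous:
  "continuous_on ({0<..<T} \<times> UNIV) (\<lambda>(t, s). coef_a P t s)"
  "i \<in> Basis \<Longrightarrow> continuous_on (\<Omega> \<times> {0<..<T} \<times> UNIV) (\<lambda>(x, t, s). coef_b P x t s \<bullet> i)"
  "continuous_on (\<Omega> \<times> {0<..<T} \<times> UNIV \<times> UNIV) (\<lambda>(x, t, s, p). coef_c P x t s p)"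
  "continuous_on ({0<..<T} \<times> UNIV) (\<lambda>(t, s). coef_d P t s)"
  using coeff unfolding coefficient_assumption_def W1inf_le_def by blast+

lemma coefficient_bounds:
  assumes t: "t \<in> {0<..<T}"
  shows "\<bar>coef_a P t s\<bar> \<le> a_up"
    "x \<in> \<Omega> \<Longrightarrow> norm (coef_b P x t s) \<le> real DIM('a) * C\<^sub>A"
    "x \<in> \<Omega> \<Longrightarrow> \<bar>coef_c P x t s p\<bar> \<le> C\<^sub>A"
    "\<bar>coef_d P t s\<bar> \<le> C\<^sub>A"
proof -
  show "\<bar>coef_a P t s\<bar> \<le> a_up"
  proof -
    have "a_lo \<le> coef_a P t s \<and> coef_a P t s \<le> a_up" using coeff t unfolding coefficient_assumption_def by blast
    then show ?thesis using a_lo by linarith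
  qed
  have cd: "\<forall>z\<in>\<Omega> \<times> {0<..<T} \<times> UNIV \<times> UNIV. \<bar>case z of (x, t, s, p) \<Rightarrow> coef_c P x t s p\<bar> \<le> C\<^sub>A"
    "\<forall>z\<in>{0<..<T} \<times> UNIV. \<bar>case z of (t, s) \<Rightarrow> coef_d P t s\<bar> \<le> C\<^sub>A"
    using coeff unfolding coefficient_assumption_def W1inf_le_def by blast+
  show "\<bar>coef_d P t s\<bar> \<le> C\<^sub>A" using bspec[OF cd(2), of "(t, s)"] t by simp
  assume x: "x \<in> \<Omega>"
  show "\<bar>coef_c P x t s p\<bar> \<le> C\<^sub>A" using bspec[OF cd(1), of "(x, t, s, p)"] t x by simp
  have "\<bar>coef_b P x t s \<bullet> i\<bar> \<le> C\<^sub>A" if "i \<in> Basis" for i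
  proof -
    have "\<forall>z\<in>\<Omega> \<times> {0<..<T} \<times> UNIV. \<bar>case z of (x, t, s) \<Rightarrow> coef_b P x t s \<bullet> i\<bar> \<le> C\<^sub>A"
      using coeff that unfolding coefficient_assumption_def W1inf_le_def by blast
    from bspec[OF this, of "(x, t, s)"] show ?thesis using t x by simp
  qed
  then have "(\<Sum>i\<in>Basis. \<bar>coef_b P x t s \<bullet> i\<bar>) \<le> (\<Sum>i\<in>(Basis::'a set). C\<^sub>A)" by (rule sum_mono)
  then show "norm (coef_b P x t s) \<le> real DIM('a) * C\<^sub>A"
    using norm_le_l1[of "coef_b P x t s"] by simp
qed

lemma coef_a_continuous: "t \<in> {0<..<T} \<Longrightarrow> continuous_on UNIV (coef_a P t)"
proof -
  assume t: "t \<in> {0<..<T}"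
  have "continuous_on UNIV (\<lambda>s::real. (t, s))" by (intro continuous_intros)
  moreover have "(\<lambda>s::real. (t, s)) ` UNIV \<subseteq> {0<..<T} \<times> UNIV" using t by auto
  ultimately have "continuous_on UNIV (\<lambda>s. case (t, s) of (t, s) \<Rightarrow> coef_a P t s)"
    by (rule continuous_on_compose2[OF coefficient_continuous(1)])
  then show ?thesis by simp
qed

text \<open>The arguments \<open>\<tau>\<close> and \<open>\<xi>\<close> are arbitrary so as to cover both the space-time cylinder and a
  single time slice.\<close>

lemma coefficient_measurable:
  assumes [measurable]: "\<tau> \<in> borel_measurable M" "\<xi> \<in> borel_measurable M" "v \<in> borel_measurable M" "V \<in> borel_measurable M"
    and in_dom: "\<And>z. z \<in> space M \<Longrightarrow> \<tau> z \<in> {0<..<T}" "\<And>z. z \<in> space M \<Longrightarrow> \<xi> z \<in> \<Omega>"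
  shows "(\<lambda>z. coef_a P (\<tau> z) (v z)) \<in> borel_measurable M"
    "(\<lambda>z. coef_b P (\<xi> z) (\<tau> z) (v z)) \<in> borel_measurable M"
    "(\<lambda>z. coef_c P (\<xi> z) (\<tau> z) (v z) (V z)) \<in> borel_measurable M"
    "(\<lambda>z. coef_d P (\<tau> z) (v z)) \<in> borel_measurable M"
proof -
  have o: "{0<..<T} \<times> (UNIV :: real set) \<in> sets borel" "\<Omega> \<times> {0<..<T} \<times> (UNIV :: real set) \<in> sets borel"
    "\<Omega> \<times> {0<..<T} \<times> (UNIV :: real set) \<times> (UNIV :: 'a set) \<in> sets borel"
    using \<Omega>(1) by (auto intro!: borel_open open_Times)
  have "(\<lambda>z. (\<tau> z, v z)) \<in> borel_measurable M" "(\<lambda>z. (\<xi> z, \<tau> z, v z)) \<in> borel_measurable M"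
    "(\<lambda>z. (\<xi> z, \<tau> z, v z, V z)) \<in> borel_measurable M"
    by (intro borel_measurable_Pair assms)+
  note m = this
  show "(\<lambda>z. coef_a P (\<tau> z) (v z)) \<in> borel_measurable M"
    using measurable_compose_continuous_on[OF coefficient_continuous(1) o(1) m(1)] in_dom by simp
  show "(\<lambda>z. coef_d P (\<tau> z) (v z)) \<in> borel_measurable M"
    using measurable_compose_continuous_on[OF coefficient_continuous(4) o(1) m(1)] in_dom by simp
  show "(\<lambda>z. coef_c P (\<xi> z) (\<tau> z) (v z) (V z)) \<in> borel_measurable M"
    using measurable_compose_continuous_on[OF coefficient_continuous(3) o(3) m(3)] in_dom by simp
  have "(\<lambda>z. coef_b P (\<xi> z) (\<tau> z) (v z) \<bullet> i) \<in> borel_measurable M" if "i \<in> Basis" for i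
    using measurable_compose_continuous_on[OF coefficient_continuous(2)[OF that] o(2) m(2)] in_dom by simp
  then show "(\<lambda>z. coef_b P (\<xi> z) (\<tau> z) (v z)) \<in> borel_measurable M"
    by (subst borel_measurable_euclidean_space) auto
qed

lemma sol_spatial_grad: "has_spatial_grad T (lebesgue_on \<Omega>) (H1_grad \<Omega>) u Du"
  by (rule L2X_spatial_grad) (use sol in \<open>simp add: weak_solution_def Let_def\<close>)

lemma phi_spatial_grad: "has_spatial_grad T (lebesgue_on \<Omega>) (H1_grad \<Omega>) phi Dphi"
  by (rule L2X_spatial_grad)
    (use product_in_H10X[OF \<Omega> \<eta> \<Phi>] in \<open>simp add: H10X_def H1X_def\<close>)

lemma phi_time_deriv: "has_time_deriv T (lebesgue_on \<Omega>) phi phi'"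
  unfolding time_deriv_def
  by (rule someI[of "has_time_deriv T (lebesgue_on \<Omega>) (\<lambda>t x. \<eta> t * \<Phi> x)"]) (rule product_has_time_deriv[OF \<Omega> \<eta> \<Phi>])

text \<open>Bounded coefficients times products of square integrable functions on the cylinder, then
  Fubini. Integrability in time matters because the integral of a non-integrable function defaults
  to 0, which would void any comparison of two fluxes.\<close>

lemma flux_density_integrable: "integrable (time T) (flux_density T \<Omega> P u phi)"
proof -
  let ?M = "time T \<Otimes>\<^sub>M mu"
  interpret x: finite_measure mu by (rule finite_measure_open_bounded[OF \<Omega>])
  interpret t: finite_measure "time T" by (rule finite_measure_time)
  interpret Q: pair_sigma_finite "time T" mu ..
  have "finite_measure ?M" by (rule finite_measure_pair_measure) unfold_locales
  then interpret M: finite_measure ?M .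
  have L: "L2_fun ?M (\<lambda>(t, x). u t x)" "L2_fun ?M (\<lambda>(t, x). Du t x)" "L2_fun ?M (\<lambda>(t, x). phi t x)"
    "L2_fun ?M (\<lambda>(t, x). Dphi t x)" "L2_fun ?M (\<lambda>(t, x). phi' t x)"
    using sol_spatial_grad phi_spatial_grad phi_time_deriv by (auto simp: has_spatial_grad_def has_time_deriv_def)
  define U where "U z = u (fst z) (snd z)" for z
  define DU where "DU z = Du (fst z) (snd z)" for z
  define p where "p z = phi (fst z) (snd z)" for z
  define Dp where "Dp z = Dphi (fst z) (snd z)" for z
  define p' where "p' z = phi' (fst z) (snd z)" for z
  have L': "L2_fun ?M U" "L2_fun ?M DU" "L2_fun ?M p" "L2_fun ?M Dp" "L2_fun ?M p'"
    using L unfolding U_def[abs_def] DU_def[abs_def] p_def[abs_def] Dp_def[abs_def] p'_def[abs_def] by (simp_all add: case_prod_beta')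
  then have m[measurable]: "U \<in> borel_measurable ?M" "DU \<in> borel_measurable ?M" "p \<in> borel_measurable ?M"
    "Dp \<in> borel_measurable ?M" "p' \<in> borel_measurable ?M" and
    sq: "integrable ?M (\<lambda>z. (norm (DU z))\<^sup>2)" "integrable ?M (\<lambda>z. (norm (p z))\<^sup>2)"
    "integrable ?M (\<lambda>z. (norm (Dp z))\<^sup>2)" "integrable ?M (\<lambda>z. (norm (p' z))\<^sup>2)"
    by (auto simp: L2_fun_def)
  have id: "(\<lambda>y. y) \<in> borel_measurable (time T)" "(\<lambda>y. y) \<in> borel_measurable mu"
    by (auto intro!: continuous_measurable_lebesgue_on continuous_intros)
  have [measurable]: "fst \<in> borel_measurable ?M" "snd \<in> borel_measurable ?M"
    using measurable_compose[OF measurable_fst id(1)] measurable_compose[OF measurable_snd id(2)] by auto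
  have dom: "fst z \<in> {0<..<T}" "snd z \<in> \<Omega>" if "z \<in> space ?M" for z
    using that by (auto simp: space_pair_measure space_restrict_space)
  note cm[measurable] = coefficient_measurable[of fst ?M snd U DU, OF _ _ _ _ dom]
  define f1 where "f1 z = (coef_a P (fst z) (U z) *\<^sub>R DU z + coef_b P (snd z) (fst z) (U z)) \<bullet> Dp z" for z
  define f2 where "f2 z = coef_c P (snd z) (fst z) (U z) (DU z) \<bullet> p z" for z
  define f3 where "f3 z = coef_d P (fst z) (U z) \<bullet> p' z" for z
  have le_sq: "s \<le> 1 + s\<^sup>2" for s :: real
    using zero_le_power2[of "s - 1 / 2"] by (simp add: power2_eq_square algebra_simps)
  have i1: "integrable ?M f1"
  proof (rule Bochner_Integration.integrable_bound)
    let ?w = "\<lambda>z. \<bar>a_up\<bar> * ((norm (DU z))\<^sup>2 + (norm (Dp z))\<^sup>2) + real DIM('a) * \<bar>C\<^sub>A\<bar> * (1 + (norm (Dp z))\<^sup>2)"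
    show "integrable ?M ?w" using sq by auto
    show "f1 \<in> borel_measurable ?M" unfolding f1_def[abs_def] by measurable
    have "\<bar>f1 z\<bar> \<le> ?w z" if z: "z \<in> space ?M" for z
    proof -
      have "norm (coef_a P (fst z) (U z) *\<^sub>R DU z + coef_b P (snd z) (fst z) (U z)) \<le> \<bar>a_up\<bar> * norm (DU z) + real DIM('a) * \<bar>C\<^sub>A\<bar>"
      proof (rule order_trans[OF norm_triangle_ineq add_mono])
        show "norm (coef_a P (fst z) (U z) *\<^sub>R DU z) \<le> \<bar>a_up\<bar> * norm (DU z)"
          using coefficient_bounds(1)[OF dom(1)[OF z], of "U z"] by (simp add: mult_right_mono)
        have "norm (coef_b P (snd z) (fst z) (U z)) \<le> real DIM('a) * C\<^sub>A"
          by (rule coefficient_bounds(2)[OF dom(1)[OF z] dom(2)[OF z]])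
        also have "\<dots> \<le> real DIM('a) * \<bar>C\<^sub>A\<bar>" by (intro mult_left_mono) auto
        finally show "norm (coef_b P (snd z) (fst z) (U z)) \<le> real DIM('a) * \<bar>C\<^sub>A\<bar>" .
      qed
      from mult_right_mono[OF this norm_ge_zero[of "Dp z"]]
      have "\<bar>f1 z\<bar> \<le> (\<bar>a_up\<bar> * norm (DU z) + real DIM('a) * \<bar>C\<^sub>A\<bar>) * norm (Dp z)"
        unfolding f1_def using Cauchy_Schwarz_ineq2 order_trans by blast
      also have "\<dots> = \<bar>a_up\<bar> * (norm (DU z) * norm (Dp z)) + real DIM('a) * \<bar>C\<^sub>A\<bar> * norm (Dp z)"
        by (simp add: algebra_simps)
      also have "\<dots> \<le> ?w z"
      proof (intro add_mono mult_left_mono le_sq)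
        have "2 * (norm (DU z) * norm (Dp z)) \<le> (norm (DU z))\<^sup>2 + (norm (Dp z))\<^sup>2"
          using zero_le_power2[of "norm (DU z) - norm (Dp z)"] by (simp add: power2_eq_square algebra_simps)
        then show "norm (DU z) * norm (Dp z) \<le> (norm (DU z))\<^sup>2 + (norm (Dp z))\<^sup>2"
          using mult_nonneg_nonneg[OF norm_ge_zero[of "DU z"] norm_ge_zero[of "Dp z"]] by linarith
      qed auto
      finally show ?thesis .
    qed
    then show "AE z in ?M. norm (f1 z) \<le> norm (?w z)" by (auto intro!: AE_I2 elim: order_trans)
  qed
  have i23: "integrable ?M (\<lambda>z. k z \<bullet> q z)"
    if [measurable]: "k \<in> borel_measurable ?M" "q \<in> borel_measurable ?M" and k: "\<And>z. z \<in> space ?M \<Longrightarrow> \<bar>k z\<bar> \<le> C\<^sub>A"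
      and q: "integrable ?M (\<lambda>z. (norm (q z))\<^sup>2)" for k q :: "_ \<Rightarrow> real"
  proof (rule Bochner_Integration.integrable_bound)
    show "integrable ?M (\<lambda>z. \<bar>C\<^sub>A\<bar> * (1 + (norm (q z))\<^sup>2))" using q by auto
    have "\<bar>k z \<bullet> q z\<bar> \<le> \<bar>C\<^sub>A\<bar> * (1 + (norm (q z))\<^sup>2)" if z: "z \<in> space ?M" for z
      unfolding inner_real_def abs_mult using k[OF z] le_sq[of "\<bar>q z\<bar>"] by (intro mult_mono) auto
    then show "AE z in ?M. norm (k z \<bullet> q z) \<le> norm (\<bar>C\<^sub>A\<bar> * (1 + (norm (q z))\<^sup>2))"
      by (auto intro!: AE_I2 elim: order_trans)
  qed measurable
  have i2: "integrable ?M f2" unfolding f2_def[abs_def]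
    by (rule i23) (use coefficient_bounds(3)[OF dom(1) dom(2)] sq in auto)
  have i3: "integrable ?M f3" unfolding f3_def[abs_def]
    by (rule i23) (use coefficient_bounds(4)[OF dom(1)] sq in auto)
  have "integrable (time T) (\<lambda>t. (LINT x|mu. f1 (t, x)) + (LINT x|mu. f2 (t, x)) + (LINT x|mu. f3 (t, x)))"
    by (intro Bochner_Integration.integrable_add Q.integrable_fst' i1 i2 i3)
  moreover have "(\<lambda>t. (LINT x|mu. f1 (t, x)) + (LINT x|mu. f2 (t, x)) + (LINT x|mu. f3 (t, x))) = flux_density T \<Omega> P u phi"
    by (simp add: fun_eq_iff flux_density_def Let_def L2_inner_def f1_def f2_def f3_def U_def DU_def p_def Dp_def p'_def)
  ultimately show ?thesis by simp
qed

text \<open>The principal part is rewritten by \<open>trace_Green\<close> on each time slice, and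
  the other three terms are estimated by the bounds on the coefficients. The quantifier over
  \<open>A\<close> stands inside the almost everywhere quantifier, so that the primitive may be
  chosen separately on each slice.\<close>

lemma flux_density_formula:
  assumes e: "e \<in> Basis"
    and half: "\<forall>y\<in>ball xbar \<rho>. y \<in> \<Omega> \<longleftrightarrow> y \<bullet> e < c"
    and front: "\<forall>y\<in>ball xbar \<rho>. y \<bullet> e = c \<longrightarrow> y \<in> frontier \<Omega>"
    and nz: "emeasure (surface \<Omega>) \<Gamma> \<noteq> 0" and fin: "finite_measure (surface \<Omega>)"
    and supp: "\<rho>' < \<rho>" "\<forall>x. x \<notin> cball xbar \<rho>' \<longrightarrow> \<Phi> x = 0"
    and g: "\<forall>t. continuous_on UNIV (g t)"
  shows "AE t in time T. \<forall>A. (\<forall>s. (A has_real_derivative coef_a P t s) (at s)) \<longrightarrow>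
    \<bar>flux_density T \<Omega> P u phi t - \<eta> t * ((LINT x|plane_measure e. A (g t (pt e c x)) * pd e \<Phi> (pt e c x)) -
       (LINT x|mu. A (u t x) * laplacian \<Phi> x))\<bar>
    \<le> \<bar>\<eta> t\<bar> * (real DIM('a) * C\<^sub>A * (LINT x|mu. norm (grad \<Phi> x))) + (\<bar>\<eta> t\<bar> + \<bar>deriv \<eta> t\<bar>) * (C\<^sub>A * (LINT x|mu. \<bar>\<Phi> x\<bar>))"
proof -
  interpret x: finite_measure mu by (rule finite_measure_open_bounded[OF \<Omega>])
  have H: "AE t in time T. H1_grad \<Omega> (u t) (Du t)" using sol_spatial_grad by (simp add: has_spatial_grad_def)
  have tr: "AE t in time T. has_trace \<Omega> (u t) (g t)" using sol by (simp add: weak_solution_def Let_def)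
  have Mm: "(\<lambda>(t, x). Dphi t x) \<in> borel_measurable (time T \<Otimes>\<^sub>M mu)" "(\<lambda>(t, x). phi' t x) \<in> borel_measurable (time T \<Otimes>\<^sub>M mu)"
    using phi_spatial_grad phi_time_deriv by (auto simp: has_spatial_grad_def has_time_deriv_def L2_fun_def)
  show ?thesis
    using H tr product_spatial_grad[OF \<Omega> \<eta> \<Phi>] product_time_deriv[OF \<Omega> \<eta> \<Phi>] AE_space[of "time T"]
  proof eventually_elim
    case (elim t)
    have t: "t \<in> {0<..<T}" "t \<in> space (time T)" using elim(5) by (auto simp: space_restrict_space)
    have L2: "L2_fun mu (u t)" "L2_fun mu (Du t)" using elim(1) by (auto simp: H1_grad_def)
    have Dui: "integrable mu (Du t)" by (rule L2_fun_integrable[OF x.finite_measure_axioms L2(2)])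
    have um[measurable]: "u t \<in> borel_measurable mu" "Du t \<in> borel_measurable mu" using L2 by (auto simp: L2_fun_def)
    have pm[measurable]: "Dphi t \<in> borel_measurable mu" "phi' t \<in> borel_measurable mu"
      using measurable_compose[OF measurable_Pair1'[OF t(2)] Mm(1)] measurable_compose[OF measurable_Pair1'[OF t(2)] Mm(2)] by auto
    have gm[measurable]: "\<Phi> \<in> borel_measurable mu" "grad \<Phi> \<in> borel_measurable mu"
      by (auto intro!: continuous_measurable_lebesgue_on smooth_continuous[OF \<Phi>] smooth_continuous_grad[OF \<Phi>])
    have id: "(\<lambda>y. y) \<in> borel_measurable mu"
      by (auto intro!: continuous_measurable_lebesgue_on continuous_intros)
    have sp: "z \<in> \<Omega>" if "z \<in> space mu" for z using that by (simp add: space_restrict_space)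
    note cm[measurable] = coefficient_measurable[of "\<lambda>_. t" mu "\<lambda>y. y" "u t" "Du t", OF _ id um t(1) sp, OF borel_measurable_const]
    define a where "a = coef_a P t"
    define b where "b x = coef_b P x t (u t x)" for x
    define k where "k x = coef_c P x t (u t x) (Du t x)" for x
    define d where "d x = coef_d P t (u t x)" for x
    have [measurable]: "(\<lambda>x. a (u t x)) \<in> borel_measurable mu" "b \<in> borel_measurable mu" "k \<in> borel_measurable mu" "d \<in> borel_measurable mu"
      using cm unfolding a_def b_def[abs_def] k_def[abs_def] d_def[abs_def] by auto
    obtain Bg where Bg: "\<forall>x\<in>\<Omega>. norm (grad \<Phi> x) \<le> Bg"
      using continuous_bounded_on_bounded[OF smooth_continuous_grad[OF \<Phi>] \<Omega>(2)] by blast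
    have gi: "integrable mu (\<lambda>x. norm (grad \<Phi> x))" "integrable mu (\<lambda>x. \<bar>\<Phi> x\<bar>)"
      by (rule integrable_norm integrable_abs, rule L2_fun_integrable[OF x.finite_measure_axioms],
          rule L2_fun_continuous[OF \<Omega>], rule smooth_continuous[OF \<Phi>] smooth_continuous_grad[OF \<Phi>])+
    have i1: "integrable mu (\<lambda>x. a (u t x) * (Du t x \<bullet> grad \<Phi> x))"
    proof (rule Bochner_Integration.integrable_bound)
      show "integrable mu (\<lambda>x. \<bar>a_up\<bar> * \<bar>Bg\<bar> * norm (Du t x))" using Dui by auto
      have "\<bar>a (u t x) * (Du t x \<bullet> grad \<Phi> x)\<bar> \<le> \<bar>a_up\<bar> * (norm (Du t x) * \<bar>Bg\<bar>)" if "x \<in> space mu" for x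
      proof -
        have "norm (grad \<Phi> x) \<le> \<bar>Bg\<bar>" using Bg sp[OF that] by fastforce
        then have "\<bar>Du t x \<bullet> grad \<Phi> x\<bar> \<le> norm (Du t x) * \<bar>Bg\<bar>"
          using Cauchy_Schwarz_ineq2[of "Du t x" "grad \<Phi> x"] mult_left_mono[of "norm (grad \<Phi> x)" "\<bar>Bg\<bar>" "norm (Du t x)"] by force
        then show ?thesis unfolding abs_mult a_def using coefficient_bounds(1)[OF t(1), of "u t x"]
          by (intro mult_mono) auto
      qed
      then show "AE x in mu. norm (a (u t x) * (Du t x \<bullet> grad \<Phi> x)) \<le> norm (\<bar>a_up\<bar> * \<bar>Bg\<bar> * norm (Du t x))"
        by (auto intro!: AE_I2 simp: abs_mult mult_ac)
    qed measurable
    have bb: "\<bar>b x \<bullet> grad \<Phi> x\<bar> \<le> real DIM('a) * C\<^sub>A * norm (grad \<Phi> x)" if "x \<in> space mu" for x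
      using Cauchy_Schwarz_ineq2[of "b x" "grad \<Phi> x"]
        mult_right_mono[OF coefficient_bounds(2)[OF t(1) sp[OF that], of "u t x"] norm_ge_zero[of "grad \<Phi> x"]]
      unfolding b_def by linarith
    have ib: "integrable mu (\<lambda>x. b x \<bullet> grad \<Phi> x)"
    proof (rule Bochner_Integration.integrable_bound[of _ "\<lambda>x. real DIM('a) * C\<^sub>A * norm (grad \<Phi> x)"])
      show "AE x in mu. norm (b x \<bullet> grad \<Phi> x) \<le> norm (real DIM('a) * C\<^sub>A * norm (grad \<Phi> x))"
        using order_trans[OF bb abs_ge_self] by (intro AE_I2) simp
    qed (use gi in auto)
    have small: "\<bar>LINT x|mu. q x * \<Phi> x\<bar> \<le> C\<^sub>A * (LINT x|mu. \<bar>\<Phi> x\<bar>)"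
      if [measurable]: "q \<in> borel_measurable mu" and q: "\<And>x. x \<in> space mu \<Longrightarrow> \<bar>q x\<bar> \<le> C\<^sub>A" for q
    proof -
      have qb: "\<bar>q x * \<Phi> x\<bar> \<le> C\<^sub>A * \<bar>\<Phi> x\<bar>" if "x \<in> space mu" for x
        unfolding abs_mult by (rule mult_right_mono[OF q[OF that]]) simp
      have i: "integrable mu (\<lambda>x. C\<^sub>A * \<bar>\<Phi> x\<bar>)" by (rule integrable_mult_right) (rule gi(2))
      have "integrable mu (\<lambda>x. q x * \<Phi> x)"
      proof (rule Bochner_Integration.integrable_bound[OF i])
        show "AE x in mu. norm (q x * \<Phi> x) \<le> norm (C\<^sub>A * \<bar>\<Phi> x\<bar>)"
          using order_trans[OF qb abs_ge_self] by (intro AE_I2) simp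
      qed measurable
      then have "\<bar>LINT x|mu. q x * \<Phi> x\<bar> \<le> (LINT x|mu. C\<^sub>A * \<bar>\<Phi> x\<bar>)"
        by (rule integral_abs_bound_integral[OF _ i]) (rule qb)
      then show ?thesis by simp
    qed
    have I1: "L2_inner mu (\<lambda>x. coef_a P t (u t x) *\<^sub>R Du t x + coef_b P x t (u t x)) (Dphi t)
        = \<eta> t * (LINT x|mu. a (u t x) * (Du t x \<bullet> grad \<Phi> x)) + \<eta> t * (LINT x|mu. b x \<bullet> grad \<Phi> x)"
    proof -
      have "L2_inner mu (\<lambda>x. coef_a P t (u t x) *\<^sub>R Du t x + coef_b P x t (u t x)) (Dphi t)
         = (LINT x|mu. \<eta> t * (a (u t x) * (Du t x \<bullet> grad \<Phi> x)) + \<eta> t * (b x \<bullet> grad \<Phi> x))"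
        unfolding L2_inner_def a_def[symmetric] b_def[symmetric]
      proof (rule integral_cong_AE)
        show "AE x in mu. (a (u t x) *\<^sub>R Du t x + b x) \<bullet> Dphi t x = \<eta> t * (a (u t x) * (Du t x \<bullet> grad \<Phi> x)) + \<eta> t * (b x \<bullet> grad \<Phi> x)"
          using elim(3) by eventually_elim (simp add: inner_add_left algebra_simps)
      qed measurable
      also have "\<dots> = (LINT x|mu. \<eta> t * (a (u t x) * (Du t x \<bullet> grad \<Phi> x))) + (LINT x|mu. \<eta> t * (b x \<bullet> grad \<Phi> x))"
        by (rule Bochner_Integration.integral_add) (use i1 ib in auto)
      finally show ?thesis by simp
    qed
    have I2: "L2_inner mu (\<lambda>x. coef_c P x t (u t x) (Du t x)) (\<lambda>x. \<eta> t * \<Phi> x) = \<eta> t * (LINT x|mu. k x * \<Phi> x)"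
      unfolding L2_inner_def k_def by (simp add: mult_ac flip: integral_mult_right_zero)
    have I3: "L2_inner mu (\<lambda>x. coef_d P t (u t x)) (phi' t) = deriv \<eta> t * (LINT x|mu. d x * \<Phi> x)"
    proof -
      have "L2_inner mu (\<lambda>x. coef_d P t (u t x)) (phi' t) = (LINT x|mu. deriv \<eta> t * (d x * \<Phi> x))"
        unfolding L2_inner_def d_def[symmetric]
      proof (rule integral_cong_AE)
        show "AE x in mu. d x \<bullet> phi' t x = deriv \<eta> t * (d x * \<Phi> x)"
          using elim(4) by eventually_elim simp
      qed measurable
      then show ?thesis by simp
    qed
    \<comment> \<open>The chosen derivatives of the test function have been replaced by the explicit
      ones, so that the time factors come out of the space integrals.\<close>
    have fd: "flux_density T \<Omega> P u phi t = \<eta> t * (LINT x|mu. a (u t x) * (Du t x \<bullet> grad \<Phi> x))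
       + \<eta> t * (LINT x|mu. b x \<bullet> grad \<Phi> x) + \<eta> t * (LINT x|mu. k x * \<Phi> x) + deriv \<eta> t * (LINT x|mu. d x * \<Phi> x)"
      unfolding flux_density_def Let_def I1 I2 I3 by simp
    have e1: "\<bar>LINT x|mu. b x \<bullet> grad \<Phi> x\<bar> \<le> real DIM('a) * C\<^sub>A * (LINT x|mu. norm (grad \<Phi> x))"
    proof -
      have "\<bar>LINT x|mu. b x \<bullet> grad \<Phi> x\<bar> \<le> (LINT x|mu. real DIM('a) * C\<^sub>A * norm (grad \<Phi> x))"
        by (rule integral_abs_bound_integral) (use ib gi bb in auto)
      then show ?thesis by simp
    qed
    have e2: "\<bar>LINT x|mu. k x * \<Phi> x\<bar> \<le> C\<^sub>A * (LINT x|mu. \<bar>\<Phi> x\<bar>)"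
      by (rule small) (use coefficient_bounds(3)[OF t(1) sp] in \<open>auto simp: k_def\<close>)
    have e3: "\<bar>LINT x|mu. d x * \<Phi> x\<bar> \<le> C\<^sub>A * (LINT x|mu. \<bar>\<Phi> x\<bar>)"
      by (rule small) (use coefficient_bounds(4)[OF t(1)] in \<open>auto simp: d_def\<close>)
    show ?case
    proof (intro allI impI)
      fix A :: "real \<Rightarrow> real" assume A: "\<forall>s. (A has_real_derivative coef_a P t s) (at s)"
      have Gr: "(LINT x|mu. a (u t x) * (Du t x \<bullet> grad \<Phi> x)) =
         (LINT x|plane_measure e. A (g t (pt e c x)) * pd e \<Phi> (pt e c x)) - (LINT x|mu. A (u t x) * laplacian \<Phi> x)"
        by (rule trace_Green[OF \<Omega> e half[rule_format] front[rule_format] nz fin \<Phi> supp(1) supp(2)[rule_format] _ _ _ elim(2) g[rule_format] elim(1)])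
          (use A coef_a_continuous[OF t(1)] coefficient_bounds(1)[OF t(1)] in \<open>auto simp: a_def\<close>)
      let ?p = "(LINT x|plane_measure e. A (g t (pt e c x)) * pd e \<Phi> (pt e c x)) - (LINT x|mu. A (u t x) * laplacian \<Phi> x)"
      have "flux_density T \<Omega> P u phi t - \<eta> t * ?p = \<eta> t * (LINT x|mu. b x \<bullet> grad \<Phi> x) + (\<eta> t * (LINT x|mu. k x * \<Phi> x) + deriv \<eta> t * (LINT x|mu. d x * \<Phi> x))"
        unfolding fd Gr by simp
      also have "\<bar>\<dots>\<bar> \<le> \<bar>\<eta> t * (LINT x|mu. b x \<bullet> grad \<Phi> x)\<bar> + (\<bar>\<eta> t * (LINT x|mu. k x * \<Phi> x)\<bar> + \<bar>deriv \<eta> t * (LINT x|mu. d x * \<Phi> x)\<bar>)"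
        by linarith
      also have "\<dots> \<le> \<bar>\<eta> t\<bar> * (real DIM('a) * C\<^sub>A * (LINT x|mu. norm (grad \<Phi> x)))
         + (\<bar>\<eta> t\<bar> * (C\<^sub>A * (LINT x|mu. \<bar>\<Phi> x\<bar>)) + \<bar>deriv \<eta> t\<bar> * (C\<^sub>A * (LINT x|mu. \<bar>\<Phi> x\<bar>)))"
        unfolding abs_mult by (intro add_mono mult_left_mono e1 e2 e3) auto
      finally show "\<bar>flux_density T \<Omega> P u phi t - \<eta> t * ?p\<bar>
        \<le> \<bar>\<eta> t\<bar> * (real DIM('a) * C\<^sub>A * (LINT x|mu. norm (grad \<Phi> x))) + (\<bar>\<eta> t\<bar> + \<bar>deriv \<eta> t\<bar>) * (C\<^sub>A * (LINT x|mu. \<bar>\<Phi> x\<bar>))"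
        by (simp add: distrib_right)
    qed
  qed
qed

end

section \<open>Separating the fluxes by peaked boundary data\<close>

text \<open>By |s| \<le> 1 + s^2. The L^1 norm is the one required, since primitives of bounded
  functions grow at most linearly; the bound depends on the solution only through
  \<open>C\<^sub>U\<close>.\<close>

lemma solution_L1_bound:
  fixes \<Omega> :: "'a::euclidean_space set"
  assumes \<Omega>: "open \<Omega>" "bounded \<Omega>" and u: "u \<in> L2X T (lebesgue_on \<Omega>) (H1_grad \<Omega>)"
    and C_U: "L2X_norm T (lebesgue_on \<Omega>) (H1_grad \<Omega>) u \<le> C\<^sub>U"
  shows "integrable (time T) (\<lambda>t. LINT x|lebesgue_on \<Omega>. \<bar>u t x\<bar>)"
    "AE t in time T. integrable (lebesgue_on \<Omega>) (u t)"
    "(LINT t|time T. LINT x|lebesgue_on \<Omega>. \<bar>u t x\<bar>) \<le> (LINT t|time T. LINT x|lebesgue_on \<Omega>. 1) + C\<^sub>U\<^sup>2"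
proof -
  let ?\<mu> = "lebesgue_on \<Omega>"
  let ?M = "time T \<Otimes>\<^sub>M ?\<mu>" and ?Du = "spatial_grad T ?\<mu> (H1_grad \<Omega>) u"
  interpret x: finite_measure ?\<mu> by (rule finite_measure_open_bounded[OF \<Omega>])
  interpret t: finite_measure "time T" by (rule finite_measure_time)
  interpret Q: pair_sigma_finite "time T" ?\<mu> ..
  have M: "finite_measure ?M" by (rule finite_measure_pair_measure) unfold_locales
  have "has_spatial_grad T ?\<mu> (H1_grad \<Omega>) u ?Du" by (rule L2X_spatial_grad[OF u])
  then have L: "L2_fun ?M (\<lambda>z. u (fst z) (snd z))" "L2_fun ?M (\<lambda>z. ?Du (fst z) (snd z))"
    by (simp_all add: has_spatial_grad_def case_prod_beta')
  note i = L2_fun_integrable[OF M L(1)]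
  have sq: "integrable ?M (\<lambda>z. (u (fst z) (snd z))\<^sup>2)" "integrable ?M (\<lambda>z. (norm (?Du (fst z) (snd z)))\<^sup>2)"
    using L by (simp_all add: L2_fun_def)
  show int: "integrable (time T) (\<lambda>t. LINT x|?\<mu>. \<bar>u t x\<bar>)"
    using Q.integrable_fst'[OF integrable_abs[OF i]] by simp
  have int2: "integrable (time T) (\<lambda>t. LINT x|?\<mu>. (u t x)\<^sup>2)" "integrable (time T) (\<lambda>t. LINT x|?\<mu>. (norm (?Du t x))\<^sup>2)"
    using Q.integrable_fst'[OF sq(1)] Q.integrable_fst'[OF sq(2)] by simp_all
  show ae: "AE t in time T. integrable ?\<mu> (u t)" using Q.AE_integrable_fst'[OF i] by simp
  have norm_sq: "(L2_norm ?\<mu> v)\<^sup>2 = (LINT x|?\<mu>. (norm (v x))\<^sup>2)" for v :: "'a \<Rightarrow> 'b::euclidean_space"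
    unfolding L2_norm_def L2_inner_def by (simp add: power2_norm_eq_inner)
  have nn: "0 \<le> (LINT t|time T. (LINT x|?\<mu>. (u t x)\<^sup>2) + (LINT x|?\<mu>. (norm (?Du t x))\<^sup>2))"
    by (intro integral_nonneg_AE AE_I2 add_nonneg_nonneg Bochner_Integration.integral_nonneg) auto
  have nr: "L2X_norm T ?\<mu> (H1_grad \<Omega>) u = sqrt (LINT t|time T. (LINT x|?\<mu>. (u t x)\<^sup>2) + (LINT x|?\<mu>. (norm (?Du t x))\<^sup>2))"
    unfolding L2X_norm_def norm_sq by simp
  have "(LINT t|time T. LINT x|?\<mu>. (u t x)\<^sup>2) \<le> (LINT t|time T. (LINT x|?\<mu>. (u t x)\<^sup>2) + (LINT x|?\<mu>. (norm (?Du t x))\<^sup>2))"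
    by (rule integral_mono[OF int2(1) Bochner_Integration.integrable_add[OF int2]])
      (simp add: Bochner_Integration.integral_nonneg)
  also have "\<dots> = (L2X_norm T ?\<mu> (H1_grad \<Omega>) u)\<^sup>2" unfolding nr using nn by simp
  also have "\<dots> \<le> C\<^sub>U\<^sup>2" by (rule power_mono[OF C_U]) (simp add: nr nn)
  finally have U2: "(LINT t|time T. LINT x|?\<mu>. (u t x)\<^sup>2) \<le> C\<^sub>U\<^sup>2" .
  have "(LINT t|time T. LINT x|?\<mu>. \<bar>u t x\<bar>) \<le> (LINT t|time T. (LINT x|?\<mu>. 1) + (LINT x|?\<mu>. (u t x)\<^sup>2))"
  proof (rule integral_mono_AE[OF int])
    show "integrable (time T) (\<lambda>t. (LINT x|?\<mu>. 1) + (LINT x|?\<mu>. (u t x)\<^sup>2))" using int2 by auto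
    show "AE t in time T. (LINT x|?\<mu>. \<bar>u t x\<bar>) \<le> (LINT x|?\<mu>. 1) + (LINT x|?\<mu>. (u t x)\<^sup>2)"
      using ae Q.AE_integrable_fst'[OF sq(1)]
    proof eventually_elim
      case (elim t)
      have le: "\<bar>s\<bar> \<le> 1 + s\<^sup>2" for s :: real
        using zero_le_power2[of "\<bar>s\<bar> - 1 / 2"] by (simp add: power2_eq_square algebra_simps)
      have "(LINT x|?\<mu>. \<bar>u t x\<bar>) \<le> (LINT x|?\<mu>. 1 + (u t x)\<^sup>2)"
        by (rule integral_mono) (use elim le in auto)
      also have "\<dots> = (LINT x|?\<mu>. 1) + (LINT x|?\<mu>. (u t x)\<^sup>2)" using elim by (simp add: Bochner_Integration.integral_add)
      finally show ?case .
    qed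
  qed
  also have "\<dots> = (LINT t|time T. LINT x|?\<mu>. 1) + (LINT t|time T. LINT x|?\<mu>. (u t x)\<^sup>2)"
    using int2(1) by (subst Bochner_Integration.integral_add) auto
  finally show "(LINT t|time T. LINT x|?\<mu>. \<bar>u t x\<bar>) \<le> (LINT t|time T. LINT x|?\<mu>. 1) + C\<^sub>U\<^sup>2" using U2 by linarith
qed

text \<open>Completing the square; the bound T^2/4 is what the factor 4/T^2 in the height of
  \<open>peak_data\<close> compensates.\<close>

lemma time_cutoff_bounds:
  assumes "0 \<le> t1" "t1 < t2" "t2 \<le> T"
  shows "0 \<le> time_cutoff t1 t2 t" "time_cutoff t1 t2 t \<le> T\<^sup>2 / 4" "t \<notin> {t1<..<t2} \<Longrightarrow> time_cutoff t1 t2 t = 0"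
proof -
  show "0 \<le> time_cutoff t1 t2 t" by (simp add: time_cutoff_def)
  have "4 * ((t - t1) * (t2 - t)) = (t2 - t1)\<^sup>2 - (2 * t - t1 - t2)\<^sup>2"
    by (simp add: power2_eq_square algebra_simps)
  also have "\<dots> \<le> (t2 - t1)\<^sup>2" by simp
  also have "\<dots> \<le> T\<^sup>2" using assms by (intro power_mono) auto
  finally show "time_cutoff t1 t2 t \<le> T\<^sup>2 / 4" by (simp add: time_cutoff_def max_def)
  assume "t \<notin> {t1<..<t2}"
  then have "(t - t1) * (t2 - t) \<le> 0" using assms by (auto simp: mult_le_0_iff)
  then show "time_cutoff t1 t2 t = 0" by (simp add: time_cutoff_def)
qed

lemma space_cutoff_eq:
  assumes "0 < \<epsilon>"
  shows "space_cutoff xbar \<epsilon> x = max 0 (min 1 (2 - 2 * norm (x - xbar) / \<epsilon>))"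
  using assms by (auto simp: space_cutoff_def max_def min_def field_simps)

text \<open>The normalisation of \<open>\<gamma>\<close> keeps the peak below \<open>g2\<close>: the
  time cutoff is at most T^2/4, and for N \<le> 3 the power of \<epsilon> is largest at
  \<open>\<epsilon>0\<close>, where its product with the minimum in \<open>\<gamma>\<close> is still
  at most 1.\<close>

lemma peak_data_properties:
  fixes xbar :: "'a::euclidean_space"
  assumes T: "0 < T" and t12: "0 \<le> t1" "t1 < t2" "t2 \<le> T" and g12: "g1 < g2" and \<epsilon>: "0 < \<epsilon>" "\<epsilon> \<le> \<epsilon>0"
    and N: "DIM('a) \<le> 3"
  defines "\<gamma> \<equiv> 4 * (g2 - g1) * min 1 (\<epsilon>0 powr ((real DIM('a) - 3) / 2)) / T\<^sup>2"
  defines "h \<equiv> peak_data T xbar \<epsilon>0 t1 t2 g1 g2 \<epsilon>"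
  shows "continuous_on UNIV (h t)" "g1 \<le> h t x" "h t x \<le> g2" "\<epsilon> \<le> norm (x - xbar) \<Longrightarrow> h t x = g1"
    "norm (x - xbar) \<le> \<epsilon> / 2 \<Longrightarrow> h t x = g1 + \<gamma> * \<epsilon> powr ((3 - real DIM('a)) / 2) * time_cutoff t1 t2 t"
    "t \<notin> {t1<..<t2} \<Longrightarrow> h t x = g1"
proof -
  let ?p = "\<epsilon> powr ((3 - real DIM('a)) / 2)"
  have h: "h t x = g1 + \<gamma> * ?p * space_cutoff xbar \<epsilon> x * time_cutoff t1 t2 t" for t x
    unfolding h_def peak_data_def \<gamma>_def Let_def ..
  note tc = time_cutoff_bounds[OF t12]
  have sc: "0 \<le> space_cutoff xbar \<epsilon> x" "space_cutoff xbar \<epsilon> x \<le> 1" for x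
    unfolding space_cutoff_eq[OF \<epsilon>(1)] by auto
  have \<gamma>: "\<gamma> \<ge> 0" using g12 by (simp add: \<gamma>_def)
  show "continuous_on UNIV (h t)"
    unfolding h space_cutoff_eq[OF \<epsilon>(1)] using \<epsilon>(1) by (intro continuous_intros) auto
  show "g1 \<le> h t x" unfolding h using \<gamma> sc tc by simp
  show "h t x = g1" if "\<epsilon> \<le> norm (x - xbar)" unfolding h using that \<epsilon>(1) by (simp add: space_cutoff_def)
  show "h t x = g1 + \<gamma> * ?p * time_cutoff t1 t2 t" if "norm (x - xbar) \<le> \<epsilon> / 2"
    unfolding h using that by (simp add: space_cutoff_def)
  show "t \<notin> {t1<..<t2} \<Longrightarrow> h t x = g1" unfolding h using tc(3) by simp
  have "min 1 (\<epsilon>0 powr ((real DIM('a) - 3) / 2)) * ?p \<le> \<epsilon>0 powr ((real DIM('a) - 3) / 2) * \<epsilon>0 powr ((3 - real DIM('a)) / 2)"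
    using \<epsilon> N by (intro mult_mono powr_mono2) auto
  also have "\<dots> = \<epsilon>0 powr 0" unfolding powr_add[symmetric] by (simp add: field_simps)
  finally have m1: "min 1 (\<epsilon>0 powr ((real DIM('a) - 3) / 2)) * ?p \<le> 1" using \<epsilon> by simp
  have "\<gamma> * ?p * space_cutoff xbar \<epsilon> x * time_cutoff t1 t2 t \<le> \<gamma> * ?p * 1 * (T\<^sup>2 / 4)"
    using \<gamma> sc tc by (intro mult_mono) auto
  also have "\<dots> = (g2 - g1) * (min 1 (\<epsilon>0 powr ((real DIM('a) - 3) / 2)) * ?p)"
    using T by (simp add: \<gamma>_def)
  also have "\<dots> \<le> (g2 - g1) * 1" using m1 g12 by (intro mult_left_mono) auto
  finally show "h t x \<le> g2" unfolding h by simp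
qed

text \<open>The first term is the gain at the boundary, the second bounds the volume integrals of
  the primitives against the Laplacian, the third the terms with \<open>b\<close>, \<open>c\<close>
  and \<open>d\<close> of both problems. The gap between the coefficients is assumed just for the
  times and values that the peak takes.\<close>

lemma flux_gap:
  fixes \<Omega> :: "'a::euclidean_space set" and h :: "real \<Rightarrow> 'a \<Rightarrow> real"
  assumes \<Omega>: "open \<Omega>" "bounded \<Omega>" and a_lo: "a_lo > 0" and T: "T > 0"
    and coeff: "coefficient_assumption T \<Omega> C\<^sub>A C\<^sub>0 a_lo a_up P\<^sub>1" "coefficient_assumption T \<Omega> C\<^sub>A C\<^sub>0 a_lo a_up P\<^sub>2"
    and sol: "weak_solution T \<Omega> P\<^sub>1 h v\<^sub>1" "weak_solution T \<Omega> P\<^sub>2 h v\<^sub>2"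
    and C_U: "L2X_norm T (lebesgue_on \<Omega>) (H1_grad \<Omega>) v\<^sub>1 \<le> C\<^sub>U" "L2X_norm T (lebesgue_on \<Omega>) (H1_grad \<Omega>) v\<^sub>2 \<le> C\<^sub>U"
    and e: "e \<in> Basis"
    and half: "\<And>y. y \<in> ball xbar \<rho> \<Longrightarrow> y \<in> \<Omega> \<longleftrightarrow> y \<bullet> e < xbar \<bullet> e"
    and front: "\<And>y. y \<in> ball xbar \<rho> \<Longrightarrow> y \<bullet> e = xbar \<bullet> e \<Longrightarrow> y \<in> frontier \<Omega>"
    and nz: "emeasure (surface \<Omega>) \<Gamma> \<noteq> 0" and fin: "finite_measure (surface \<Omega>)"
    and \<Phi>: "smooth \<Phi>" "\<rho>' < \<rho>" "\<And>x. x \<notin> cball xbar \<rho>' \<Longrightarrow> \<Phi> x = 0"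
      "\<And>x. (x - xbar) \<bullet> e = 0 \<Longrightarrow> norm (x - xbar) < \<epsilon> \<Longrightarrow> 0 \<le> pd e \<Phi> x"
      "\<And>x. (x - xbar) \<bullet> e = 0 \<Longrightarrow> norm (x - xbar) \<le> \<epsilon> / 2 \<Longrightarrow> k \<le> pd e \<Phi> x"
      "\<And>x. x \<in> \<Omega> \<Longrightarrow> \<bar>laplacian \<Phi> x\<bar> \<le> K"
    and pos: "0 < \<epsilon>" "0 \<le> c0" "0 \<le> m" "0 \<le> k" "0 \<le> K" "C\<^sub>A > 0"
    and t12: "0 \<le> t1" "t1 < t2" "t2 \<le> T"
    and h: "\<And>t. continuous_on UNIV (h t)" "\<And>t x. g1 \<le> h t x" "\<And>t x. h t x \<le> g2"
      "\<And>t x. \<epsilon> \<le> norm (x - xbar) \<Longrightarrow> h t x = g1"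
      "\<And>t x. norm (x - xbar) \<le> \<epsilon> / 2 \<Longrightarrow> h t x = g1 + m * time_cutoff t1 t2 t"
      "\<And>t x. t \<notin> {t1<..<t2} \<Longrightarrow> h t x = g1"
    and gap: "\<And>t s. t1 < t \<Longrightarrow> t < t2 \<Longrightarrow> g1 \<le> s \<Longrightarrow> s \<le> g2 \<Longrightarrow> c0 \<le> coef_a P\<^sub>1 t s - coef_a P\<^sub>2 t s"
  shows "c0 * m * k * (\<epsilon> / real DIM('a)) ^ (DIM('a) - 1) * (LINT t|time T. t * (T - t) * time_cutoff t1 t2 t)
     - T\<^sup>2 * (K * a_up * (2 * ((LINT t|time T. LINT x|lebesgue_on \<Omega>. 1) + C\<^sub>U\<^sup>2) + T * (2 * \<bar>g1\<bar> * (LINT x|lebesgue_on \<Omega>. 1))))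
     - T * (2 * (T\<^sup>2 * (real DIM('a) * C\<^sub>A * (LINT x|lebesgue_on \<Omega>. norm (grad \<Phi> x))) + (T\<^sup>2 + T) * (C\<^sub>A * (LINT x|lebesgue_on \<Omega>. \<bar>\<Phi> x\<bar>))))
    \<le> neumann_flux T \<Omega> P\<^sub>1 v\<^sub>1 (\<lambda>t x. t * (T - t) * \<Phi> x) - neumann_flux T \<Omega> P\<^sub>2 v\<^sub>2 (\<lambda>t x. t * (T - t) * \<Phi> x)"
proof -
  let ?\<mu> = "lebesgue_on \<Omega>" and ?N = "real DIM('a)"
  \<comment> \<open>Time factor of the test function: zero at both end points, as
    \<open>H10X\<close> demands, positive in between, at most T^2 there, with derivative at most T
    in absolute value.\<close>
  define \<eta> where "\<eta> t = t * (T - t)" for t :: real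
  define tc where "tc = time_cutoff t1 t2"
  note tcb = time_cutoff_bounds[OF t12, folded tc_def]
  have \<eta>: "smooth \<eta>" "\<eta> 0 = 0" "\<eta> T = 0"
    using smooth_mult[OF smooth_inner_right[of "1::real"] smooth_diff[OF smooth_const smooth_inner_right[of "1::real"]], of T]
    by (simp_all add: \<eta>_def[abs_def])
  have "(\<eta> has_real_derivative T - 2 * t) (at t)" for t
    unfolding \<eta>_def[abs_def] by (auto intro!: derivative_eq_intros)
  then have d\<eta>: "deriv \<eta> t = T - 2 * t" for t by (rule DERIV_imp_deriv)
  define V where "V = (LINT x|?\<mu>. 1::real)"
  define X where "X = (LINT x|?\<mu>. norm (grad \<Phi> x))"
  define Y where "Y = (LINT x|?\<mu>. \<bar>\<Phi> x\<bar>)"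
  have XY: "X \<ge> 0" "Y \<ge> 0" by (auto simp: X_def Y_def)
  define w1 where "w1 t = (LINT x|?\<mu>. \<bar>v\<^sub>1 t x\<bar>)" for t
  define w2 where "w2 t = (LINT x|?\<mu>. \<bar>v\<^sub>2 t x\<bar>)" for t
  interpret x: finite_measure ?\<mu> by (rule finite_measure_open_bounded[OF \<Omega>])
  interpret t: finite_measure "time T" by (rule finite_measure_time)
  have inL: "v\<^sub>1 \<in> L2X T ?\<mu> (H1_grad \<Omega>)" "v\<^sub>2 \<in> L2X T ?\<mu> (H1_grad \<Omega>)"
    using sol by (auto simp: weak_solution_def Let_def)
  note b1 = solution_L1_bound[OF \<Omega> inL(1) C_U(1), folded V_def w1_def]
  note b2 = solution_L1_bound[OF \<Omega> inL(2) C_U(2), folded V_def w2_def]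
  define phi where "phi = (\<lambda>t x. \<eta> t * \<Phi> x)"
  define G where "G = c0 * m * k * (\<epsilon> / ?N) ^ (DIM('a) - 1)"
  define E where "E = T\<^sup>2 * (?N * C\<^sub>A * X) + (T\<^sup>2 + T) * (C\<^sub>A * Y)"
  \<comment> \<open>A minorant of the density difference that is free of the primitives and visibly
    integrable in time; it is established almost everywhere and then integrated.\<close>
  define lower where "lower t = G * (\<eta> t * tc t) - T\<^sup>2 * (K * a_up * (w1 t + w2 t + 2 * \<bar>g1\<bar> * V)) - 2 * E" for t
  have f1: "integrable (time T) (flux_density T \<Omega> P\<^sub>1 v\<^sub>1 phi)" and f2: "integrable (time T) (flux_density T \<Omega> P\<^sub>2 v\<^sub>2 phi)"
    unfolding phi_def by (rule flux_density_integrable[OF \<Omega> a_lo coeff(1) sol(1) \<eta> \<Phi>(1)], rule flux_density_integrable[OF \<Omega> a_lo coeff(2) sol(2) \<eta> \<Phi>(1)])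
  have i_prod: "integrable (time T) (\<lambda>t. \<eta> t * tc t)"
  proof -
    have "continuous_on UNIV (\<lambda>t. \<eta> t * tc t)"
      unfolding \<eta>_def tc_def time_cutoff_def by (intro continuous_intros)
    then show ?thesis
      by (intro L2_fun_integrable[OF finite_measure_time] L2_fun_continuous) auto
  qed
  have il: "integrable (time T) lower"
    unfolding lower_def[abs_def] using i_prod b1(1) b2(1) by auto
  have cont: "t \<in> {0<..<T} \<Longrightarrow> continuous_on UNIV (coef_a P\<^sub>1 t)" "t \<in> {0<..<T} \<Longrightarrow> continuous_on UNIV (coef_a P\<^sub>2 t)" for t
    using coef_a_continuous[OF \<Omega> a_lo coeff(1) sol(1) \<eta> \<Phi>(1)] coef_a_continuous[OF \<Omega> a_lo coeff(2) sol(2) \<eta> \<Phi>(1)] by auto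
  have bnd: "t \<in> {0<..<T} \<Longrightarrow> \<bar>coef_a P\<^sub>1 t s\<bar> \<le> a_up" "t \<in> {0<..<T} \<Longrightarrow> \<bar>coef_a P\<^sub>2 t s\<bar> \<le> a_up" for t s
    using coefficient_bounds(1)[OF \<Omega> a_lo coeff(1) sol(1) \<eta> \<Phi>(1)] coefficient_bounds(1)[OF \<Omega> a_lo coeff(2) sol(2) \<eta> \<Phi>(1)] by auto
  have a_up: "0 \<le> a_up" using bnd(1)[of "T/2" 0] T by force
  have supp: "\<Phi> x = 0" if "norm x > norm xbar + \<bar>\<rho>'\<bar>" for x
    by (rule \<Phi>(3)) (use norm_triangle_sub[of x xbar] that in \<open>auto simp: dist_norm norm_minus_commute\<close>)
  have geo: "\<forall>y\<in>ball xbar \<rho>. y \<in> \<Omega> \<longleftrightarrow> y \<bullet> e < xbar \<bullet> e" "\<forall>y\<in>ball xbar \<rho>. y \<bullet> e = xbar \<bullet> e \<longrightarrow> y \<in> frontier \<Omega>"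
    "\<forall>x. x \<notin> cball xbar \<rho>' \<longrightarrow> \<Phi> x = 0" "\<forall>t. continuous_on UNIV (h t)"
    using half front \<Phi>(3) h(1) by blast+
  have "AE t in time T. lower t \<le> flux_density T \<Omega> P\<^sub>1 v\<^sub>1 phi t - flux_density T \<Omega> P\<^sub>2 v\<^sub>2 phi t"
    using flux_density_formula[OF \<Omega> a_lo coeff(1) sol(1) \<eta> \<Phi>(1) e geo(1,2) nz fin \<Phi>(2) geo(3,4)]
      flux_density_formula[OF \<Omega> a_lo coeff(2) sol(2) \<eta> \<Phi>(1) e geo(1,2) nz fin \<Phi>(2) geo(3,4)]
      b1(2) b2(2) AE_space[of "time T"]
  proof eventually_elim
    case (elim t)
    have t: "t \<in> {0<..<T}" using elim(5) by (simp add: space_restrict_space)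
    have \<eta>b: "0 \<le> \<eta> t" "\<eta> t \<le> T\<^sup>2" "\<bar>deriv \<eta> t\<bar> \<le> T"
    proof -
      show "0 \<le> \<eta> t" using t by (simp add: \<eta>_def)
      have "t * (T - t) \<le> T * T" using t by (intro mult_mono) auto
      then show "\<eta> t \<le> T\<^sup>2" by (simp add: \<eta>_def power2_eq_square)
      show "\<bar>deriv \<eta> t\<bar> \<le> T" unfolding d\<eta> using t by auto
    qed
    \<comment> \<open>Primitives normalised at the base value \<open>g1\<close>, so that both
      boundary integrals live on the peak alone.\<close>
    obtain A1 where A1: "\<forall>s. (A1 has_real_derivative coef_a P\<^sub>1 t s) (at s)" "A1 g1 = 0"
      using antiderivative_exists[OF cont(1)[OF t]] by blast
    obtain A2 where A2: "\<forall>s. (A2 has_real_derivative coef_a P\<^sub>2 t s) (at s)" "A2 g1 = 0"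
      using antiderivative_exists[OF cont(2)[OF t]] by blast
    let ?pl = "\<lambda>A. LINT x|plane_measure e. A (h t (pt e (xbar \<bullet> e) x)) * pd e \<Phi> (pt e (xbar \<bullet> e) x)"
    have contA: "continuous_on UNIV A1" "continuous_on UNIV A2"
      using A1(1) A2(1) by (meson DERIV_isCont continuous_at_imp_continuous_on)+
    have ipl: "integrable (plane_measure e) (\<lambda>x. A (h t (pt e (xbar \<bullet> e) x)) * pd e \<Phi> (pt e (xbar \<bullet> e) x))"
      if A: "continuous_on UNIV A" for A
      by (rule integrable_plane_bounded_support[OF e, of "\<lambda>y. A (h t y) * pd e \<Phi> y" "norm xbar + \<bar>\<rho>'\<bar>"])
        (auto intro!: continuous_on_mult continuous_on_compose2[OF A h(1)] smooth_continuous[OF smooth_pd[OF \<Phi>(1) e]]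
          simp: pd_eq_0_outside_cball[OF supp])
    have gain: "G * tc t \<le> ?pl A1 - ?pl A2"
    proof (cases "t \<in> {t1<..<t2}")
      case True
      let ?D = "\<lambda>s. A1 s - A2 s"
      have D: "c0 * (s - g1) \<le> ?D s" if s: "g1 \<le> s" "s \<le> g2" for s
      proof -
        have "?D g1 - c0 * g1 \<le> ?D s - c0 * s"
        proof (rule DERIV_nonneg_imp_nondecreasing[OF s(1)])
          fix y assume y: "g1 \<le> y" "y \<le> s"
          have "((\<lambda>s. ?D s - c0 * s) has_real_derivative coef_a P\<^sub>1 t y - coef_a P\<^sub>2 t y - c0) (at y)"
            using A1(1) A2(1) by (auto intro!: derivative_eq_intros)
          moreover have "0 \<le> coef_a P\<^sub>1 t y - coef_a P\<^sub>2 t y - c0" using gap[of t y] True y s by simp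
          ultimately show "\<exists>d. ((\<lambda>s. ?D s - c0 * s) has_real_derivative d) (at y) \<and> 0 \<le> d" by blast
        qed
        then show ?thesis using A1(2) A2(2) by (simp add: algebra_simps)
      qed
      have "c0 * (m * tc t) * k * (\<epsilon> / ?N) ^ (DIM('a) - 1) \<le> ?pl ?D"
      proof (rule peak_gain[OF e pos(1,2) _ pos(4) \<Phi>(1,3,4,5) h(1,2,3,4)])
        show "0 \<le> m * tc t" using pos(3) tcb(1) by simp
        show "continuous_on UNIV ?D" using contA by (intro continuous_intros)
        show "g1 + m * tc t \<le> h t x" if "norm (x - xbar) \<le> \<epsilon> / 2" for x
          using h(5)[OF that] by (simp add: tc_def)
      qed (use A1(2) A2(2) D in auto)
      also have "?pl ?D = ?pl A1 - ?pl A2"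
        using ipl[OF contA(1)] ipl[OF contA(2)] by (simp add: left_diff_distrib)
      finally show ?thesis by (simp add: G_def mult_ac)
    next
      case False
      \<comment> \<open>Outside the time window the datum is the constant \<open>g1\<close>, where
        both primitives vanish, so both sides are zero.\<close>
      then show ?thesis using h(6)[OF False] A1(2) A2(2) tcb(3)[OF False] by simp
    qed
    \<comment> \<open>The primitive grows at most linearly with slope \<open>a_up\<close>, and the
      Laplacian is at most \<open>K\<close> on \<open>\<Omega>\<close>, so the singularity of
      \<open>\<Phi>\<close> does not enter this term.\<close>
    have L: "\<bar>LINT x|?\<mu>. A (v x) * laplacian \<Phi> x\<bar> \<le> K * a_up * ((LINT x|?\<mu>. \<bar>v x\<bar>) + \<bar>g1\<bar> * V)"
      if A: "\<forall>s. (A has_real_derivative a s) (at s)" "A g1 = 0" "\<And>s. \<bar>a s\<bar> \<le> a_up" "continuous_on UNIV A"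
        and v: "integrable ?\<mu> v" for A a v
    proof -
      have Ab: "\<bar>A s\<bar> \<le> a_up * (\<bar>s\<bar> + \<bar>g1\<bar>)" for s
      proof -
        have "norm (A s - A g1) \<le> a_up * norm (s - g1)"
          by (rule field_differentiable_bound[of UNIV A a]) (use A in \<open>auto intro: DERIV_subset\<close>)
        also have "\<dots> \<le> a_up * (\<bar>s\<bar> + \<bar>g1\<bar>)" using a_up by (intro mult_left_mono) auto
        finally show ?thesis using A(2) by simp
      qed
      have bd: "\<bar>A (v x) * laplacian \<Phi> x\<bar> \<le> K * a_up * (\<bar>v x\<bar> + \<bar>g1\<bar>)" if "x \<in> space ?\<mu>" for x
      proof -
        have "\<bar>A (v x)\<bar> * \<bar>laplacian \<Phi> x\<bar> \<le> (a_up * (\<bar>v x\<bar> + \<bar>g1\<bar>)) * K"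
          using Ab \<Phi>(6)[of x] that a_up by (intro mult_mono) (auto simp: space_restrict_space)
        then show ?thesis by (simp add: abs_mult mult_ac)
      qed
      have i: "integrable ?\<mu> (\<lambda>x. K * a_up * (\<bar>v x\<bar> + \<bar>g1\<bar>))" using v by auto
      have "integrable ?\<mu> (\<lambda>x. A (v x) * laplacian \<Phi> x)"
      proof (rule Bochner_Integration.integrable_bound[OF i])
        have "(\<lambda>x. A (v x)) \<in> borel_measurable ?\<mu>"
          by (rule measurable_compose[OF borel_measurable_integrable[OF v] borel_measurable_continuous_onI[OF A(4)]])
        moreover have "laplacian \<Phi> \<in> borel_measurable ?\<mu>"
          by (intro continuous_measurable_lebesgue_on smooth_continuous smooth_laplacian \<Phi>(1))
        ultimately show "(\<lambda>x. A (v x) * laplacian \<Phi> x) \<in> borel_measurable ?\<mu>" by simp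
        show "AE x in ?\<mu>. norm (A (v x) * laplacian \<Phi> x) \<le> norm (K * a_up * (\<bar>v x\<bar> + \<bar>g1\<bar>))"
          using order_trans[OF bd abs_ge_self] by (intro AE_I2) simp
      qed
      then have "\<bar>LINT x|?\<mu>. A (v x) * laplacian \<Phi> x\<bar> \<le> (LINT x|?\<mu>. K * a_up * (\<bar>v x\<bar> + \<bar>g1\<bar>))"
        by (rule integral_abs_bound_integral[OF _ i]) (rule bd)
      also have "\<dots> = K * a_up * ((LINT x|?\<mu>. \<bar>v x\<bar>) + \<bar>g1\<bar> * V)"
        using v by (simp add: V_def)
      finally show ?thesis .
    qed
    let ?l1 = "LINT x|?\<mu>. A1 (v\<^sub>1 t x) * laplacian \<Phi> x" and ?l2 = "LINT x|?\<mu>. A2 (v\<^sub>2 t x) * laplacian \<Phi> x"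
    have l1: "\<bar>?l1\<bar> \<le> K * a_up * (w1 t + \<bar>g1\<bar> * V)"
      unfolding w1_def by (rule L[OF A1 bnd(1)[OF t] contA(1) elim(3)])
    have l2: "\<bar>?l2\<bar> \<le> K * a_up * (w2 t + \<bar>g1\<bar> * V)"
      unfolding w2_def by (rule L[OF A2 bnd(2)[OF t] contA(2) elim(4)])
    have err: "\<bar>\<eta> t\<bar> * (?N * C\<^sub>A * X) + (\<bar>\<eta> t\<bar> + \<bar>deriv \<eta> t\<bar>) * (C\<^sub>A * Y) \<le> E"
      unfolding E_def using \<eta>b XY pos(6) by (intro add_mono mult_right_mono) auto
    have F1: "\<bar>flux_density T \<Omega> P\<^sub>1 v\<^sub>1 phi t - \<eta> t * (?pl A1 - ?l1)\<bar> \<le> E"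
      using elim(1)[rule_format, of A1] A1(1) err unfolding X_def Y_def phi_def by force
    have F2: "\<bar>flux_density T \<Omega> P\<^sub>2 v\<^sub>2 phi t - \<eta> t * (?pl A2 - ?l2)\<bar> \<le> E"
      using elim(2)[rule_format, of A2] A2(1) err unfolding X_def Y_def phi_def by force
    have "G * (\<eta> t * tc t) = \<eta> t * (G * tc t)" by (simp add: mult_ac)
    also have "\<dots> \<le> \<eta> t * (?pl A1 - ?pl A2)" by (intro mult_left_mono gain \<eta>b)
    finally have 1: "G * (\<eta> t * tc t) \<le> \<eta> t * (?pl A1 - ?pl A2)" .
    have "\<eta> t * (?l1 - ?l2) \<le> \<eta> t * (K * a_up * (w1 t + w2 t + 2 * \<bar>g1\<bar> * V))"
    proof (rule mult_left_mono[OF _ \<eta>b(1)])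
      have "?l1 - ?l2 \<le> K * a_up * (w1 t + \<bar>g1\<bar> * V) + K * a_up * (w2 t + \<bar>g1\<bar> * V)" using l1 l2 by linarith
      then show "?l1 - ?l2 \<le> K * a_up * (w1 t + w2 t + 2 * \<bar>g1\<bar> * V)" by (simp add: algebra_simps)
    qed
    also have "\<dots> \<le> T\<^sup>2 * (K * a_up * (w1 t + w2 t + 2 * \<bar>g1\<bar> * V))"
      using \<eta>b(2) pos a_up by (intro mult_right_mono) (auto simp: w1_def w2_def V_def intro!: mult_nonneg_nonneg add_nonneg_nonneg)
    finally have 2: "\<eta> t * (?l1 - ?l2) \<le> T\<^sup>2 * (K * a_up * (w1 t + w2 t + 2 * \<bar>g1\<bar> * V))" .
    have 3: "\<eta> t * (?pl A1 - ?l1) - \<eta> t * (?pl A2 - ?l2) = \<eta> t * (?pl A1 - ?pl A2) - \<eta> t * (?l1 - ?l2)"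
      by (simp add: algebra_simps)
    show ?case unfolding lower_def using 1 2 3 F1 F2 by linarith
  qed
  then have "(LINT t|time T. lower t) \<le> (LINT t|time T. flux_density T \<Omega> P\<^sub>1 v\<^sub>1 phi t - flux_density T \<Omega> P\<^sub>2 v\<^sub>2 phi t)"
    using il f1 f2 by (intro integral_mono_AE) auto
  also have "\<dots> = neumann_flux T \<Omega> P\<^sub>1 v\<^sub>1 phi - neumann_flux T \<Omega> P\<^sub>2 v\<^sub>2 phi"
    unfolding neumann_flux_eq using f1 f2 by simp
  finally have main: "(LINT t|time T. lower t) \<le> neumann_flux T \<Omega> P\<^sub>1 v\<^sub>1 phi - neumann_flux T \<Omega> P\<^sub>2 v\<^sub>2 phi" .
  have mT: "Sigma_Algebra.measure (time T) {0<..<T} = T"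
    using T by (simp add: measure_restrict_space)
  have "(LINT t|time T. lower t) = G * (LINT t|time T. \<eta> t * tc t)
     - T\<^sup>2 * (K * a_up * ((LINT t|time T. w1 t) + (LINT t|time T. w2 t) + T * (2 * \<bar>g1\<bar> * V))) - T * (2 * E)"
    unfolding lower_def using i_prod b1(1) b2(1) by (simp add: mT)
  moreover have "T\<^sup>2 * (K * a_up * ((LINT t|time T. w1 t) + (LINT t|time T. w2 t) + T * (2 * \<bar>g1\<bar> * V)))
     \<le> T\<^sup>2 * (K * a_up * (2 * ((LINT t|time T. V) + C\<^sub>U\<^sup>2) + T * (2 * \<bar>g1\<bar> * V)))"
    using b1(3) b2(3) pos a_up T by (intro mult_left_mono add_mono) auto
  ultimately show ?thesis
    using main unfolding phi_def G_def E_def \<eta>_def tc_def V_def X_def Y_def by linarith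
qed

lemma half_space_frontier:
  fixes \<Omega> :: "'a::euclidean_space set"
  assumes e: "norm e = 1" and half: "\<And>y. y \<in> ball xbar \<rho> \<Longrightarrow> y \<in> \<Omega> \<longleftrightarrow> y \<bullet> e < c"
    and y: "y \<in> ball xbar \<rho>" "y \<bullet> e = c"
  shows "y \<in> frontier \<Omega>"
  unfolding frontier_straddle
proof (intro allI impI conjI)
  fix d :: real assume d: "0 < d"
  have "open (ball xbar \<rho>)" by simp
  then obtain r where r: "r > 0" "ball y r \<subseteq> ball xbar \<rho>" using y(1) openE by blast
  define t where "t = min d r / 2"
  have t: "0 < t" "t < d" "t < r" using d r by (auto simp: t_def)
  have dist: "dist y (y - t *\<^sub>R e) = t" using e t by (simp add: dist_norm)
  have "e \<bullet> e = 1" using e by (simp add: norm_eq_1)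
  then have "(y - t *\<^sub>R e) \<bullet> e < c" using y t by (simp add: inner_diff_left)
  moreover have "y - t *\<^sub>R e \<in> ball xbar \<rho>" using r(2) dist t by (auto simp: subset_eq)
  ultimately have "y - t *\<^sub>R e \<in> \<Omega>" using half by blast
  then show "\<exists>x\<in>\<Omega>. dist y x < d" using dist t by (intro bexI[of _ "y - t *\<^sub>R e"]) auto
  have "y \<notin> \<Omega>" using half[OF y(1)] y(2) by simp
  then show "\<exists>x. x \<notin> \<Omega> \<and> dist y x < d" using d by (intro exI[of _ y]) auto
qed

lemma smooth_has_trace:
  fixes \<Omega> :: "'a::euclidean_space set"
  assumes \<Omega>: "open \<Omega>" "bounded \<Omega>" and fin: "finite_measure (surface \<Omega>)" and f: "smooth f"
    and supp: "\<And>x. norm x > R \<Longrightarrow> f x = 0"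
  shows "has_trace \<Omega> f f"
proof -
  obtain B where B: "\<And>x. norm (f x) \<le> B"
    using continuous_bounded_support_bounded[OF smooth_continuous[OF f] supp] by blast
  have "L2_fun (surface \<Omega>) f"
    by (rule L2_fun_bounded[OF fin continuous_measurable_surface[OF smooth_continuous[OF f]] B])
  then show ?thesis unfolding has_trace_def
    using H1_grad_smooth[OF \<Omega> f] f
    by (intro conjI exI[of _ "grad f"] exI[of _ "\<lambda>_. f"]) (auto simp: L2_conv_def)
qed

section \<open>Choice of parameters and the one-sided estimate\<close>

lemma weight_integral_pos:
  assumes "0 < t1" "t1 < t2" "t2 < T"
  shows "0 < (LINT t|time T. t * (T - t) * time_cutoff t1 t2 t)"
proof -
  \<comment> \<open>On the middle third of the window all factors are bounded below: by
    \<open>t1\<close>, \<open>T - t2\<close>, \<open>\<Delta>\<close> and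
    \<open>\<Delta>\<close>.\<close>
  define \<Delta> where "\<Delta> = (t2 - t1) / 3"
  have \<Delta>: "\<Delta> > 0" "t1 + \<Delta> < t2 - \<Delta>" using assms by (auto simp: \<Delta>_def field_simps)
  define m where "m = t1 * (T - t2) * (\<Delta> * \<Delta>)"
  have m: "m > 0" using assms \<Delta> by (simp add: m_def)
  let ?f = "\<lambda>t. t * (T - t) * time_cutoff t1 t2 t"
  have J: "{t1 + \<Delta>..t2 - \<Delta>} \<in> sets (time T)"
    using assms \<Delta> by (auto simp: sets_restrict_space intro!: image_eqI[of _ _ "{t1 + \<Delta>..t2 - \<Delta>}"])
  have "0 < m * (t2 - \<Delta> - (t1 + \<Delta>))" using m \<Delta> by simp
  also have "\<dots> = (LINT t|time T. m * indicator {t1 + \<Delta>..t2 - \<Delta>} t)"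
  proof -
    have int: "{t1 + \<Delta>..t2 - \<Delta>} \<inter> {0<..<T} = {t1 + \<Delta>..t2 - \<Delta>}" using assms \<Delta> by auto
    have "Sigma_Algebra.measure (time T) {t1 + \<Delta>..t2 - \<Delta>} = Sigma_Algebra.measure lebesgue {t1 + \<Delta>..t2 - \<Delta>}"
      using assms \<Delta> by (intro measure_restrict_space) auto
    then show ?thesis using J \<Delta> by (simp add: int space_restrict_space)
  qed
  also have "\<dots> \<le> (LINT t|time T. ?f t)"
  proof (rule integral_mono)
    show "integrable (time T) (\<lambda>t. m * indicator {t1 + \<Delta>..t2 - \<Delta>} t)"
      using J finite_measure.emeasure_finite[OF finite_measure_time]
      by (intro integrable_mult_right integrable_real_indicator) (auto simp: less_top[symmetric])
    have "continuous_on UNIV ?f" unfolding time_cutoff_def by (intro continuous_intros)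
    then show "integrable (time T) ?f"
      by (intro L2_fun_integrable[OF finite_measure_time] L2_fun_continuous) auto
    fix t assume "t \<in> space (time T)"
    then have t: "0 < t" "t < T" by (auto simp: space_restrict_space)
    show "m * indicator {t1 + \<Delta>..t2 - \<Delta>} t \<le> ?f t"
    proof (cases "t \<in> {t1 + \<Delta>..t2 - \<Delta>}")
      case True
      have "\<Delta> * \<Delta> \<le> (t - t1) * (t2 - t)" using True \<Delta> by (intro mult_mono) auto
      also have "\<dots> \<le> time_cutoff t1 t2 t" by (simp add: time_cutoff_def)
      finally have 1: "\<Delta> * \<Delta> \<le> time_cutoff t1 t2 t" .
      have 2: "t1 * (T - t2) \<le> t * (T - t)" using True \<Delta> assms by (intro mult_mono) auto
      have "m \<le> ?f t" unfolding m_def by (rule mult_mono[OF 2 1]) (use t \<Delta> in auto)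
      then show ?thesis using True by simp
    next
      case False
      have "0 \<le> time_cutoff t1 t2 t" by (simp add: time_cutoff_def)
      then show ?thesis using False t by simp
    qed
  qed
  finally show ?thesis .
qed

text \<open>In the variable y = \<epsilon>^(-1/4) the claim is C1 + C2 y < c y^2. It holds for y
  \<ge> B with B as in the proof, because B \<ge> 1 allows C1 to be replaced by C1 y; and y is large
  when \<epsilon> is small.\<close>

lemma small_parameter_exists:
  fixes c C1 C2 b :: real
  assumes "c > 0" "C1 \<ge> 0" "C2 \<ge> 0" "b > 0"
  shows "\<exists>\<epsilon>. 0 < \<epsilon> \<and> \<epsilon> \<le> 1 \<and> \<epsilon> < b \<and> C1 + C2 * \<epsilon> powr (-1/4) < c * (\<epsilon> powr (-1/4))\<^sup>2"
proof -
  define B where "B = (C1 + C2) / c + 1"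
  have B: "B \<ge> 1" "c * B > C1 + C2" using assms by (auto simp: B_def field_simps)
  define \<epsilon> where "\<epsilon> = min (B powr (-4)) (b / 2)"
  have \<epsilon>: "0 < \<epsilon>" "\<epsilon> \<le> B powr (-4)" "\<epsilon> < b" using B assms by (auto simp: \<epsilon>_def)
  have "B powr (-4) \<le> B powr 0" using B by (intro powr_mono) auto
  then have \<epsilon>1: "\<epsilon> \<le> 1" using \<epsilon>(2) B by simp
  define y where "y = \<epsilon> powr (-1/4)"
  have "B = (B powr (-4)) powr (-1/4)" using B by (simp add: powr_powr)
  also have "\<dots> \<le> y" unfolding y_def using \<epsilon> by (intro powr_mono2') auto
  finally have y: "B \<le> y" .
  have "C1 + C2 * y \<le> C1 * y + C2 * y" using mult_left_mono[of 1 y C1] assms(2) y B by simp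
  also have "\<dots> = (C1 + C2) * y" by (simp add: algebra_simps)
  also have "\<dots> < (c * B) * y" using B y by (intro mult_strict_right_mono) auto
  also have "\<dots> \<le> (c * y) * y" using y B assms by (intro mult_right_mono mult_left_mono) auto
  finally have "C1 + C2 * y < c * y\<^sup>2" by (simp add: power2_eq_square mult.assoc)
  then show ?thesis using \<epsilon> \<epsilon>1 unfolding y_def by blast
qed

text \<open>One-sided form, in which it is known which leading coefficient is larger; the general
  case follows by exchanging the two problems. The strict inequality is exhibited on an admissible
  test function whose trace vanishes off the measured part.\<close>

lemma flux_difference:
  fixes \<Omega> \<Gamma>' :: "'a::euclidean_space set" and xbar e :: 'a
    and T \<epsilon>0 g_lo g_up C\<^sub>A C\<^sub>0 C\<^sub>G C\<^sub>U a_lo a_up t_star g_star :: real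
    and P\<^sub>1 P\<^sub>2 :: "'a pde_data" and u\<^sub>1 u\<^sub>2 :: "(real \<Rightarrow> 'a \<Rightarrow> real) \<Rightarrow> real \<Rightarrow> 'a \<Rightarrow> real"
  assumes dim: "2 \<le> DIM('a)" "DIM('a) \<le> 3" and e: "e \<in> Basis"
    and constants: "T > 0" "g_lo < g_up" "C\<^sub>A > 0" "a_lo > 0"
    and geometry: "geometric_assumption \<Omega> \<Gamma>' xbar \<epsilon>0 e"
    and C_G: "data_bound_large_enough T \<Omega> xbar \<epsilon>0 g_lo g_up C\<^sub>G"
    and coeff: "coefficient_assumption T \<Omega> C\<^sub>A C\<^sub>0 a_lo a_up P\<^sub>1" "coefficient_assumption T \<Omega> C\<^sub>A C\<^sub>0 a_lo a_up P\<^sub>2"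
    and solv: "solvability_assumption T \<Omega> (dirichlet_data T \<Omega> g_lo g_up C\<^sub>G) C\<^sub>U P\<^sub>1"
      "solvability_assumption T \<Omega> (dirichlet_data T \<Omega> g_lo g_up C\<^sub>G) C\<^sub>U P\<^sub>2"
    and sol: "\<forall>g\<in>dirichlet_data T \<Omega> g_lo g_up C\<^sub>G. weak_solution T \<Omega> P\<^sub>1 g (u\<^sub>1 g)"
      "\<forall>g\<in>dirichlet_data T \<Omega> g_lo g_up C\<^sub>G. weak_solution T \<Omega> P\<^sub>2 g (u\<^sub>2 g)"
    and star: "0 < t_star" "t_star < T" "g_lo \<le> g_star" "g_star \<le> g_up"
    and differ: "coef_a P\<^sub>2 t_star g_star < coef_a P\<^sub>1 t_star g_star"
  shows "\<exists>g\<in>dirichlet_data T \<Omega> g_lo g_up C\<^sub>G. \<exists>\<phi>\<in>H10X T (lebesgue_on \<Omega>) (H1_grad \<Omega>).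
    (AE t in time T. \<exists>h. has_trace \<Omega> (\<phi> t) h \<and> (AE x in surface \<Omega>. x \<notin> ball xbar \<epsilon>0 \<inter> frontier \<Omega> \<longrightarrow> h x = 0)) \<and>
    neumann_flux T \<Omega> P\<^sub>2 (u\<^sub>2 g) \<phi> < neumann_flux T \<Omega> P\<^sub>1 (u\<^sub>1 g) \<phi>"
proof -
  let ?G = "dirichlet_data T \<Omega> g_lo g_up C\<^sub>G" and ?\<mu> = "lebesgue_on \<Omega>" and ?N = "real DIM('a)"
  have \<Omega>: "open \<Omega>" "bounded \<Omega>" and \<epsilon>0: "\<epsilon>0 > 0" and nz: "emeasure (surface \<Omega>) \<Gamma>' \<noteq> 0"
    and xbar: "xbar \<in> frontier \<Omega>" and normal: "\<And>x. x \<in> ball xbar \<epsilon>0 \<Longrightarrow> x \<in> frontier \<Omega> \<Longrightarrow> is_outer_normal \<Omega> x e"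
    using geometry unfolding geometric_assumption_def bounded_lipschitz_domain_def by auto
  have fin: "finite_measure (surface \<Omega>)"
    by (rule finite_measure_surface[OF C_G constants(1,2) \<epsilon>0])
  have ne: "norm e = 1" using e by simp
  obtain \<rho>1 where \<rho>1: "\<rho>1 > 0" "\<rho>1 \<le> \<epsilon>0" "\<forall>y\<in>ball xbar \<rho>1. y \<in> \<Omega> \<longleftrightarrow> y \<bullet> e < xbar \<bullet> e"
    using flat_boundary[OF \<Omega>(1) ne xbar \<epsilon>0 normal] by blast
  \<comment> \<open>Radius at most 1, so that the support of the test function lies in
    \<open>ball xbar 1\<close>, to which the weight \<open>W\<close> is cut off.\<close>
  define \<rho> where "\<rho> = min \<rho>1 1"
  have \<rho>: "0 < \<rho>" "\<rho> \<le> 1" "\<rho> \<le> \<epsilon>0" using \<rho>1 by (auto simp: \<rho>_def)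
  have half: "y \<in> \<Omega> \<longleftrightarrow> y \<bullet> e < xbar \<bullet> e" if "y \<in> ball xbar \<rho>" for y
    using \<rho>1(3) that by (auto simp: \<rho>_def)
  have front: "y \<in> frontier \<Omega>" if "y \<in> ball xbar \<rho>" "y \<bullet> e = xbar \<bullet> e" for y
    by (rule half_space_frontier[OF ne half that])
  obtain K \<kappa> where K: "K > 0" "\<kappa> > 0"
    and test: "\<forall>\<epsilon>. 0 < \<epsilon> \<and> \<epsilon> < \<rho> / 4 \<longrightarrow> (\<exists>\<Phi>. singular_test xbar e \<rho> K \<kappa> \<epsilon> \<Phi>)"
    using singular_test_function[OF e \<rho>(1,2) dim(1), of xbar] by blast
  \<comment> \<open>Half the gap at the given point; by continuity it persists in a
    neighbourhood.\<close>
  define c0 where "c0 = (coef_a P\<^sub>1 t_star g_star - coef_a P\<^sub>2 t_star g_star) / 2"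
  have c0: "c0 > 0" using differ by (simp add: c0_def)
  obtain \<delta> where \<delta>: "\<delta> > 0" "\<And>t s. t \<in> {0<..<T} \<Longrightarrow> dist (t, s) (t_star, g_star) < \<delta> \<Longrightarrow> c0 < coef_a P\<^sub>1 t s - coef_a P\<^sub>2 t s"
  proof -
    let ?S = "{0<..<T} \<times> (UNIV :: real set)" and ?f = "\<lambda>(t, s). coef_a P\<^sub>1 t s - coef_a P\<^sub>2 t s"
    have "continuous_on ?S (\<lambda>(t, s). coef_a P\<^sub>1 t s)" "continuous_on ?S (\<lambda>(t, s). coef_a P\<^sub>2 t s)"
      using coeff unfolding coefficient_assumption_def W1inf_le_def by blast+
    from continuous_on_diff[OF this] have "continuous_on ?S ?f" by (simp add: case_prod_beta')
    moreover have "(t_star, g_star) \<in> ?S" using star by simp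
    ultimately obtain \<delta> where "\<delta> > 0" "\<forall>z\<in>?S. dist z (t_star, g_star) < \<delta> \<longrightarrow> dist (?f z) (?f (t_star, g_star)) < c0"
      using c0 unfolding continuous_on_iff by blast
    moreover have "c0 < coef_a P\<^sub>1 t s - coef_a P\<^sub>2 t s" if "dist (?f (t, s)) (?f (t_star, g_star)) < c0" for t s
    proof -
      have "coef_a P\<^sub>1 t_star g_star - coef_a P\<^sub>2 t_star g_star = 2 * c0" by (simp add: c0_def)
      then show ?thesis using that unfolding dist_real_def prod.case by linarith
    qed
    ultimately show ?thesis using that[of \<delta>] by force
  qed
  \<comment> \<open>A third of \<open>\<delta>\<close> in each variable adds up to less than
    \<open>\<delta>\<close>; the second argument of each minimum keeps the window strictly inside
    (0, T).\<close>
  define t1 where "t1 = t_star - min (\<delta> / 3) (t_star / 2)"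
  define t2 where "t2 = t_star + min (\<delta> / 3) ((T - t_star) / 2)"
  have t12: "0 < t1" "t1 < t2" "t2 < T" "t_star - \<delta> / 3 \<le> t1" "t2 \<le> t_star + \<delta> / 3"
    using star \<delta>(1) by (auto simp: t1_def t2_def min_def field_simps)
  \<comment> \<open>\<open>g_star\<close> may be an end point of the admissible range: then one of
    the two values is \<open>g_star\<close> itself, and \<open>g_lo < g_up\<close> still keeps them
    apart.\<close>
  define g1 where "g1 = max g_lo (g_star - \<delta> / 3)"
  define g2 where "g2 = min g_up (g_star + \<delta> / 3)"
  have g12: "g_lo \<le> g1" "g1 < g2" "g2 \<le> g_up" "g_star - \<delta> / 3 \<le> g1" "g2 \<le> g_star + \<delta> / 3"
    using star constants(2) \<delta>(1) by (auto simp: g1_def g2_def)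
  have gap: "c0 \<le> coef_a P\<^sub>1 t s - coef_a P\<^sub>2 t s" if "t1 < t" "t < t2" "g1 \<le> s" "s \<le> g2" for t s
  proof -
    have "dist (t, s) (t_star, g_star) \<le> \<bar>t - t_star\<bar> + \<bar>s - g_star\<bar>"
      unfolding dist_Pair_Pair dist_real_def by (rule sqrt_sum_squares_le_sum) simp_all
    moreover have "\<bar>t - t_star\<bar> \<le> \<delta> / 3" "\<bar>s - g_star\<bar> \<le> \<delta> / 3" using that t12 g12 by linarith+
    ultimately have "dist (t, s) (t_star, g_star) < \<delta>" using \<delta>(1) by linarith
    then show ?thesis using \<delta>(2)[of t s] that t12 by auto
  qed
  define \<gamma> where "\<gamma> = 4 * (g2 - g1) * min 1 (\<epsilon>0 powr ((?N - 3) / 2)) / T\<^sup>2"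
  have \<gamma>: "\<gamma> > 0" using g12 \<epsilon>0 constants(1) by (simp add: \<gamma>_def)
  define Q where "Q = (LINT t|time T. t * (T - t) * time_cutoff t1 t2 t)"
  have Q: "Q > 0" unfolding Q_def by (rule weight_integral_pos[OF t12(1-3)])
  define W where "W x = norm (x - xbar) powr (- (?N - 1/4)) * indicator (ball xbar 1) x" for x
  define J where "J = (LINT x|?\<mu>. W x)"
  have iW: "integrable ?\<mu> W"
  proof -
    have "integrable lborel W" unfolding W_def[abs_def] by (rule integrable_norm_powr_ball) (use dim in auto)
    then have "integrable lebesgue W" by (simp add: integrable_completion borel_measurable_integrable)
    then have "integrable lebesgue (\<lambda>x. indicator \<Omega> x *\<^sub>R W x)" using \<Omega>(1) by (intro integrable_mult_indicator) auto
    then show ?thesis using \<Omega>(1) by (subst integrable_restrict_space) auto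
  qed
  have J: "J \<ge> 0" by (simp add: J_def W_def)
  define V where "V = (LINT x|?\<mu>. 1::real)"
  define VT where "VT = (LINT t|time T. LINT x|?\<mu>. 1::real)"
  have V: "V \<ge> 0" "VT \<ge> 0" by (auto simp: V_def VT_def)
  have a_up: "a_up \<ge> 0"
  proof -
    have "a_lo \<le> coef_a P\<^sub>1 (T / 2) 0 \<and> coef_a P\<^sub>1 (T / 2) 0 \<le> a_up"
      using coeff(1) constants(1) unfolding coefficient_assumption_def by simp
    then show ?thesis using constants(4) by linarith
  qed
  \<comment> \<open>\<open>c\<close> collects the factors of the gain, \<open>C1\<close> the bounded
    volume terms, and \<open>C2\<close> the lower-order terms, which grow like
    \<epsilon>^(-1/4).\<close>
  define c where "c = c0 * \<gamma> * \<kappa> / ?N ^ (DIM('a) - 1) * Q"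
  define C1 where "C1 = T\<^sup>2 * (K * a_up * (2 * (VT + C\<^sub>U\<^sup>2) + T * (2 * \<bar>g1\<bar> * V)))"
  define C2 where "C2 = T * (2 * (T\<^sup>2 * (?N * C\<^sub>A * (K * J)) + (T\<^sup>2 + T) * (C\<^sub>A * (K * J))))"
  have c: "c > 0" using c0 \<gamma> K Q by (simp add: c_def)
  have C: "C1 \<ge> 0" "C2 \<ge> 0"
    using constants K J V a_up by (auto simp: C1_def C2_def intro!: mult_nonneg_nonneg add_nonneg_nonneg)
  have "0 < min (\<rho> / 4) \<epsilon>0" using \<rho> \<epsilon>0 by simp
  from small_parameter_exists[OF c C this] obtain \<epsilon> where \<epsilon>: "0 < \<epsilon>" "\<epsilon> \<le> 1" "\<epsilon> < \<rho> / 4" "\<epsilon> \<le> \<epsilon>0"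
    and small: "C1 + C2 * \<epsilon> powr (-1/4) < c * (\<epsilon> powr (-1/4))\<^sup>2" by auto
  from test \<epsilon>(1,3) obtain \<Phi> where "singular_test xbar e \<rho> K \<kappa> \<epsilon> \<Phi>" by blast
  then have \<Phi>: "smooth \<Phi>" "x \<notin> cball xbar (\<rho> / 2) \<Longrightarrow> \<Phi> x = 0"
    "(x - xbar) \<bullet> e < 0 \<Longrightarrow> \<bar>\<Phi> x\<bar> \<le> K * \<epsilon> powr (-1/4) * W x"
    "(x - xbar) \<bullet> e < 0 \<Longrightarrow> norm (grad \<Phi> x) \<le> K * \<epsilon> powr (-1/4) * W x"
    "(x - xbar) \<bullet> e < 0 \<Longrightarrow> \<bar>laplacian \<Phi> x\<bar> \<le> K"
    "(x - xbar) \<bullet> e = 0 \<Longrightarrow> norm (x - xbar) < \<epsilon> \<Longrightarrow> 0 \<le> pd e \<Phi> x"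
    "(x - xbar) \<bullet> e = 0 \<Longrightarrow> norm (x - xbar) \<le> \<epsilon> / 2 \<Longrightarrow> \<kappa> * \<epsilon> powr (- ?N) \<le> pd e \<Phi> x" for x
    unfolding W_def singular_test_def by blast+
  have supp: "\<Phi> x = 0" if "norm x > norm xbar + \<rho>" for x
    by (rule \<Phi>(2)) (use norm_triangle_sub[of x xbar] that \<rho> in \<open>auto simp: dist_norm norm_minus_commute\<close>)
  have off: "pd i \<Phi> x = 0" "laplacian \<Phi> x = 0" if "x \<notin> cball xbar (\<rho> / 2)" for x i
  proof -
    show "pd i \<Phi> x = 0" by (rule pd_eq_0_outside_closed[OF closed_cball _ that]) (rule \<Phi>(2))
    show "laplacian \<Phi> x = 0" by (rule laplacian_eq_0_outside_closed[OF closed_cball _ that]) (rule \<Phi>(2))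
  qed
  have W0: "0 \<le> K * \<epsilon> powr (-1/4) * W x" for x using K by (simp add: W_def)
  \<comment> \<open>Near its support \<open>\<Omega>\<close> is the half space, where the bounds of
    \<open>singular_test\<close> apply; elsewhere the test function and its derivatives
    vanish.\<close>
  have in_\<Omega>: "\<bar>\<Phi> x\<bar> \<le> K * \<epsilon> powr (-1/4) * W x" "norm (grad \<Phi> x) \<le> K * \<epsilon> powr (-1/4) * W x" "\<bar>laplacian \<Phi> x\<bar> \<le> K"
    if x: "x \<in> \<Omega>" for x
  proof -
    have "\<bar>\<Phi> x\<bar> \<le> K * \<epsilon> powr (-1/4) * W x \<and> norm (grad \<Phi> x) \<le> K * \<epsilon> powr (-1/4) * W x \<and> \<bar>laplacian \<Phi> x\<bar> \<le> K"
    proof (cases "x \<in> cball xbar (\<rho> / 2)")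
      case True
      then have "x \<in> ball xbar \<rho>" using \<rho> by auto
      then have "(x - xbar) \<bullet> e < 0" using half x by (simp add: inner_diff_left)
      then show ?thesis using \<Phi>(3-5) by blast
    next
      case False
      then show ?thesis using off[OF False] \<Phi>(2)[OF False] W0[of x] K by (simp add: grad_def)
    qed
    then show "\<bar>\<Phi> x\<bar> \<le> K * \<epsilon> powr (-1/4) * W x" "norm (grad \<Phi> x) \<le> K * \<epsilon> powr (-1/4) * W x" "\<bar>laplacian \<Phi> x\<bar> \<le> K" by auto
  qed
  have IX: "(LINT x|?\<mu>. norm (grad \<Phi> x)) \<le> K * \<epsilon> powr (-1/4) * J" and IY: "(LINT x|?\<mu>. \<bar>\<Phi> x\<bar>) \<le> K * \<epsilon> powr (-1/4) * J"
  proof -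
    note L2 = L2_fun_integrable[OF finite_measure_open_bounded[OF \<Omega>] L2_fun_continuous[OF \<Omega>]]
    have "(LINT x|?\<mu>. norm (grad \<Phi> x)) \<le> (LINT x|?\<mu>. K * \<epsilon> powr (-1/4) * W x)"
      by (rule integral_mono[OF integrable_norm[OF L2[OF smooth_continuous_grad[OF \<Phi>(1)]]] integrable_mult_right[OF iW]])
        (rule in_\<Omega>(2), simp add: space_restrict_space)
    then show "(LINT x|?\<mu>. norm (grad \<Phi> x)) \<le> K * \<epsilon> powr (-1/4) * J" by (simp add: J_def)
    have "(LINT x|?\<mu>. \<bar>\<Phi> x\<bar>) \<le> (LINT x|?\<mu>. K * \<epsilon> powr (-1/4) * W x)"
      by (rule integral_mono[OF integrable_abs[OF L2[OF smooth_continuous[OF \<Phi>(1)]]] integrable_mult_right[OF iW]])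
        (rule in_\<Omega>(1), simp add: space_restrict_space)
    then show "(LINT x|?\<mu>. \<bar>\<Phi> x\<bar>) \<le> K * \<epsilon> powr (-1/4) * J" by (simp add: J_def)
  qed
  define g where "g = (peak_data T xbar \<epsilon>0 t1 t2 g1 g2 \<epsilon> :: real \<Rightarrow> 'a \<Rightarrow> real)"
  note peak = peak_data_properties[where xbar = xbar, OF constants(1) less_imp_le[OF t12(1)] t12(2) less_imp_le[OF t12(3)] g12(2) \<epsilon>(1,4) dim(2),
      folded g_def \<gamma>_def]
  have gG: "g \<in> ?G"
  proof -
    have "g \<in> H1X T (surface \<Omega>) (bdry_H1_grad \<Omega>) \<and> H1X_norm T (surface \<Omega>) (bdry_H1_grad \<Omega>) g \<le> C\<^sub>G"
      using C_G t12 g12 \<epsilon> unfolding data_bound_large_enough_def g_def by auto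
    moreover have "g_lo \<le> g t x \<and> g t x \<le> g_up" for t x
      using peak(2)[of t x] peak(3)[of t x] g12 by linarith
    ultimately show ?thesis unfolding dirichlet_data_def by (auto intro!: AE_I2)
  qed
  define \<phi> where "\<phi> = (\<lambda>t x. t * (T - t) * \<Phi> x)"
  have \<eta>: "smooth (\<lambda>t::real. t * (T - t))"
    using smooth_mult[OF smooth_inner_right[of "1::real"] smooth_diff[OF smooth_const smooth_inner_right[of "1::real"]], of T] by simp
  have \<phi>: "\<phi> \<in> H10X T ?\<mu> (H1_grad \<Omega>)"
    unfolding \<phi>_def using product_in_H10X[OF \<Omega> \<eta> _ _ \<Phi>(1), of T] by simp
  have tr: "\<exists>h. has_trace \<Omega> (\<phi> t) h \<and> (AE x in surface \<Omega>. x \<notin> ball xbar \<epsilon>0 \<inter> frontier \<Omega> \<longrightarrow> h x = 0)" for t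
  proof (intro exI conjI)
    show "has_trace \<Omega> (\<phi> t) (\<phi> t)"
      unfolding \<phi>_def
      by (rule smooth_has_trace[OF \<Omega> fin smooth_mult[OF smooth_const \<Phi>(1)], of "norm xbar + \<rho>"]) (simp add: supp)
    have "\<phi> t x = 0" if "x \<in> space (surface \<Omega>)" "x \<notin> ball xbar \<epsilon>0 \<inter> frontier \<Omega>" for x
    proof -
      have "x \<notin> cball xbar (\<rho> / 2)" using that \<rho> by (auto simp: space_surface)
      then show ?thesis by (simp add: \<phi>_def \<Phi>(2))
    qed
    then show "AE x in surface \<Omega>. x \<notin> ball xbar \<epsilon>0 \<inter> frontier \<Omega> \<longrightarrow> \<phi> t x = 0" by (auto intro!: AE_I2)
  qed
  have CU: "L2X_norm T ?\<mu> (H1_grad \<Omega>) (u\<^sub>1 g) \<le> C\<^sub>U" "L2X_norm T ?\<mu> (H1_grad \<Omega>) (u\<^sub>2 g) \<le> C\<^sub>U"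
    using solv gG sol[THEN bspec, OF gG] unfolding solvability_assumption_def by blast+
  let ?m = "\<gamma> * \<epsilon> powr ((3 - ?N) / 2)" and ?k = "\<kappa> * \<epsilon> powr (- ?N)"
  let ?X = "LINT x|?\<mu>. norm (grad \<Phi> x)" and ?Y = "LINT x|?\<mu>. \<bar>\<Phi> x\<bar>"
  have "c0 * ?m * ?k * (\<epsilon> / ?N) ^ (DIM('a) - 1) * Q - C1
     - T * (2 * (T\<^sup>2 * (?N * C\<^sub>A * ?X) + (T\<^sup>2 + T) * (C\<^sub>A * ?Y)))
    \<le> neumann_flux T \<Omega> P\<^sub>1 (u\<^sub>1 g) \<phi> - neumann_flux T \<Omega> P\<^sub>2 (u\<^sub>2 g) \<phi>"
    unfolding Q_def C1_def V_def VT_def \<phi>_def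
  proof (rule flux_gap[OF \<Omega> constants(4,1) coeff sol[THEN bspec, OF gG] CU e half front nz fin \<Phi>(1)])
    show "\<rho> / 2 < \<rho>" using \<rho> by simp
    show "0 \<le> ?m" "0 \<le> ?k" "0 \<le> c0" "0 \<le> K" using \<gamma> K c0 by auto
  qed (use \<Phi>(2,6,7) in_\<Omega>(3) \<epsilon> constants t12 peak gap in auto)
  moreover have "T * (2 * (T\<^sup>2 * (?N * C\<^sub>A * ?X) + (T\<^sup>2 + T) * (C\<^sub>A * ?Y))) \<le> C2 * \<epsilon> powr (-1/4)"
  proof -
    have "T * (2 * (T\<^sup>2 * (?N * C\<^sub>A * ?X) + (T\<^sup>2 + T) * (C\<^sub>A * ?Y)))
       \<le> T * (2 * (T\<^sup>2 * (?N * C\<^sub>A * (K * \<epsilon> powr (-1/4) * J)) + (T\<^sup>2 + T) * (C\<^sub>A * (K * \<epsilon> powr (-1/4) * J))))"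
      using IX IY constants by (intro mult_left_mono add_mono) auto
    also have "\<dots> = C2 * \<epsilon> powr (-1/4)" by (simp add: C2_def algebra_simps)
    finally show ?thesis .
  qed
  moreover have "c * (\<epsilon> powr (-1/4))\<^sup>2 \<le> c0 * ?m * ?k * (\<epsilon> / ?N) ^ (DIM('a) - 1) * Q"
  proof -
    \<comment> \<open>Height of the peak, normal derivative and area of the disc: (3-N)/2 - N +
      (N-1) = (1-N)/2.\<close>
    have p: "\<epsilon> powr ((3 - ?N) / 2) * \<epsilon> powr (- ?N) * \<epsilon> ^ (DIM('a) - 1) = \<epsilon> powr ((1 - ?N) / 2)"
    proof -
      have "\<epsilon> ^ (DIM('a) - 1) = \<epsilon> powr (?N - 1)" using \<epsilon>(1) dim by (simp add: powr_realpow[symmetric] of_nat_diff)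
      then show ?thesis by (simp flip: powr_add) (simp add: field_simps)
    qed
    have "(\<epsilon> powr (-1/4))\<^sup>2 = \<epsilon> powr (-1/2)" using \<epsilon>(1) by (simp add: powr_powr flip: powr_realpow)
    \<comment> \<open>As \<epsilon> \<le> 1 and N \<ge> 2, the gain grows at least like
      \<epsilon>^(-1/2), the square of the growth of the error terms.\<close>
    also have "\<dots> \<le> \<epsilon> powr ((1 - ?N) / 2)" using \<epsilon> dim by (intro powr_mono') auto
    finally have "c * (\<epsilon> powr (-1/4))\<^sup>2 \<le> c * \<epsilon> powr ((1 - ?N) / 2)" using c by simp
    also have "\<dots> = c0 * ?m * ?k * (\<epsilon> / ?N) ^ (DIM('a) - 1) * Q"
      unfolding p[symmetric] c_def by (simp add: power_divide)
    finally show ?thesis .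
  qed
  ultimately have "neumann_flux T \<Omega> P\<^sub>2 (u\<^sub>2 g) \<phi> < neumann_flux T \<Omega> P\<^sub>1 (u\<^sub>1 g) \<phi>" using small by linarith
  then show ?thesis using gG \<phi> tr by (intro bexI[of _ g] bexI[of _ \<phi>] conjI AE_I2) auto
qed

theorem theorem1:
  fixes \<Omega> \<Gamma>' \<Gamma>\<^sub>M :: "(real ^ 'n) set" and xbar :: "real ^ 'n" and k :: 'n
    and T \<epsilon>0 g_lo g_up C\<^sub>A C\<^sub>0 C\<^sub>G C\<^sub>U a_lo a_up t_star g_star :: real
    and P\<^sub>1 P\<^sub>2 :: "(real ^ 'n) pde_data"
    and u\<^sub>1 u\<^sub>2 :: "(real \<Rightarrow> real ^ 'n \<Rightarrow> real) \<Rightarrow> real \<Rightarrow> real ^ 'n \<Rightarrow> real"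
    and G :: "(real \<Rightarrow> real ^ 'n \<Rightarrow> real) set"
  assumes dim: "CARD('n) \<in> {2, 3}"
    and constants: "T > 0" "g_lo < g_up" "C\<^sub>A > 0" "C\<^sub>0 > 0" "C\<^sub>G > 0" "a_lo > 0" "a_up > 0"
    and geometry: "geometric_assumption \<Omega> \<Gamma>' xbar \<epsilon>0 (axis k 1)"
    and \<Gamma>\<^sub>M: "\<Gamma>\<^sub>M = ball xbar \<epsilon>0 \<inter> frontier \<Omega>"
    and G: "G = dirichlet_data T \<Omega> g_lo g_up C\<^sub>G"
    and C_G: "data_bound_large_enough T \<Omega> xbar \<epsilon>0 g_lo g_up C\<^sub>G"
    and coeff1: "coefficient_assumption T \<Omega> C\<^sub>A C\<^sub>0 a_lo a_up P\<^sub>1"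
    and coeff2: "coefficient_assumption T \<Omega> C\<^sub>A C\<^sub>0 a_lo a_up P\<^sub>2"
    and solv1: "solvability_assumption T \<Omega> G C\<^sub>U P\<^sub>1"
    and solv2: "solvability_assumption T \<Omega> G C\<^sub>U P\<^sub>2"
    and sol1: "\<And>g. g \<in> G \<Longrightarrow> weak_solution T \<Omega> P\<^sub>1 g (u\<^sub>1 g)"
    and sol2: "\<And>g. g \<in> G \<Longrightarrow> weak_solution T \<Omega> P\<^sub>2 g (u\<^sub>2 g)"
    and differ: "0 < t_star" "t_star < T" "g_lo \<le> g_star" "g_star \<le> g_up"
      "coef_a P\<^sub>1 t_star g_star \<noteq> coef_a P\<^sub>2 t_star g_star"
  shows "\<exists>g\<in>G. \<not> vanishes_on T \<Omega> \<Gamma>\<^sub>M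
           (\<lambda>\<phi>. neumann_flux T \<Omega> P\<^sub>1 (u\<^sub>1 g) \<phi> - neumann_flux T \<Omega> P\<^sub>2 (u\<^sub>2 g) \<phi>)"
proof -
  have dim': "2 \<le> DIM(real ^ 'n)" "DIM(real ^ 'n) \<le> 3" using dim by auto
  have e: "axis k (1::real) \<in> Basis" by (simp add: axis_in_Basis_iff)
  \<comment> \<open>The estimate is one-sided, so the problem with the larger leading coefficient
    takes the first place in \<open>flux_difference\<close>.\<close>
  consider "coef_a P\<^sub>2 t_star g_star < coef_a P\<^sub>1 t_star g_star" | "coef_a P\<^sub>1 t_star g_star < coef_a P\<^sub>2 t_star g_star"
    using differ(5) by linarith
  moreover have sol: "\<forall>g\<in>dirichlet_data T \<Omega> g_lo g_up C\<^sub>G. weak_solution T \<Omega> P\<^sub>1 g (u\<^sub>1 g)"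
    "\<forall>g\<in>dirichlet_data T \<Omega> g_lo g_up C\<^sub>G. weak_solution T \<Omega> P\<^sub>2 g (u\<^sub>2 g)"
    using sol1 sol2 by (auto simp: G)
  ultimately show ?thesis
  proof cases
    case 1
    from flux_difference[OF dim' e constants(1-3,6) geometry C_G coeff1 coeff2 solv1[unfolded G] solv2[unfolded G]
        sol(1) sol(2) differ(1-4) 1]
    obtain g \<phi> where g: "g \<in> G" and \<phi>: "\<phi> \<in> H10X T (lebesgue_on \<Omega>) (H1_grad \<Omega>)"
      "AE t in time T. \<exists>h. has_trace \<Omega> (\<phi> t) h \<and> (AE x in surface \<Omega>. x \<notin> \<Gamma>\<^sub>M \<longrightarrow> h x = 0)"
      "neumann_flux T \<Omega> P\<^sub>2 (u\<^sub>2 g) \<phi> < neumann_flux T \<Omega> P\<^sub>1 (u\<^sub>1 g) \<phi>"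
      unfolding G \<Gamma>\<^sub>M by (elim bexE conjE)
    have "\<not> vanishes_on T \<Omega> \<Gamma>\<^sub>M (\<lambda>\<phi>. neumann_flux T \<Omega> P\<^sub>1 (u\<^sub>1 g) \<phi> - neumann_flux T \<Omega> P\<^sub>2 (u\<^sub>2 g) \<phi>)"
    proof
      assume "vanishes_on T \<Omega> \<Gamma>\<^sub>M (\<lambda>\<phi>. neumann_flux T \<Omega> P\<^sub>1 (u\<^sub>1 g) \<phi> - neumann_flux T \<Omega> P\<^sub>2 (u\<^sub>2 g) \<phi>)"
      from this[unfolded vanishes_on_def, THEN bspec, OF \<phi>(1), THEN mp, OF \<phi>(2)] \<phi>(3) show False by simp
    qed
    then show ?thesis using g by (rule bexI)
  next
    case 2
    from flux_difference[OF dim' e constants(1-3,6) geometry C_G coeff2 coeff1 solv2[unfolded G] solv1[unfolded G]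
        sol(2) sol(1) differ(1-4) 2]
    obtain g \<phi> where g: "g \<in> G" and \<phi>: "\<phi> \<in> H10X T (lebesgue_on \<Omega>) (H1_grad \<Omega>)"
      "AE t in time T. \<exists>h. has_trace \<Omega> (\<phi> t) h \<and> (AE x in surface \<Omega>. x \<notin> \<Gamma>\<^sub>M \<longrightarrow> h x = 0)"
      "neumann_flux T \<Omega> P\<^sub>1 (u\<^sub>1 g) \<phi> < neumann_flux T \<Omega> P\<^sub>2 (u\<^sub>2 g) \<phi>"
      unfolding G \<Gamma>\<^sub>M by (elim bexE conjE)
    have "\<not> vanishes_on T \<Omega> \<Gamma>\<^sub>M (\<lambda>\<phi>. neumann_flux T \<Omega> P\<^sub>1 (u\<^sub>1 g) \<phi> - neumann_flux T \<Omega> P\<^sub>2 (u\<^sub>2 g) \<phi>)"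
    proof
      assume "vanishes_on T \<Omega> \<Gamma>\<^sub>M (\<lambda>\<phi>. neumann_flux T \<Omega> P\<^sub>1 (u\<^sub>1 g) \<phi> - neumann_flux T \<Omega> P\<^sub>2 (u\<^sub>2 g) \<phi>)"
      from this[unfolded vanishes_on_def, THEN bspec, OF \<phi>(1), THEN mp, OF \<phi>(2)] \<phi>(3) show False by simp
    qed
    then show ?thesis using g by (rule bexI)
  qed
qed

end
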